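(* Let $N\geq 2$ be an integer, let $0<\alpha\leq 2$ with $\alpha\neq N$, and let $E\subset\mathbb{R}^N$ be a compact set consisting of at least two points. Then there exists a unique positive unit Borel measure $\sigma_\alpha$ on $\mathbb{R}^N$ such that $$d_E(x)^{\alpha-N}=\int |x-t|^{\alpha-N}\,d\sigma_\alpha(t),\qquad x\in\mathbb{R}^N.$$
   Context: For a bounded set $E\subset\mathbb{R}^N$, the farthest distance function is $d_E(x):=\sup_{t\in E}|x-t|$, $x\in\mathbb{R}^N$, where $|\cdot|$ is the Euclidean norm. A unit measure is a measure of total mass $1$. *)

theory Defs
  imports "HOL-Analysis.Analysis" "HOL-Probability.Probability_Measure"
begin

definition farthest_dist :: "(real ^ 'n) set \<Rightarrow> real ^ 'n \<Rightarrow> real" where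
  "farthest_dist E x = (SUP t\<in>E. norm (x - t))"

text \<open>The kernel \<open>|x - t|\<^sup>\<alpha>\<^sup>-\<^sup>N\<close> for \<open>\<alpha> < N\<close> as an extended nonnegative function. Its value on the
  diagonal is infinity; this is spelled out because \<open>0 powr a = 0\<close> also for negative \<open>a\<close>.\<close>

definition riesz_kernel :: "real \<Rightarrow> real ^ 'n \<Rightarrow> real ^ 'n \<Rightarrow> ennreal" where
  "riesz_kernel \<alpha> x t =
     (if x = t then \<infinity> else ennreal (norm (x - t) powr (\<alpha> - real CARD('n))))"

end

(* Idea. Write N for the dimension and g_s for the Gaussian density of variance s. Up to a constant,
   |x|^(alpha-N) is the integral of s^(alpha/2-1) g_s(x) over s > 0, so that convolution with the Riesz
   kernel is a superposition of Gaussian averages, and identities between kernels reduce to identities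
   between weights on the time axis. Let nu_r be the law of the first value above r of a stable
   subordinator of index alpha/2. Averaging the Gaussians over nu_r gives an operator ("sweep") that
   removes from the kernel exactly the part of the integral with s <= r. In particular it diminishes
   every translate of the kernel, hence also the infimum u = d_E^(alpha-N) of the translates k(x - t),
   t in E, and (u - sweep u) / c_r is a nonnegative density whose potential is a short-time Gaussian
   average of u. A vague limit as r tends to 0 is the required measure. The weights are damped by
   exp(-l s) with l tending to 0, so that all functions are integrable before the limit; this makes the
   masses at most 1. That no mass is lost in the limit follows from the behaviour of Gaussian averages
   of u over growing scales. For uniqueness, k * sigma = u determines, by sweeping, the short-time
   Gaussian averages of sigma.

   Vague compactness is obtained from Helly's theorem on the real line, by coding a compact set by reals
   such that decoding is continuous. *)

theory Submission
  imports Defs "HOL-Probability.Helly_Selection" "HOL-Probability.Distributions"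
begin

subsection \<open>Weak and vague limits of probability measures\<close>

text \<open>The weight s^(\<gamma>-1), with \<gamma> = alpha/2, is up to a constant the potential
  density of a stable subordinator of index \<gamma>, which exists because alpha <= 2. Restarted at
  its first value above r, the process has the old potential restricted to (r, infinity), by the
  strong Markov property; hence averaging shifts of the weight over nu_r cuts the weight off at r.
  Two obstacles shape the construction. Undamped, u is not integrable and sweeping preserves mass,
  so the mass of u - sweep u has the form infinity - infinity. With damping, sweeping multiplies
  integrals by some q < 1, and the mass of the excess and the constant c_r are (1 - q) times the
  integrals of u and of the weight, which are comparable. Secondly, the kernel is infinite at its
  pole and cannot be tested against a vague limit. The potential identity is therefore swept once
  more at a fixed level epsilon: times beyond epsilon give a bounded continuous kernel that vanishes
  at infinity. Only after the vague limit does epsilon tend to 0.\<close>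

lemma base4_digits_agree:
  fixes p q :: "nat \<Rightarrow> real"
  assumes p: "\<And>n. p n \<in> {0, 1}" and q: "\<And>n. q n \<in> {0, 1}"
    and close: "\<bar>(\<Sum>n. p n * (1/4)^n) - (\<Sum>n. q n * (1/4)^n)\<bar> < (1/4)^J"
    and "j < J"
  shows "p j = q j"
proof (rule ccontr)
  assume ne: "p j \<noteq> q j"
  define d where "d n = p n - q n" for n
  have absd: "\<bar>d n\<bar> \<le> 1" for n using p[of n] q[of n] by (auto simp: d_def)
  have absp: "\<bar>p n\<bar> \<le> 1" and absq: "\<bar>q n\<bar> \<le> 1" for n
    using p[of n] q[of n] by auto
  \<comment> \<open>Base 4 with digits 0 and 1 leaves gaps: the first differing digit contributes
    4^(-i) and all later ones together at most a third of that, so the sums differ by more than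
    4^(-(i+1)) >= 4^(-J).\<close>
  define i where "i = (LEAST i. p i \<noteq> q i)"
  have i: "p i \<noteq> q i" unfolding i_def by (rule LeastI[of "\<lambda>i. p i \<noteq> q i", OF ne])
  have before: "d n = 0" if "n < i" for n
    using not_less_Least[of n "\<lambda>i. p i \<noteq> q i"] that by (auto simp: i_def d_def)
  have "i \<le> j" unfolding i_def by (rule Least_le[of "\<lambda>i. p i \<noteq> q i", OF ne])
  have di: "\<bar>d i\<bar> = 1" using i p[of i] q[of i] by (auto simp: d_def)
  have geo: "summable (\<lambda>n. (1/4::real)^n)" by (rule summable_geometric) simp
  have sp: "summable (\<lambda>n. p n * (1/4)^n)"
    by (rule summable_comparison_test'[OF geo, of 0]) (use absp in \<open>auto simp: abs_mult intro!: mult_left_le_one_le\<close>)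
  have sq: "summable (\<lambda>n. q n * (1/4)^n)"
    by (rule summable_comparison_test'[OF geo, of 0]) (use absq in \<open>auto simp: abs_mult intro!: mult_left_le_one_le\<close>)
  have sd: "summable (\<lambda>n. d n * (1/4)^n)"
    using summable_diff[OF sp sq] by (simp add: d_def left_diff_distrib)
  have diff: "(\<Sum>n. p n * (1/4)^n) - (\<Sum>n. q n * (1/4)^n) = (\<Sum>n. d n * (1/4)^n)"
    using suminf_diff[OF sp sq] by (simp add: d_def left_diff_distrib)
  have "(\<Sum>n. d n * (1/4)^n) = (\<Sum>n. d (n + Suc i) * (1/4)^(n + Suc i)) + (\<Sum>n<Suc i. d n * (1/4)^n)"
    by (rule suminf_split_initial_segment[OF sd])
  also have "(\<Sum>n<Suc i. d n * (1/4)^n) = d i * (1/4)^i"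
    by (simp add: before)
  finally have split: "(\<Sum>n. d n * (1/4)^n) = (\<Sum>n. d (n + Suc i) * (1/4)^(n + Suc i)) + d i * (1/4)^i" .
  have geo': "summable (\<lambda>n. (1/4::real)^(n + Suc i))"
    using summable_ignore_initial_segment[OF geo] .
  have "norm (\<Sum>n. d (n + Suc i) * (1/4)^(n + Suc i)) \<le> (\<Sum>n. (1/4::real)^(n + Suc i))"
    by (rule norm_suminf_le) (use absd geo' in \<open>auto simp: abs_mult intro!: mult_left_le_one_le\<close>)
  also have "(\<Sum>n. (1/4::real)^(n + Suc i)) = (1/4)^Suc i * (\<Sum>n. (1/4::real)^n)"
    using suminf_mult[OF geo, of "(1/4)^Suc i"] by (simp add: power_add mult_ac)
  also have "(\<Sum>n. (1/4::real)^n) = 4/3" by (subst suminf_geometric) auto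
  finally have "\<bar>\<Sum>n. d (n + Suc i) * (1/4)^(n + Suc i)\<bar> \<le> (1/4)^i / 3" by simp
  moreover have "\<bar>d i * (1/4)^i\<bar> = (1/4)^i" using di by (simp add: abs_mult)
  ultimately have "\<bar>\<Sum>n. d n * (1/4)^n\<bar> \<ge> (1/4)^i * (2/3)"
    unfolding split by linarith
  moreover have "(1/4::real)^J \<le> (1/4)^(Suc i)"
    using \<open>i \<le> j\<close> \<open>j < J\<close> by (intro power_decreasing) auto
  ultimately show False using close unfolding diff
    by simp
qed

text \<open>The value \<open>s x\<close> has the indicators of a countable basis at \<open>x\<close> as its base-4 digits.\<close>
lemma compact_real_code:
  fixes K :: "'a::{metric_space, second_countable_topology} set"
  assumes "compact K"
  obtains s :: "'a \<Rightarrow> real" where "s \<in> borel_measurable borel" "\<And>x. s x \<in> {0..2}"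
    "\<And>e. e > 0 \<Longrightarrow> \<exists>d>0. \<forall>x\<in>K. \<forall>y\<in>K. \<bar>s x - s y\<bar> < d \<longrightarrow> dist x y < e"
proof -
  obtain B :: "'a set set" where B: "countable B" "topological_basis B"
    using ex_countable_basis by blast
  have "B \<noteq> {}" using topological_basisE[OF B(2) open_UNIV UNIV_I] by blast
  define b where "b = from_nat_into B"
  have range_b: "range b = B" unfolding b_def by (rule range_from_nat_into[OF \<open>B \<noteq> {}\<close> B(1)])
  have open_b[measurable]: "open (b n)" for n
    using range_b topological_basis_open[OF B(2)] by auto
  have [measurable]: "b n \<in> sets borel" for n using open_b by auto
  define s where "s x = (\<Sum>n. indicator (b n) x * (1/4)^n :: real)" for x
  have geo: "summable (\<lambda>n. (1/4::real)^n)" by (rule summable_geometric) simp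
  have sm: "summable (\<lambda>n. indicator (b n) x * (1/4)^n :: real)" for x
    by (rule summable_comparison_test'[OF geo, of 0]) (auto simp: indicator_def)
  have "s x \<in> {0..2}" for x
  proof -
    have "s x \<le> (\<Sum>n. (1/4::real)^n)" unfolding s_def
      by (rule suminf_le[OF _ sm geo]) (auto simp: indicator_def)
    also have "\<dots> \<le> 2" by (subst suminf_geometric) auto
    finally show ?thesis using suminf_nonneg[OF sm] by (auto simp: s_def)
  qed
  moreover have "s \<in> borel_measurable borel" unfolding s_def by measurable
  moreover have "\<exists>d>0. \<forall>x\<in>K. \<forall>y\<in>K. \<bar>s x - s y\<bar> < d \<longrightarrow> dist x y < e" if e: "e > 0" for e
  proof -
    have "\<exists>n. x \<in> b n \<and> b n \<subseteq> ball x (e/2)" for x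
      using topological_basisE[OF B(2) open_ball, of x x "e/2"] e range_b
      by (metis centre_in_ball half_gt_zero rangeE)
    then obtain n where n: "\<And>x. x \<in> b (n x)" "\<And>x. b (n x) \<subseteq> ball x (e/2)" by metis
    obtain F where F: "F \<subseteq> K" "finite F" "K \<subseteq> (\<Union>x\<in>F. b (n x))"
      using compactE_image[OF \<open>compact K\<close>, of K "\<lambda>x. b (n x)"] n(1) open_b by blast
    \<comment> \<open>\<open>J\<close> exceeds the indices of the finitely many basis sets that
      cover \<open>K\<close>, so codes closer than 4^(-J) agree on membership in each of
      them.\<close>
    define J where "J = Suc (Max (n ` F \<union> {0}))"
    have J: "n x < J" if "x \<in> F" for x
      unfolding J_def using F(2) that by (auto simp: less_Suc_eq_le intro!: Max_ge)
    show ?thesis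
    proof (intro exI[of _ "(1/4)^J"] conjI ballI impI)
      fix x y assume xy: "x \<in> K" "y \<in> K" "\<bar>s x - s y\<bar> < (1/4)^J"
      then obtain z where z: "z \<in> F" "x \<in> b (n z)" using F by blast
      have "indicator (b (n z)) x = (indicator (b (n z)) y :: real)"
        by (rule base4_digits_agree[of "\<lambda>i. indicator (b i) x" "\<lambda>i. indicator (b i) y" J])
          (use xy J[OF z(1)] in \<open>auto simp: s_def indicator_def\<close>)
      then have "y \<in> b (n z)" using z by (auto simp: indicator_def split: if_splits)
      then have "dist z x < e/2" "dist z y < e/2" using z n(2) by (auto simp: subset_eq)
      then show "dist x y < e" by (metis dist_commute dist_triangle_half_l)
    qed auto
  qed
  ultimately show ?thesis using that by blast
qed

text \<open>The code \<open>s\<close> need not be continuous, but its inverse on the image of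
  \<open>K\<close> is uniformly continuous. It extends to the closure of the image and then, by
  Dugundji's theorem with values in the convex set \<open>K\<close>, to the whole line.\<close>

lemma compact_convex_real_parametrization:
  fixes K :: "'a::euclidean_space set"
  assumes "compact K" "convex K" "K \<noteq> {}"
  obtains s :: "'a \<Rightarrow> real" and p :: "real \<Rightarrow> 'a"
  where "s \<in> borel_measurable borel" "\<And>x. s x \<in> {0..2}"
    "continuous_on UNIV p" "range p \<subseteq> K" "\<And>x. x \<in> K \<Longrightarrow> p (s x) = x"
proof -
  obtain s :: "'a \<Rightarrow> real" where s: "s \<in> borel_measurable borel" "\<And>x. s x \<in> {0..2}"
    "\<And>e. e > 0 \<Longrightarrow> \<exists>d>0. \<forall>x\<in>K. \<forall>y\<in>K. \<bar>s x - s y\<bar> < d \<longrightarrow> dist x y < e"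
    using compact_real_code[OF assms(1)] by metis
  have inj: "inj_on s K"
  proof (rule inj_onI, rule ccontr)
    fix x y assume xy: "x \<in> K" "y \<in> K" "s x = s y" "x \<noteq> y"
    then show False using s(3)[of "dist x y"] by fastforce
  qed
  define q where "q = inv_into K s"
  have q: "q (s x) = x" if "x \<in> K" for x using that inj by (simp add: q_def)
  have "uniformly_continuous_on (s ` K) q"
    unfolding uniformly_continuous_on_def
  proof (intro allI impI)
    fix e :: real assume "e > 0"
    from s(3)[OF this] obtain d where "d > 0" "\<forall>x\<in>K. \<forall>y\<in>K. \<bar>s x - s y\<bar> < d \<longrightarrow> dist x y < e"
      by blast
    then show "\<exists>d>0. \<forall>x\<in>s ` K. \<forall>x'\<in>s ` K. dist x' x < d \<longrightarrow> dist (q x') (q x) < e"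
      by (intro exI[of _ d]) (auto simp: q dist_real_def)
  qed
  then obtain g where g: "uniformly_continuous_on (closure (s ` K)) g" "\<And>x. x \<in> s ` K \<Longrightarrow> q x = g x"
    using uniformly_continuous_on_extension_on_closure by metis
  have "g ` closure (s ` K) \<subseteq> K"
  proof -
    have "g ` closure (s ` K) \<subseteq> closure (g ` (s ` K))"
      using uniformly_continuous_imp_continuous[OF g(1)] closure_subset
      by (intro continuous_image_closure_subset) auto
    also have "g ` (s ` K) = K" using g(2) q by force
    also have "closure K = K" using assms(1) by (simp add: compact_imp_closed)
    finally show ?thesis .
  qed
  moreover have "closedin (top_of_set UNIV) (closure (s ` K))" by simp
  ultimately obtain p where p: "continuous_on UNIV p" "p ` UNIV \<subseteq> K" "\<And>x. x \<in> closure (s ` K) \<Longrightarrow> p x = g x"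
    using Dugundji[OF assms(2,3) _ uniformly_continuous_imp_continuous[OF g(1)]] by metis
  have "p (s x) = x" if "x \<in> K" for x
    using that p(3) g(2) q closure_subset by (metis image_eqI subsetD)
  then show ?thesis using that s p by blast
qed

text \<open>Push the measures to the line by \<open>s\<close>, where they live on [0, 2] and are
  tight, extract a limit by Helly's theorem, and bring it back by \<open>p\<close>. Only the way
  back has to be continuous: on the line the test function is \<open>f \<circ> p\<close>, and
  \<open>p (s x) = x\<close> on \<open>K\<close>.\<close>

lemma compact_convex_subseq_weak_limit:
  fixes \<tau> :: "nat \<Rightarrow> 'a::euclidean_space measure"
  assumes K: "compact K" "convex K"
    and \<tau>: "\<And>n. prob_space (\<tau> n)" "\<And>n. sets (\<tau> n) = sets borel" "\<And>n. AE x in \<tau> n. x \<in> K"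
  obtains r :: "nat \<Rightarrow> nat" and \<mu> where "strict_mono r" "prob_space \<mu>" "sets \<mu> = sets borel"
    "\<And>f :: 'a \<Rightarrow> real. continuous_on K f \<Longrightarrow> f \<in> borel_measurable borel \<Longrightarrow>
       (\<lambda>n. \<integral>x. f x \<partial>\<tau> (r n)) \<longlonglongrightarrow> (\<integral>x. f x \<partial>\<mu>)" "AE x in \<mu>. x \<in> K"
proof -
  have "K \<noteq> {}" 
  proof
    assume "K = {}"
    then have "AE x in \<tau> 0. False" using \<tau>(3)[of 0] by simp
    then show False using prob_space.not_empty[OF \<tau>(1)[of 0]] prob_space.AE_const[OF \<tau>(1)[of 0]] by simp
  qed
  obtain s :: "'a \<Rightarrow> real" and p where s: "s \<in> borel_measurable borel" "\<And>x. s x \<in> {0..2}"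
    and p: "continuous_on UNIV p" "range p \<subseteq> K" "\<And>x. x \<in> K \<Longrightarrow> p (s x) = x"
    by (rule compact_convex_real_parametrization[OF K \<open>K \<noteq> {}\<close>]) (rule that)
  note [measurable] = s(1)
  have [measurable]: "p \<in> borel_measurable borel" by (rule borel_measurable_continuous_onI[OF p(1)])
  have [measurable_cong]: "sets (\<tau> n) = sets borel" for n by (rule \<tau>)
  define M where "M n = distr (\<tau> n) borel s" for n
  have M: "real_distribution (M n)" for n
    unfolding M_def by (rule prob_space.real_distribution_distr[OF \<tau>(1)]) simp
  have "tight M"
    unfolding tight_def
  proof (intro conjI allI impI)
    fix e :: real assume "e > 0"
    have sx: "-1 < s x \<and> s x \<le> 3" for x using s(2)[of x] by auto
    have "measure (M n) {-1<..3} = 1" for n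
    proof -
      interpret prob_space "\<tau> n" by (rule \<tau>)
      have "measure (M n) {-1<..3} = measure (\<tau> n) (space (\<tau> n))"
        unfolding M_def using sx by (subst measure_distr) (auto intro!: arg_cong2[where f=measure])
      then show ?thesis by (simp add: prob_space)
    qed
    then show "\<exists>a b. a < b \<and> (\<forall>n. 1 - e < Sigma_Algebra.measure (M n) {a<..b})"
      using \<open>e > 0\<close> by (intro exI[of _ "-1"] exI[of _ 3]) auto
  qed (rule M)
  then obtain r L where rL: "strict_mono r" "real_distribution L" "weak_conv_m (M \<circ> id \<circ> r) L"
    using tight_imp_convergent_subsubsequence[of M id] by (auto simp: strict_mono_def)
  interpret L: real_distribution L by fact
  define \<mu> where "\<mu> = distr L borel p"
  show ?thesis
  proof (rule that)
    show "strict_mono r" by fact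
    show "prob_space \<mu>" unfolding \<mu>_def by (rule L.prob_space_distr) simp
    show "sets \<mu> = sets borel" by (simp add: \<mu>_def)
    have Kb: "K \<in> sets borel" using K(1) by (simp add: compact_imp_closed borel_closed)
    show "AE x in \<mu>. x \<in> K" unfolding \<mu>_def
      using p(2) Kb by (subst AE_distr_iff) (auto simp: pred_def)
    fix f :: "'a \<Rightarrow> real" assume f: "continuous_on K f" and [measurable]: "f \<in> borel_measurable borel"
    have fp: "continuous_on UNIV (f \<circ> p)" 
      using continuous_on_compose[OF p(1)] continuous_on_subset[OF f p(2)] by blast
    obtain c where c: "\<And>x. x \<in> K \<Longrightarrow> norm (f x) \<le> c"
      using compact_imp_bounded[OF compact_continuous_image[OF f K(1)]] by (auto simp: bounded_iff)
    have "(\<lambda>n. integral\<^sup>L ((M \<circ> id \<circ> r) n) (f \<circ> p)) \<longlonglongrightarrow> integral\<^sup>L L (f \<circ> p)"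
      by (rule weak_conv_imp_integral_bdd_continuous_conv[of _ _ _ c])
        (use rL fp p(2) c M in \<open>auto simp: continuous_on_eq_continuous_at o_def image_subset_iff\<close>)
    also have "integral\<^sup>L L (f \<circ> p) = (\<integral>x. f x \<partial>\<mu>)"
      unfolding \<mu>_def by (subst integral_distr) (auto simp: o_def)
    also have "(\<lambda>n. integral\<^sup>L ((M \<circ> id \<circ> r) n) (f \<circ> p)) = (\<lambda>n. \<integral>x. f x \<partial>\<tau> (r n))"
    proof
      fix n
      have "integral\<^sup>L ((M \<circ> id \<circ> r) n) (f \<circ> p) = (\<integral>x. f (p (s x)) \<partial>\<tau> (r n))"
        unfolding M_def by (simp, subst integral_distr) auto
      also have "\<dots> = (\<integral>x. f x \<partial>\<tau> (r n))"
        by (rule integral_cong_AE) (use \<tau>(3)[of "r n"] p(3) in auto)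
      finally show "integral\<^sup>L ((M \<circ> id \<circ> r) n) (f \<circ> p) = (\<integral>x. f x \<partial>\<tau> (r n))" .
    qed
    finally show "(\<lambda>n. \<integral>x. f x \<partial>\<tau> (r n)) \<longlonglongrightarrow> (\<integral>x. f x \<partial>\<mu>)" .
  qed
qed

text \<open>Compactify by \<open>x \<mapsto> x / (1 + |x|)\<close>; the part of the limit measure on the unit sphere is the mass
  that escapes to infinity.\<close>
lemma vague_limit_subseq:
  fixes \<tau> :: "nat \<Rightarrow> 'a::euclidean_space measure"
  assumes \<tau>: "\<And>n. prob_space (\<tau> n)" "\<And>n. sets (\<tau> n) = sets borel"
  obtains r :: "nat \<Rightarrow> nat" and \<sigma> where "strict_mono r" "sets \<sigma> = sets borel" "emeasure \<sigma> UNIV \<le> 1"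
    "\<And>f :: 'a \<Rightarrow> real. continuous_on UNIV f \<Longrightarrow> (f \<longlongrightarrow> 0) at_infinity \<Longrightarrow>
       (\<lambda>n. \<integral>x. f x \<partial>\<tau> (r n)) \<longlonglongrightarrow> (\<integral>x. f x \<partial>\<sigma>)"
proof -
  note [measurable_cong] = \<tau>(2)
  define h :: "'a \<Rightarrow> 'a" where "h x = x /\<^sub>R (1 + norm x)" for x
  define j :: "'a \<Rightarrow> 'a" where "j y = y /\<^sub>R (1 - norm y)" for y
  have [measurable]: "h \<in> borel_measurable borel" "j \<in> borel_measurable borel"
    unfolding h_def j_def by measurable
  have norm_h: "norm (h x) < 1" for x by (simp add: h_def divide_simps add_pos_nonneg)
  have jh: "j (h x) = x" for x
  proof -
    have "1 - norm (h x) = 1 / (1 + norm x)"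
      by (simp add: h_def field_simps add_pos_nonneg add_nonneg_eq_0_iff)
    then show ?thesis by (simp add: j_def h_def add_nonneg_eq_0_iff)
  qed
  define \<tau>' where "\<tau>' n = distr (\<tau> n) borel h" for n
  have 1: "prob_space (\<tau>' n)" for n
    unfolding \<tau>'_def by (rule prob_space.prob_space_distr[OF \<tau>(1)]) simp
  have 2: "sets (\<tau>' n) = sets borel" for n by (simp add: \<tau>'_def)
  have 3: "AE x in \<tau>' n. x \<in> cball 0 1" for n
    unfolding \<tau>'_def using norm_h by (subst AE_distr_iff) (auto simp: less_imp_le)
  obtain r :: "nat \<Rightarrow> nat" and \<mu> where r: "strict_mono r" and \<mu>: "prob_space \<mu>" "sets \<mu> = sets borel"
    and lim: "\<And>f :: 'a \<Rightarrow> real. continuous_on (cball 0 1) f \<Longrightarrow> f \<in> borel_measurable borel \<Longrightarrow>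
       (\<lambda>n. \<integral>x. f x \<partial>\<tau>' (r n)) \<longlonglongrightarrow> (\<integral>x. f x \<partial>\<mu>)"
    by (rule compact_convex_subseq_weak_limit[OF compact_cball convex_cball 1 2 3]) (rule that)
  note [measurable_cong] = \<mu>(2)
  interpret \<mu>: prob_space \<mu> by fact
  define \<sigma> where "\<sigma> = distr (density \<mu> (indicator (ball 0 1))) borel j"
  show ?thesis
  proof (rule that)
    show "strict_mono r" by fact
    show "sets \<sigma> = sets borel" by (simp add: \<sigma>_def)
    have "emeasure \<sigma> UNIV = emeasure (density \<mu> (indicator (ball 0 1))) (space \<mu>)"
      unfolding \<sigma>_def using sets_eq_imp_space_eq[OF \<mu>(2)] by (subst emeasure_distr) auto
    also have "\<dots> = emeasure \<mu> (ball 0 1)"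
      using sets_eq_imp_space_eq[OF \<mu>(2)] by (subst emeasure_density) (auto simp: \<mu>(2) intro!: borel_measurable_indicator)
    also have "\<dots> \<le> 1" by (rule \<mu>.emeasure_le_1)
    finally show "emeasure \<sigma> UNIV \<le> 1" .
    fix f :: "'a \<Rightarrow> real" assume f: "continuous_on UNIV f" and f0: "(f \<longlongrightarrow> 0) at_infinity"
    have [measurable]: "f \<in> borel_measurable borel" by (rule borel_measurable_continuous_onI[OF f])
    \<comment> \<open>Transplanted to the open ball, \<open>f\<close> extends continuously by 0 to
      the sphere because it vanishes at infinity; the indicator supplies this value.\<close>
    define F where "F y = indicator (ball 0 1) y * f (j y)" for y
    have [measurable]: "F \<in> borel_measurable borel" unfolding F_def
      by (intro borel_measurable_times borel_measurable_indicator measurable_compose[of j borel borel f]) auto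
    have "continuous_on (cball 0 1) F"
      unfolding continuous_on_eq_continuous_within
    proof
      fix y :: 'a assume y: "y \<in> cball 0 1"
      show "continuous (at y within cball 0 1) F"
      proof (cases "norm y < 1")
        case True
        have "continuous_on (ball 0 1) j" unfolding j_def by (auto intro!: continuous_intros)
        then have "continuous_on (ball 0 1) (\<lambda>y. f (j y))"
          by (rule continuous_on_compose2[OF f]) auto
        then have "continuous_on (ball 0 1) F"
          by (rule continuous_on_eq) (auto simp: F_def)
        then have "isCont F y" using True by (simp add: continuous_on_eq_continuous_at)
        then show ?thesis by (rule continuous_at_imp_continuous_at_within)
      next
        case False
        with y have ny: "norm y = 1" by simp
        have "(F \<longlongrightarrow> 0) (at y within cball 0 1)"
        proof (rule tendstoI)
          fix e :: real assume e: "e > 0"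
          from tendstoD[OF f0 e] obtain b where b: "\<And>x. norm x \<ge> b \<Longrightarrow> \<bar>f x\<bar> < e"
            by (auto simp: eventually_at_infinity dist_real_def)
          \<comment> \<open>\<open>c\<close> is the norm of the image under \<open>h\<close> of a
            point of norm |b|; hence \<open>j z\<close> has norm at least |b| once \<open>z\<close>
            is in the ball and has norm above \<open>c\<close>.\<close>
          define c where "c = \<bar>b\<bar> / (1 + \<bar>b\<bar>)"
          have "c < norm y" unfolding ny c_def by (simp add: divide_simps)
          then have "eventually (\<lambda>z. c < norm z) (at y within cball 0 1)"
            by (rule order_tendstoD(1)[OF tendsto_norm[OF tendsto_ident_at]])
          then show "eventually (\<lambda>z. dist (F z) 0 < e) (at y within cball 0 1)"
          proof eventually_elim
            case (elim z)
            show ?case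
            proof (cases "norm z < 1")
              case True
              have "\<bar>b\<bar> * (1 - norm z) \<le> norm z"
                using elim by (simp add: c_def field_simps add_pos_nonneg)
              then have "\<bar>b\<bar> \<le> norm (j z)" using True by (simp add: j_def field_simps)
              then show ?thesis using b[of "j z"] True by (simp add: F_def)
            qed (simp add: F_def e)
          qed
        qed
        moreover have "F y = 0" using ny by (simp add: F_def)
        ultimately show ?thesis by (simp add: continuous_within)
      qed
    qed
    from lim[OF this] have "(\<lambda>n. \<integral>x. F x \<partial>\<tau>' (r n)) \<longlonglongrightarrow> (\<integral>x. F x \<partial>\<mu>)" by simp
    also have "(\<integral>x. F x \<partial>\<mu>) = (\<integral>x. f x \<partial>\<sigma>)"
    proof -
      have "(\<integral>x. f x \<partial>\<sigma>) = (\<integral>x. f (j x) \<partial>density \<mu> (\<lambda>y. ennreal (indicator (ball 0 1) y)))"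
        unfolding \<sigma>_def ennreal_indicator[symmetric] by (rule integral_distr) auto
      also have "\<dots> = (\<integral>x. indicator (ball 0 1) x *\<^sub>R f (j x) \<partial>\<mu>)"
        by (rule integral_density[of "\<lambda>x. f (j x)" \<mu> "indicator (ball 0 1)"])
          (auto intro!: borel_measurable_indicator measurable_compose[of j _ borel f] simp: \<mu>(2))
      finally show ?thesis by (simp add: F_def)
    qed
    also have "(\<lambda>n. \<integral>x. F x \<partial>\<tau>' (r n)) = (\<lambda>n. \<integral>x. f x \<partial>\<tau> (r n))"
      unfolding \<tau>'_def
      by (subst integral_distr[OF _ \<open>F \<in> borel_measurable borel\<close>]) (simp_all add: F_def jh norm_h)
    finally show "(\<lambda>n. \<integral>x. f x \<partial>\<tau> (r n)) \<longlonglongrightarrow> (\<integral>x. f x \<partial>\<sigma>)" .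
  qed
qed

text \<open>Closed sets form an intersection-stable generator, and the indicator of a nonempty
  closed set \<open>C\<close> is the limit of the bounded continuous functions
  \<open>max 0 (1 - n * infdist x C)\<close>.\<close>

lemma measure_eqI_bounded_continuous:
  fixes \<mu> \<nu> :: "'a::metric_space measure"
  assumes \<mu>: "finite_measure \<mu>" "sets \<mu> = sets borel" and \<nu>: "finite_measure \<nu>" "sets \<nu> = sets borel"
    and eq: "\<And>f :: 'a \<Rightarrow> real. continuous_on UNIV f \<Longrightarrow> (\<And>x. 0 \<le> f x \<and> f x \<le> 1) \<Longrightarrow>
      (\<integral>\<^sup>+x. ennreal (f x) \<partial>\<mu>) = (\<integral>\<^sup>+x. ennreal (f x) \<partial>\<nu>)"
  shows "\<mu> = \<nu>"
proof -
  have closed_eq: "emeasure \<mu> C = emeasure \<nu> C" if C: "closed C" for C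
  \<comment> \<open>\<open>infdist\<close> to the empty set is 0 by convention, so the approximating
    functions would be 1 instead of tending to 0.\<close>
  proof (cases "C = {}")
    case False
    define f where "f n x = max 0 (1 - real n * infdist x C)" for n x
    have cont: "continuous_on UNIV (f n)" for n unfolding f_def by (intro continuous_intros)
    have [measurable]: "f n \<in> borel_measurable borel" for n by (rule borel_measurable_continuous_onI[OF cont])
    have bound: "0 \<le> f n x \<and> f n x \<le> 1" for n x by (auto simp: f_def infdist_nonneg)
    have lim: "(\<lambda>n. f n x) \<longlonglongrightarrow> indicator C x" for x
    proof (cases "x \<in> C")
      case True then show ?thesis by (simp add: f_def)
    next
      case x: False
      then have pos: "infdist x C > 0"
        using in_closed_iff_infdist_zero[OF C False, of x] infdist_nonneg[of x C] by linarith
      obtain m where m: "real m * infdist x C > 1" using ex_less_of_nat_mult[OF pos, of 1] by auto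
      have "eventually (\<lambda>n. f n x = indicator C x) sequentially"
        using eventually_ge_at_top[of m]
      proof eventually_elim
        case (elim n)
        then have "real m * infdist x C \<le> real n * infdist x C"
          using pos by (intro mult_right_mono) auto
        with m x show ?case by (simp add: f_def)
      qed
      then show ?thesis by (rule tendsto_eventually)
    qed
    have L: "(\<lambda>n. \<integral>\<^sup>+x. ennreal (f n x) \<partial>\<kappa>) \<longlonglongrightarrow> emeasure \<kappa> C"
      if \<kappa>: "finite_measure \<kappa>" "sets \<kappa> = sets borel" for \<kappa> :: "'a measure"
    proof -
      interpret finite_measure \<kappa> by fact
      note [measurable_cong] = \<kappa>(2)
      have [measurable]: "C \<in> sets borel" using C by auto
      have "(\<lambda>n. \<integral>\<^sup>+x. ennreal (f n x) \<partial>\<kappa>) \<longlonglongrightarrow> (\<integral>\<^sup>+x. ennreal (indicator C x) \<partial>\<kappa>)"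
        by (rule nn_integral_dominated_convergence[where w="\<lambda>_. 1"])
          (auto simp: bound lim less_top[symmetric])
      then show ?thesis using \<kappa>(2) by (simp add: ennreal_indicator)
    qed
    show ?thesis
      using LIMSEQ_unique[OF L[OF \<mu>]] L[OF \<nu>] eq[OF cont bound] by simp
  qed simp
  show ?thesis
  proof (rule measure_eqI_generator_eq[where E="Collect closed" and \<Omega>=UNIV and A="\<lambda>_. UNIV"])
    show "Int_stable (Collect closed)" by (auto simp: Int_stable_def)
    show "sets \<mu> = sigma_sets UNIV (Collect closed)" "sets \<nu> = sigma_sets UNIV (Collect closed)"
      by (simp_all add: \<mu> \<nu> borel_eq_closed)
    show "emeasure \<mu> UNIV \<noteq> \<infinity>"
      using finite_measure.finite_emeasure_space[OF \<mu>(1)] sets_eq_imp_space_eq[OF \<mu>(2)] by simp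
  qed (auto simp: closed_eq)
qed

subsection \<open>The Gaussian semigroup\<close>

definition gauss :: "real \<Rightarrow> 'a::euclidean_space \<Rightarrow> real" where
  "gauss s x = (2 * pi * s) powr (- (real DIM('a) / 2)) * exp (- (norm x)\<^sup>2 / (2 * s))"

lemma gauss_measurable[measurable (raw)]:
  assumes [measurable]: "f \<in> borel_measurable M" "g \<in> borel_measurable M"
  shows "(\<lambda>x. gauss (f x) (g x)) \<in> borel_measurable M"
  unfolding gauss_def by measurable

lemma gauss_nonneg[simp]: "0 \<le> gauss s x"
  by (simp add: gauss_def)

lemma gauss_pos: "0 < s \<Longrightarrow> 0 < gauss s x"
  by (simp add: gauss_def)

lemma gauss_mono:
  fixes x y :: "'a::euclidean_space"
  shows "0 < s \<Longrightarrow> norm x \<le> norm y \<Longrightarrow> gauss s y \<le> gauss s x"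
  by (simp add: gauss_def divide_right_mono power_mono)

lemma gauss_minus_commute: "gauss s (x - y) = gauss s (y - x)"
  by (simp add: gauss_def norm_minus_commute)

text \<open>Total mass and convolution of Gaussians are inherited through this product from normal
  densities on the line.\<close>

lemma gauss_eq_prod:
  fixes x :: "'a::euclidean_space"
  assumes s: "0 < s"
  shows "gauss s x = (\<Prod>b\<in>Basis. normal_density 0 (sqrt s) (x \<bullet> b))"
proof -
  have nd: "normal_density 0 (sqrt s) u = 1 / sqrt (2 * pi * s) * exp (- u\<^sup>2 / (2 * s))" for u
    using s by (simp add: normal_density_def)
  have "(\<Prod>b\<in>Basis. normal_density 0 (sqrt s) (x \<bullet> b)) =
      (\<Prod>b\<in>(Basis::'a set). 1 / sqrt (2 * pi * s)) * exp (\<Sum>b\<in>Basis. - (x \<bullet> b)\<^sup>2 / (2 * s))"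
    unfolding nd prod.distrib exp_sum[OF finite_Basis] by (rule refl)
  also have "(\<Sum>b\<in>Basis. - (x \<bullet> b)\<^sup>2 / (2 * s)) = - (norm x)\<^sup>2 / (2 * s)"
  proof -
    have "(norm x)\<^sup>2 = (\<Sum>b\<in>Basis. (x \<bullet> b)\<^sup>2)"
      by (subst power2_norm_eq_inner, subst euclidean_inner) (simp add: power2_eq_square)
    then show ?thesis by (simp add: sum_divide_distrib sum_negf)
  qed
  also have "(\<Prod>b\<in>(Basis::'a set). 1 / sqrt (2 * pi * s)) = (2 * pi * s) powr (- (real DIM('a) / 2))"
  proof -
    have "1 / sqrt (2 * pi * s) = (2 * pi * s) powr (- (1/2))"
      using s by (simp add: powr_minus_divide powr_half_sqrt)
    then show ?thesis using s
      by (simp add: powr_realpow[symmetric] powr_powr)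
  qed
  finally show ?thesis by (simp add: gauss_def)
qed

lemma nn_integral_lborel_affine:
  fixes f :: "'a::euclidean_space \<Rightarrow> ennreal"
  assumes [measurable]: "f \<in> borel_measurable borel" and c: "c \<noteq> 0"
  shows "(\<integral>\<^sup>+x. f x \<partial>lborel) = ennreal (\<bar>c\<bar> ^ DIM('a)) * (\<integral>\<^sup>+x. f (t + c *\<^sub>R x) \<partial>lborel)"
  by (subst lborel_affine[OF c, of t])
    (simp add: nn_integral_density nn_integral_distr nn_integral_cmult)

lemma nn_integral_lborel_shift:
  fixes f :: "'a::euclidean_space \<Rightarrow> ennreal"
  assumes [measurable]: "f \<in> borel_measurable borel"
  shows "(\<integral>\<^sup>+x. f (x - t) \<partial>lborel) = (\<integral>\<^sup>+x. f x \<partial>lborel)"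
  using nn_integral_lborel_affine[OF assms, of 1 "- t"] by simp

lemma nn_integral_lborel_reflect:
  fixes f :: "'a::euclidean_space \<Rightarrow> ennreal"
  assumes [measurable]: "f \<in> borel_measurable borel"
  shows "(\<integral>\<^sup>+x. f (t - x) \<partial>lborel) = (\<integral>\<^sup>+x. f x \<partial>lborel)"
  using nn_integral_lborel_affine[OF assms, of "-1" t] by simp

lemma nn_integral_gauss: "0 < s \<Longrightarrow> (\<integral>\<^sup>+x. gauss s (x :: 'a::euclidean_space) \<partial>lborel) = 1"
proof -
  assume s: "0 < s"
  have "(\<integral>\<^sup>+x. gauss s (x :: 'a) \<partial>lborel) =
      (\<integral>\<^sup>+x. (\<Prod>b\<in>Basis. ennreal (normal_density 0 (sqrt s) ((x::'a) \<bullet> b))) \<partial>lborel)"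
    using s by (simp add: gauss_eq_prod prod_ennreal normal_density_nonneg)
  also have "\<dots> = (\<Prod>b\<in>(Basis::'a set). \<integral>\<^sup>+x. normal_density 0 (sqrt s) x \<partial>lborel)"
    by (rule nn_integral_lborel_prod) auto
  also have "\<dots> = 1"
    using s by (simp add: nn_integral_eq_integral normal_density_nonneg)
  finally show ?thesis .
qed

lemma gauss_convolution:
  fixes x z :: "'a::euclidean_space"
  assumes "0 < s" "0 < t"
  shows "(\<integral>\<^sup>+y. ennreal (gauss s (x - y)) * ennreal (gauss t (y - z)) \<partial>lborel) = gauss (s + t) (x - z)"
proof -
  have "(\<integral>\<^sup>+y. ennreal (gauss s (x - y)) * ennreal (gauss t (y - z)) \<partial>lborel) =
      (\<integral>\<^sup>+y. ennreal (gauss s ((x - z) - (y - z))) * ennreal (gauss t (y - z)) \<partial>lborel)"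
    by simp
  also have "\<dots> = (\<integral>\<^sup>+y. ennreal (gauss s ((x - z) - y)) * ennreal (gauss t y) \<partial>lborel)"
    by (rule nn_integral_lborel_shift) simp
  also have "\<dots> = (\<integral>\<^sup>+y. (\<Prod>b\<in>Basis. (\<lambda>u. ennreal (normal_density 0 (sqrt s) ((x - z) \<bullet> b - u) * normal_density 0 (sqrt t) u)) (y \<bullet> b)) \<partial>lborel)"
    using assms
    by (intro nn_integral_cong)
      (simp add: gauss_eq_prod prod_ennreal normal_density_nonneg prod.distrib inner_diff_left ennreal_mult[symmetric] prod_nonneg)
  also have "\<dots> = (\<Prod>b\<in>(Basis::'a set). \<integral>\<^sup>+u. ennreal (normal_density 0 (sqrt s) ((x - z) \<bullet> b - u) * normal_density 0 (sqrt t) u) \<partial>lborel)"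
    by (rule nn_integral_lborel_prod) auto
  also have "\<dots> = (\<Prod>b\<in>(Basis::'a set). ennreal (normal_density 0 (sqrt (s + t)) ((x - z) \<bullet> b)))"
    using fun_cong[OF conv_normal_density_zero_mean[of "sqrt s" "sqrt t"]] assms by simp
  also have "\<dots> = gauss (s + t) (x - z)"
    using assms by (simp add: gauss_eq_prod prod_ennreal normal_density_nonneg)
  finally show ?thesis .
qed

lemma gauss_scale:
  fixes x :: "'a::euclidean_space"
  assumes "0 < c" "0 < s"
  shows "gauss (c\<^sup>2 * s) (c *\<^sub>R x) * c ^ DIM('a) = gauss s x"
proof -
  have "(2 * pi * (c\<^sup>2 * s)) powr (- (real DIM('a) / 2)) = (2 * pi * s) powr (- (real DIM('a) / 2)) * (c\<^sup>2) powr (- (real DIM('a) / 2))"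
    using assms by (simp add: powr_mult mult_ac)
  also have "(c\<^sup>2) powr (- (real DIM('a) / 2)) = c powr (- real DIM('a))"
    using assms powr_powr[of c 2 "- (real DIM('a) / 2)"] by simp
  also have "\<dots> = 1 / c ^ DIM('a)"
    using assms by (simp add: powr_minus_divide powr_realpow)
  finally have A: "(2 * pi * (c\<^sup>2 * s)) powr (- (real DIM('a) / 2)) * c ^ DIM('a) = (2 * pi * s) powr (- (real DIM('a) / 2))"
    using assms by simp
  have "gauss (c\<^sup>2 * s) (c *\<^sub>R x) * c ^ DIM('a) =
     ((2 * pi * (c\<^sup>2 * s)) powr (- (real DIM('a) / 2)) * c ^ DIM('a)) * exp (- (c\<^sup>2 * (norm x)\<^sup>2) / (2 * (c\<^sup>2 * s)))"
    using assms by (simp add: gauss_def power_mult_distrib mult_ac)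
  also have "- (c\<^sup>2 * (norm x)\<^sup>2) / (2 * (c\<^sup>2 * s)) = - (norm x)\<^sup>2 / (2 * s)"
    using assms by simp
  finally show ?thesis unfolding A by (simp add: gauss_def)
qed

section \<open>Gaussian averages of functions and measures\<close>

definition heat :: "real \<Rightarrow> ('a::euclidean_space \<Rightarrow> ennreal) \<Rightarrow> 'a \<Rightarrow> ennreal" where
  "heat s f x = (\<integral>\<^sup>+y. f y * ennreal (gauss s (x - y)) \<partial>lborel)"

lemma heat_measurable[measurable (raw)]:
  fixes f :: "'b \<Rightarrow> 'a::euclidean_space \<Rightarrow> ennreal"
  assumes [measurable]: "case_prod f \<in> borel_measurable (M \<Otimes>\<^sub>M borel)" "s \<in> borel_measurable M" "g \<in> borel_measurable M"
  shows "(\<lambda>w. heat (s w) (f w) (g w)) \<in> borel_measurable M"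
  unfolding heat_def by measurable

text \<open>The substitution y = x + sqrt s z moves the dependence on s from the Gaussian into the
  argument of \<open>f\<close>. Limits in s and homogeneity of \<open>f\<close> can then be used
  under one fixed Gaussian.\<close>

lemma heat_eq_std:
  fixes f :: "'a::euclidean_space \<Rightarrow> ennreal"
  assumes [measurable]: "f \<in> borel_measurable borel" and s: "0 < s"
  shows "heat s f x = (\<integral>\<^sup>+z. f (x + sqrt s *\<^sub>R z) * ennreal (gauss 1 z) \<partial>lborel)"
proof -
  have "heat s f x = ennreal (\<bar>sqrt s\<bar> ^ DIM('a)) *
      (\<integral>\<^sup>+z. f (x + sqrt s *\<^sub>R z) * ennreal (gauss s (x - (x + sqrt s *\<^sub>R z))) \<partial>lborel)"
    unfolding heat_def using s
    by (intro nn_integral_lborel_affine[of "\<lambda>y. f y * ennreal (gauss s (x - y))"]) auto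
  also have "\<dots> = (\<integral>\<^sup>+z. f (x + sqrt s *\<^sub>R z) * ennreal (gauss s (sqrt s *\<^sub>R z) * sqrt s ^ DIM('a)) \<partial>lborel)"
    using s by (subst nn_integral_cmult[symmetric])
      (auto simp: ennreal_mult mult_ac gauss_def intro!: nn_integral_cong)
  also have "\<dots> = (\<integral>\<^sup>+z. f (x + sqrt s *\<^sub>R z) * ennreal (gauss 1 z) \<partial>lborel)"
    using gauss_scale[where 'a='a, of "sqrt s" 1] s by simp
  finally show ?thesis .
qed

lemma heat_mono: "(\<And>y. f y \<le> g y) \<Longrightarrow> heat s f x \<le> heat s g x"
  unfolding heat_def by (intro nn_integral_mono mult_right_mono) auto

lemma heat_const: "0 < s \<Longrightarrow> heat s (\<lambda>_. c) (x::'a::euclidean_space) = c"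
  unfolding heat_def
  using nn_integral_lborel_reflect[of "\<lambda>y. ennreal (gauss s (y::'a))" x]
  by (simp add: nn_integral_cmult nn_integral_gauss)

lemma heat_le_const: "0 < s \<Longrightarrow> (\<And>y. f y \<le> c) \<Longrightarrow> heat s f x \<le> c"
  using heat_mono[of f "\<lambda>_. c" s x] by (simp add: heat_const)

lemma heat_gauss:
  "0 < s \<Longrightarrow> 0 < t \<Longrightarrow> heat s (\<lambda>y. ennreal (gauss t (y - z))) x = gauss (s + t) (x - z)"
  unfolding heat_def using gauss_convolution[of s t x z] by (simp add: mult.commute)

lemma nn_integral_heat:
  fixes f :: "'a::euclidean_space \<Rightarrow> ennreal"
  assumes [measurable]: "f \<in> borel_measurable borel" and s: "0 < s"
  shows "(\<integral>\<^sup>+x. heat s f x \<partial>lborel) = (\<integral>\<^sup>+x. f x \<partial>lborel)"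
proof -
  have "(\<integral>\<^sup>+x. heat s f x \<partial>lborel) = (\<integral>\<^sup>+y. \<integral>\<^sup>+x. f y * ennreal (gauss s (x - y)) \<partial>lborel \<partial>lborel)"
    unfolding heat_def by (rule lborel_pair.Fubini') measurable
  also have "\<dots> = (\<integral>\<^sup>+y. f y * (\<integral>\<^sup>+x. ennreal (gauss s (x - y)) \<partial>lborel) \<partial>lborel)"
    by (simp add: nn_integral_cmult)
  also have "\<dots> = (\<integral>\<^sup>+y. f y \<partial>lborel)"
    using s by (subst nn_integral_lborel_shift) (auto simp: nn_integral_gauss)
  finally show ?thesis .
qed

lemma tendsto_multc_ennreal:
  "(f \<longlongrightarrow> x) F \<Longrightarrow> ((\<lambda>n. f n * ennreal c) \<longlongrightarrow> x * ennreal c) F"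
  using ennreal_tendsto_cmult[of "ennreal c" f x F] by (simp add: mult.commute)

lemma heat_tendsto:
  fixes f :: "'a::euclidean_space \<Rightarrow> ennreal"
  assumes [measurable]: "f \<in> borel_measurable borel" and cont: "isCont f x"
    and bound: "\<And>y. f y \<le> c" and c: "c < \<infinity>"
  shows "((\<lambda>s. heat s f x) \<longlongrightarrow> f x) (at_right 0)"
  unfolding tendsto_at_iff_sequentially
proof (intro allI impI)
  fix X :: "nat \<Rightarrow> real" assume X: "\<forall>i. X i \<in> {0<..} - {0}" and lim: "X \<longlonglongrightarrow> 0"
  have "(\<lambda>i. \<integral>\<^sup>+z. f (x + sqrt (X i) *\<^sub>R z) * ennreal (gauss 1 z) \<partial>lborel) \<longlonglongrightarrow> (\<integral>\<^sup>+z. f x * ennreal (gauss 1 (z::'a)) \<partial>lborel)"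
  proof (rule nn_integral_dominated_convergence[where w="\<lambda>z::'a. c * ennreal (gauss 1 z)"])
    show "(\<integral>\<^sup>+z. c * ennreal (gauss 1 (z::'a)) \<partial>lborel) < \<infinity>"
      using c by (simp add: nn_integral_cmult nn_integral_gauss)
    have "(\<lambda>i. f (x + sqrt (X i) *\<^sub>R z)) \<longlonglongrightarrow> f x" for z
    proof (rule isCont_tendsto_compose[OF cont])
      have "(\<lambda>i. x + sqrt (X i) *\<^sub>R z) \<longlonglongrightarrow> x + sqrt 0 *\<^sub>R z"
        by (intro tendsto_intros lim)
      then show "(\<lambda>i. x + sqrt (X i) *\<^sub>R z) \<longlonglongrightarrow> x" by simp
    qed
    from tendsto_multc_ennreal[OF this] show "AE z in lborel. (\<lambda>i. f (x + sqrt (X i) *\<^sub>R z) * ennreal (gauss 1 z)) \<longlonglongrightarrow> f x * ennreal (gauss 1 z)"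
      by simp
  qed (auto intro!: mult_right_mono bound)
  also have "(\<lambda>i. \<integral>\<^sup>+z. f (x + sqrt (X i) *\<^sub>R z) * ennreal (gauss 1 z) \<partial>lborel) = (\<lambda>s. heat s f x) \<circ> X"
    using X by (auto simp: heat_eq_std fun_eq_iff)
  also have "(\<integral>\<^sup>+z. f x * ennreal (gauss 1 (z::'a)) \<partial>lborel) = f x"
    by (simp add: nn_integral_cmult nn_integral_gauss)
  finally show "((\<lambda>s. heat s f x) \<circ> X) \<longlonglongrightarrow> f x" .
qed

definition mheat :: "real \<Rightarrow> 'a::euclidean_space measure \<Rightarrow> 'a \<Rightarrow> ennreal" where
  "mheat s \<sigma> x = (\<integral>\<^sup>+y. ennreal (gauss s (x - y)) \<partial>\<sigma>)"

lemma mheat_measurable: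
  assumes \<sigma>: "sigma_finite_measure \<sigma>" "sets \<sigma> = sets borel"
    and [measurable]: "s \<in> borel_measurable M" "g \<in> borel_measurable M"
  shows "(\<lambda>w. mheat (s w) \<sigma> (g w)) \<in> borel_measurable M"
proof -
  interpret sigma_finite_measure \<sigma> by fact
  note [measurable_cong] = \<sigma>(2)
  show ?thesis unfolding mheat_def by measurable
qed

lemma heat_time_integral:
  fixes G :: "real \<Rightarrow> 'a::euclidean_space \<Rightarrow> ennreal"
  assumes [measurable]: "case_prod G \<in> borel_measurable (borel \<Otimes>\<^sub>M borel)" "w \<in> borel_measurable borel"
  shows "heat t (\<lambda>y. \<integral>\<^sup>+s. w s * G s y \<partial>lborel) x = (\<integral>\<^sup>+s. w s * heat t (G s) x \<partial>lborel)"
proof -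
  have "heat t (\<lambda>y. \<integral>\<^sup>+s. w s * G s y \<partial>lborel) x =
      (\<integral>\<^sup>+y. \<integral>\<^sup>+s. w s * (G s y * ennreal (gauss t (x - y))) \<partial>lborel \<partial>lborel)"
    unfolding heat_def by (subst nn_integral_multc[symmetric]) (auto simp: mult_ac)
  also have "\<dots> = (\<integral>\<^sup>+s. \<integral>\<^sup>+y. w s * (G s y * ennreal (gauss t (x - y))) \<partial>lborel \<partial>lborel)"
    by (rule lborel_pair.Fubini') measurable
  also have "\<dots> = (\<integral>\<^sup>+s. w s * heat t (G s) x \<partial>lborel)"
    unfolding heat_def by (simp add: nn_integral_cmult)
  finally show ?thesis .
qed

lemma heat_mheat:
  fixes \<sigma> :: "'a::euclidean_space measure"
  assumes \<sigma>: "sigma_finite_measure \<sigma>" "sets \<sigma> = sets borel" and st: "0 < s" "0 < t"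
  shows "heat t (mheat s \<sigma>) x = mheat (s + t) \<sigma> x"
proof -
  interpret \<sigma>: sigma_finite_measure \<sigma> by fact
  interpret pair_sigma_finite \<sigma> lborel ..
  note [measurable_cong] = \<sigma>(2)
  have "heat t (mheat s \<sigma>) x = (\<integral>\<^sup>+y. \<integral>\<^sup>+z. ennreal (gauss s (y - z)) * ennreal (gauss t (x - y)) \<partial>\<sigma> \<partial>lborel)"
    unfolding heat_def mheat_def by (simp add: nn_integral_multc)
  also have "\<dots> = (\<integral>\<^sup>+z. \<integral>\<^sup>+y. ennreal (gauss s (y - z)) * ennreal (gauss t (x - y)) \<partial>lborel \<partial>\<sigma>)"
    by (rule Fubini') measurable
  also have "\<dots> = mheat (s + t) \<sigma> x"
    unfolding mheat_def using gauss_convolution[OF st(2,1), of x] by (simp add: mult.commute add.commute)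
  finally show ?thesis .
qed

lemma heat_heat:
  fixes f :: "'a::euclidean_space \<Rightarrow> ennreal"
  assumes [measurable]: "f \<in> borel_measurable borel" and st: "0 < s" "0 < t"
  shows "heat t (heat s f) x = heat (s + t) f x"
proof -
  have "heat t (heat s f) x = (\<integral>\<^sup>+y. \<integral>\<^sup>+z. f z * (ennreal (gauss s (y - z)) * ennreal (gauss t (x - y))) \<partial>lborel \<partial>lborel)"
    unfolding heat_def by (subst nn_integral_multc[symmetric]) (auto simp: mult_ac)
  also have "\<dots> = (\<integral>\<^sup>+z. \<integral>\<^sup>+y. f z * (ennreal (gauss s (y - z)) * ennreal (gauss t (x - y))) \<partial>lborel \<partial>lborel)"
    by (rule lborel_pair.Fubini') measurable
  also have "\<dots> = heat (s + t) f x"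
    unfolding heat_def using gauss_convolution[OF st(2,1), of x]
    by (simp add: nn_integral_cmult) (simp add: mult.commute add.commute)
  finally show ?thesis .
qed

section \<open>Superpositions of Gaussian averages with weights on the time axis\<close>

definition avg :: "(real \<Rightarrow> ennreal) \<Rightarrow> ('a::euclidean_space \<Rightarrow> ennreal) \<Rightarrow> 'a \<Rightarrow> ennreal" where
  "avg w f x = (\<integral>\<^sup>+s. w s * heat s f x \<partial>lborel)"

definition mavg :: "(real \<Rightarrow> ennreal) \<Rightarrow> 'a::euclidean_space measure \<Rightarrow> 'a \<Rightarrow> ennreal" where
  "mavg w \<sigma> x = (\<integral>\<^sup>+s. w s * mheat s \<sigma> x \<partial>lborel)"

text \<open>The values are in \<open>ennreal\<close>, so that the kernel may be infinite at 0 and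
  integrals can be exchanged without integrability.\<close>

definition kern :: "(real \<Rightarrow> ennreal) \<Rightarrow> 'a::euclidean_space \<Rightarrow> ennreal" where
  "kern w x = (\<integral>\<^sup>+s. w s * ennreal (gauss s x) \<partial>lborel)"

lemma kern_measurable[measurable (raw)]:
  assumes [measurable]: "w \<in> borel_measurable borel" "g \<in> borel_measurable M"
  shows "(\<lambda>x. kern w (g x)) \<in> borel_measurable M"
  unfolding kern_def by measurable

lemma avg_measurable[measurable (raw)]:
  assumes [measurable]: "w \<in> borel_measurable borel" "f \<in> borel_measurable borel" "g \<in> borel_measurable M"
  shows "(\<lambda>x. avg w f (g x)) \<in> borel_measurable M"
  unfolding avg_def by measurable

lemma kern_minus_commute: "kern w (x - y) = kern w (y - x)"
  by (simp add: kern_def gauss_minus_commute[of _ x y])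

lemma mavg_eq_kern:
  assumes \<sigma>: "sigma_finite_measure \<sigma>" "sets \<sigma> = sets borel" and [measurable]: "w \<in> borel_measurable borel"
  shows "mavg w \<sigma> x = (\<integral>\<^sup>+y. kern w (x - y) \<partial>\<sigma>)"
proof -
  interpret \<sigma>: sigma_finite_measure \<sigma> by fact
  interpret pair_sigma_finite \<sigma> lborel ..
  note [measurable_cong] = \<sigma>(2)
  have "mavg w \<sigma> x = (\<integral>\<^sup>+s. \<integral>\<^sup>+y. w s * ennreal (gauss s (x - y)) \<partial>\<sigma> \<partial>lborel)"
    unfolding mavg_def mheat_def by (simp add: nn_integral_cmult)
  also have "\<dots> = (\<integral>\<^sup>+y. \<integral>\<^sup>+s. w s * ennreal (gauss s (x - y)) \<partial>lborel \<partial>\<sigma>)"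
    by (rule Fubini') measurable
  finally show ?thesis by (simp add: kern_def)
qed

lemma avg_eq_kern:
  fixes f :: "'a::euclidean_space \<Rightarrow> ennreal"
  assumes [measurable]: "f \<in> borel_measurable borel" and [measurable]: "w \<in> borel_measurable borel"
  shows "avg w f x = (\<integral>\<^sup>+y. f y * kern w (x - y) \<partial>lborel)"
proof -
  have "avg w f x = (\<integral>\<^sup>+s. \<integral>\<^sup>+y. f y * (w s * ennreal (gauss s (x - y))) \<partial>lborel \<partial>lborel)"
    unfolding avg_def heat_def by (subst nn_integral_cmult[symmetric]) (auto simp: mult_ac)
  also have "\<dots> = (\<integral>\<^sup>+y. \<integral>\<^sup>+s. f y * (w s * ennreal (gauss s (x - y))) \<partial>lborel \<partial>lborel)"
    by (rule lborel_pair.Fubini') measurable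
  finally show ?thesis by (simp add: kern_def nn_integral_cmult)
qed

lemma mheat_return: "mheat s (return borel t) x = ennreal (gauss s (x - t))"
  unfolding mheat_def by (subst nn_integral_return) auto

lemma mavg_return: "mavg w (return borel t) x = kern w (x - t)"
  by (simp add: mavg_def kern_def mheat_return)

lemma avg_le_const:
  fixes f :: "'a::euclidean_space \<Rightarrow> ennreal"
  assumes [measurable]: "w \<in> borel_measurable borel" and "\<And>s. s \<le> 0 \<Longrightarrow> w s = 0" "\<And>y. f y \<le> c"
  shows "avg w f x \<le> (\<integral>\<^sup>+s. w s \<partial>lborel) * c"
proof -
  have "w s * heat s f x \<le> w s * c" for s
    using assms heat_le_const[of s f c x] by (cases "0 < s") (auto intro!: mult_left_mono)
  then have "avg w f x \<le> (\<integral>\<^sup>+s. w s * c \<partial>lborel)"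
    unfolding avg_def by (rule nn_integral_mono)
  then show ?thesis by (simp add: nn_integral_multc)
qed

lemma avg_add:
  fixes f g :: "'a::euclidean_space \<Rightarrow> ennreal"
  assumes [measurable]: "w \<in> borel_measurable borel" "f \<in> borel_measurable borel" "g \<in> borel_measurable borel"
  shows "avg w (\<lambda>x. f x + g x) x = avg w f x + avg w g x"
  by (simp add: avg_eq_kern nn_integral_add distrib_right)

lemma avg_cmult:
  fixes f :: "'a::euclidean_space \<Rightarrow> ennreal"
  assumes [measurable]: "w \<in> borel_measurable borel" "f \<in> borel_measurable borel"
  shows "avg w (\<lambda>x. c * f x) x = c * avg w f x"
  by (simp add: avg_eq_kern nn_integral_cmult mult.assoc)

lemma avg_mono: "(\<And>y. f y \<le> g y) \<Longrightarrow> avg w f x \<le> avg w g x"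
  unfolding avg_def by (intro nn_integral_mono mult_left_mono heat_mono) auto

text \<open>Duality, by Tonelli and the symmetry of the kernel: the averaging passes from the
  measure to the test function. Uniqueness of the equilibrium measure rests on it.\<close>

lemma nn_integral_mavg:
  fixes f :: "'a::euclidean_space \<Rightarrow> ennreal" and \<sigma> :: "'a measure"
  assumes [measurable]: "f \<in> borel_measurable borel" "w \<in> borel_measurable borel"
    and \<sigma>: "sigma_finite_measure \<sigma>" "sets \<sigma> = sets borel"
  shows "(\<integral>\<^sup>+x. f x * mavg w \<sigma> x \<partial>lborel) = (\<integral>\<^sup>+y. avg w f y \<partial>\<sigma>)"
proof -
  interpret \<sigma>: sigma_finite_measure \<sigma> by fact
  interpret pair_sigma_finite \<sigma> "lborel :: 'a measure" ..
  note [measurable_cong] = \<sigma>(2)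
  have "(\<integral>\<^sup>+x. f x * mavg w \<sigma> x \<partial>lborel) = (\<integral>\<^sup>+x. \<integral>\<^sup>+y. f x * kern w (x - y) \<partial>\<sigma> \<partial>lborel)"
    by (simp add: mavg_eq_kern[OF \<sigma>] nn_integral_cmult)
  also have "\<dots> = (\<integral>\<^sup>+y. \<integral>\<^sup>+x. f x * kern w (x - y) \<partial>lborel \<partial>\<sigma>)"
    by (rule Fubini') measurable
  also have "\<dots> = (\<integral>\<^sup>+y. avg w f y \<partial>\<sigma>)"
    by (simp add: avg_eq_kern kern_minus_commute[of w])
  finally show ?thesis .
qed

lemma heat_kern:
  fixes z :: "'a::euclidean_space"
  assumes [measurable]: "w \<in> borel_measurable borel" and w0: "\<And>s. s \<le> 0 \<Longrightarrow> w s = 0" and t: "0 < t"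
  shows "heat t (\<lambda>y. kern w (y - z)) x = (\<integral>\<^sup>+s. w s * ennreal (gauss (s + t) (x - z)) \<partial>lborel)"
  unfolding kern_def
proof (subst heat_time_integral)
  show "(\<integral>\<^sup>+s. w s * heat t (\<lambda>y. ennreal (gauss s (y - z))) x \<partial>lborel) = (\<integral>\<^sup>+s. w s * ennreal (gauss (s + t) (x - z)) \<partial>lborel)"
  proof (rule nn_integral_cong)
    fix s :: real
    show "w s * heat t (\<lambda>y. ennreal (gauss s (y - z))) x = w s * ennreal (gauss (s + t) (x - z))"
      using heat_gauss[OF t, of s z x] w0 by (cases "0 < s") (auto simp: add.commute)
  qed
qed auto

lemma heat_tendsto_seq:
  fixes f :: "nat \<Rightarrow> 'a::euclidean_space \<Rightarrow> ennreal"
  assumes [measurable]: "\<And>n. f n \<in> borel_measurable borel" "g \<in> borel_measurable borel"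
    and lim: "\<And>y. (\<lambda>n. f n y) \<longlonglongrightarrow> g y" and bound: "\<And>n y. f n y \<le> c" and c: "c < \<infinity>" and s: "0 < s"
  shows "(\<lambda>n. heat s (f n) x) \<longlonglongrightarrow> heat s g x"
  unfolding heat_def
proof (rule nn_integral_dominated_convergence[where w="\<lambda>y. c * ennreal (gauss s (x - y))"])
  show "(\<integral>\<^sup>+y. c * ennreal (gauss s (x - y)) \<partial>lborel) < \<infinity>"
    using heat_const[OF s, of c x] c by (simp add: heat_def)
  show "AE y in lborel. (\<lambda>n. f n y * ennreal (gauss s (x - y))) \<longlonglongrightarrow> g y * ennreal (gauss s (x - y))"
    using tendsto_multc_ennreal[OF lim] by simp
qed (auto intro!: mult_right_mono bound)

subsection \<open>Subordination: the damped Riesz kernels\<close>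

text \<open>Up to constants, \<open>kern\<close> of this weight is the Riesz kernel of order
  2\<gamma> for \<open>l = 0\<close>, and a Bessel kernel for \<open>l > 0\<close>. The weight
  vanishes at nonpositive times, so that integrals over the whole line see only genuine
  Gaussians.\<close>

definition damped_weight :: "real \<Rightarrow> real \<Rightarrow> real \<Rightarrow> ennreal" where
  "damped_weight \<gamma> l s = (if 0 < s then ennreal (exp (- l * s) * s powr (\<gamma> - 1)) else 0)"

lemma damped_weight_measurable[measurable (raw)]:
  assumes [measurable]: "f \<in> borel_measurable M"
  shows "(\<lambda>x. damped_weight \<gamma> l (f x)) \<in> borel_measurable M"
  unfolding damped_weight_def by measurable

lemma damped_weight_scale:
  assumes "0 < r"
  shows "damped_weight \<gamma> 0 (r * s) = ennreal (r powr (\<gamma> - 1)) * damped_weight \<gamma> 0 s"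
  using assms by (auto simp: damped_weight_def powr_mult ennreal_mult zero_less_mult_iff)

lemma damped_weight_eq: "damped_weight \<gamma> l s = ennreal (exp (- l * s)) * damped_weight \<gamma> 0 s"
  by (auto simp: damped_weight_def ennreal_mult)

text \<open>The law of the first value above level 1 of a stable subordinator of index \<open>\<gamma>\<close>: the image of
  the \<open>Beta(1 - \<gamma>, \<gamma>)\<close> law under \<open>t \<mapsto> 1 / (1 - t)\<close>, a point mass at 1 if \<open>\<gamma> = 1\<close>.\<close>
lemma exists_overshoot_law:
  assumes \<gamma>: "0 < \<gamma>" "\<gamma> \<le> 1"
  obtains \<nu> :: "real measure" where "prob_space \<nu>" "sets \<nu> = sets borel" "AE v in \<nu>. 1 \<le> v"
    "\<And>s. (\<integral>\<^sup>+v. damped_weight \<gamma> 0 (s - v) \<partial>\<nu>) = damped_weight \<gamma> 0 s * indicator {1<..} s"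
proof (cases "\<gamma> = 1")
  case True
  show ?thesis
  proof (rule that[of "return borel 1"])
    show "(\<integral>\<^sup>+v. damped_weight \<gamma> 0 (s - v) \<partial>return borel 1) = damped_weight \<gamma> 0 s * indicator {1<..} s" for s
      by (subst nn_integral_return) (auto simp: damped_weight_def True indicator_def)
  qed (auto simp: prob_space_return AE_return)
next
  case False
  then have \<gamma>1: "\<gamma> < 1" using \<gamma> by simp
  define B where "B = Beta (1 - \<gamma>) \<gamma>"
  have B: "B > 0" unfolding B_def Beta_def using \<gamma> \<gamma>1 by (intro divide_pos_pos mult_pos_pos Gamma_real_pos) auto
  have int_B: "(\<integral>\<^sup>+t. ennreal (t powr (-\<gamma>) * (1 - t) powr (\<gamma> - 1)) * indicator {0..1} t \<partial>lborel) = B"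
    using has_integral_Beta_real[of "1 - \<gamma>" \<gamma>] \<gamma> \<gamma>1 unfolding B_def
    by (intro nn_integral_has_integral_lebesgue') auto
  define b where "b t = t powr (-\<gamma>) * (1 - t) powr (\<gamma> - 1) / B" for t
  define law where "law = density lborel (\<lambda>t. ennreal (b t) * indicator {0<..<1} t)"
  have [measurable]: "b \<in> borel_measurable borel" unfolding b_def by measurable
  have int_Ioo: "(\<integral>\<^sup>+t. f t * indicator {0<..<c} t \<partial>lborel) = (\<integral>\<^sup>+t. f t * indicator {0..c} t \<partial>lborel)"
    for f :: "real \<Rightarrow> ennreal" and c :: real
  proof (rule nn_integral_cong_AE)
    have "AE t in lborel. t \<noteq> 0 \<and> t \<noteq> c" using AE_lborel_singleton[of 0] AE_lborel_singleton[of c] by auto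
    then show "AE t in lborel. f t * indicator {0<..<c} t = f t * indicator {0..c} t"
      by eventually_elim (auto simp: indicator_def)
  qed
  have b: "ennreal (b t) = ennreal (1 / B) * ennreal (t powr (-\<gamma>) * (1 - t) powr (\<gamma> - 1))" for t
    using B by (subst ennreal_mult[symmetric]) (auto simp: b_def)
  have "emeasure law (space law) = (\<integral>\<^sup>+t. ennreal (b t) * indicator {0<..<1} t \<partial>lborel)"
    by (simp add: law_def emeasure_density)
  also have "\<dots> = ennreal (1 / B) * (\<integral>\<^sup>+t. ennreal (t powr (-\<gamma>) * (1 - t) powr (\<gamma> - 1)) * indicator {0..1} t \<partial>lborel)"
    unfolding int_Ioo b by (subst nn_integral_cmult[symmetric]) (auto simp: mult.assoc)
  also have "\<dots> = 1" unfolding int_B using B by (simp add: ennreal_mult[symmetric])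
  finally have prob: "prob_space law" by (rule prob_spaceI)
  have AE_law: "AE t in law. 0 < t \<and> t < 1"
    unfolding law_def by (subst AE_density) (auto simp: indicator_def)
  define \<nu> where "\<nu> = distr law borel (\<lambda>t. 1 / (1 - t))"
  have [measurable_cong]: "sets law = sets borel" by (simp add: law_def)
  show ?thesis
  proof (rule that[of \<nu>])
    show "prob_space \<nu>" unfolding \<nu>_def by (rule prob_space.prob_space_distr[OF prob]) simp
    show "sets \<nu> = sets borel" by (simp add: \<nu>_def)
    show "AE v in \<nu>. 1 \<le> v" unfolding \<nu>_def
      by (subst AE_distr_iff) (use AE_law in \<open>auto simp: field_simps\<close>)
    fix s :: real
    have eq: "(\<integral>\<^sup>+v. damped_weight \<gamma> 0 (s - v) \<partial>\<nu>) =
        (\<integral>\<^sup>+t. ennreal (b t) * indicator {0<..<1} t * damped_weight \<gamma> 0 (s - 1 / (1 - t)) \<partial>lborel)"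
      unfolding \<nu>_def law_def by (subst nn_integral_distr) (auto simp: nn_integral_density)
    show "(\<integral>\<^sup>+v. damped_weight \<gamma> 0 (s - v) \<partial>\<nu>) = damped_weight \<gamma> 0 s * indicator {1<..} s"
    proof (cases "s > 1")
      case False
      have "s - 1 / (1 - t) \<le> 0" if "0 < t" "t < 1" for t
      proof -
        have "1 \<le> 1 / (1 - t)" using that by (simp add: field_simps)
        then show ?thesis using False by linarith
      qed
      then have "ennreal (b t) * indicator {0<..<1} t * damped_weight \<gamma> 0 (s - 1 / (1 - t)) = 0" for t
        by (auto simp: damped_weight_def indicator_def not_less[symmetric])
      then show ?thesis unfolding eq using False by (simp only: nn_integral_const) simp
    next
      case True
      \<comment> \<open>With v = 1 / (1 - t), the condition v < s reads t < a, and s - v = s (a - t)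
        / (1 - t). The factor (1 - t)^(\<gamma>-1) of the Beta density cancels, leaving
        t^(-\<gamma>) (a - t)^(\<gamma>-1) on (0, a). Substituting t = a x, the powers of a cancel
        too and the complete Beta integral remains.\<close>
      define a where "a = 1 - 1 / s"
      have a: "0 < a" "a < 1" using True by (auto simp: a_def)
      have s1: "1 / (1 - a) = s" using True by (simp add: a_def)
      have "ennreal (b t) * indicator {0<..<1} t * damped_weight \<gamma> 0 (s - 1 / (1 - t)) =
          ennreal (s powr (\<gamma> - 1) / B) * (ennreal (t powr (-\<gamma>) * (a - t) powr (\<gamma> - 1)) * indicator {0<..<a} t)" for t
      proof (cases "0 < t \<and> t < 1")
        case t: True
        have "s - 1 / (1 - t) = (s * (1 - t) - 1) / (1 - t)" using t by (simp add: field_simps)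
        also have "s * (1 - t) - 1 = s * (a - t)" using True by (simp add: a_def field_simps)
        finally have st: "s - 1 / (1 - t) = s * (a - t) / (1 - t)" .
        show ?thesis
        proof (cases "t < a")
          case ta: True
          have "damped_weight \<gamma> 0 (s - 1 / (1 - t)) = ennreal ((s * (a - t) / (1 - t)) powr (\<gamma> - 1))"
            unfolding st damped_weight_def using True ta t by simp
          moreover have "b t * ((s * (a - t) / (1 - t)) powr (\<gamma> - 1)) =
              s powr (\<gamma> - 1) / B * (t powr (-\<gamma>) * (a - t) powr (\<gamma> - 1))"
            using True ta t by (simp add: b_def powr_mult powr_divide)
          ultimately show ?thesis using t ta B
            by (simp add: ennreal_mult[symmetric] b_def)
        next
          case ta: False
          then have "s * (a - t) / (1 - t) \<le> 0" using t True
            by (intro divide_nonpos_pos mult_nonneg_nonpos) auto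
          then show ?thesis using ta unfolding st by (simp add: damped_weight_def)
        qed
      qed (use a in auto)
      then have "(\<integral>\<^sup>+v. damped_weight \<gamma> 0 (s - v) \<partial>\<nu>) =
          ennreal (s powr (\<gamma> - 1) / B) * (\<integral>\<^sup>+t. ennreal (t powr (-\<gamma>) * (a - t) powr (\<gamma> - 1)) * indicator {0<..<a} t \<partial>lborel)"
        unfolding eq by (simp add: nn_integral_cmult)
      also have "(\<integral>\<^sup>+t. ennreal (t powr (-\<gamma>) * (a - t) powr (\<gamma> - 1)) * indicator {0<..<a} t \<partial>lborel) =
          ennreal a * (\<integral>\<^sup>+x. ennreal ((a * x) powr (-\<gamma>) * (a - a * x) powr (\<gamma> - 1)) * indicator {0<..<a} (a * x) \<partial>lborel)"
        using a by (subst nn_integral_real_affine[of _ a 0]) auto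
      also have "\<dots> = (\<integral>\<^sup>+x. ennreal (x powr (-\<gamma>) * (1 - x) powr (\<gamma> - 1)) * indicator {0<..<1} x \<partial>lborel)"
      proof (subst nn_integral_cmult[symmetric], simp, rule nn_integral_cong)
        fix x :: real
        show "ennreal a * (ennreal ((a * x) powr (-\<gamma>) * (a - a * x) powr (\<gamma> - 1)) * indicator {0<..<a} (a * x)) =
          ennreal (x powr (-\<gamma>) * (1 - x) powr (\<gamma> - 1)) * indicator {0<..<1} x"
        proof (cases "0 < x \<and> x < 1")
          case x: True
          have "a * ((a * x) powr (-\<gamma>) * (a - a * x) powr (\<gamma> - 1)) = (a powr 1 * a powr (-\<gamma>) * a powr (\<gamma> - 1)) * (x powr (-\<gamma>) * (1 - x) powr (\<gamma> - 1))"
          proof -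
            have "a - a * x = a * (1 - x)" by (simp add: algebra_simps)
            then show ?thesis using a x by (simp only: powr_mult) (simp add: mult_ac)
          qed
          also have "a powr 1 * a powr (-\<gamma>) * a powr (\<gamma> - 1) = 1"
            using a by (simp only: powr_add[symmetric]) simp
          finally show ?thesis using a x by (simp add: ennreal_mult'[symmetric])
        next
          case False
          then show ?thesis using a by (auto simp: indicator_def zero_less_mult_iff)
        qed
      qed
      also have "\<dots> = B" unfolding int_Ioo int_B by simp
      also have "ennreal (s powr (\<gamma> - 1) / B) * ennreal B = damped_weight \<gamma> 0 s * indicator {1<..} s"
        using B True by (simp add: ennreal_mult[symmetric] damped_weight_def)
      finally show ?thesis .
    qed
  qed
qed

section \<open>Finiteness, positivity and homogeneity of the kernels\<close>

lemma nn_integral_powr_Ioc_finite: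
  fixes r p :: real
  assumes "0 \<le> r" "-1 < p"
  shows "(\<integral>\<^sup>+s. ennreal (s powr p) * indicator {0..r} s \<partial>lborel) < \<infinity>"
  using nn_integral_has_integral_lebesgue'[OF _ has_integral_powr_from_0[OF assms(2,1)]] by simp

lemma nn_integral_powr_Ici_finite:
  fixes r p :: real
  assumes "0 < r" "p < -1"
  shows "(\<integral>\<^sup>+s. ennreal (s powr p) * indicator {r..} s \<partial>lborel) < \<infinity>"
  using nn_integral_has_integral_lebesgue'[OF _ has_integral_powr_to_inf[OF assms(2,1)]] by simp

lemma power_div_fact_le_exp:
  fixes x :: real
  assumes "0 \<le> x"
  shows "x ^ n / fact n \<le> exp x"
proof -
  have "(\<Sum>k\<in>{n}. x ^ k /\<^sub>R fact k) \<le> (\<Sum>k. x ^ k /\<^sub>R fact k)"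
    by (rule sum_le_suminf[OF summable_exp_generic]) (use assms in auto)
  then show ?thesis by (simp add: exp_def divide_inverse mult.commute)
qed

text \<open>By exp y >= y^n / n! with y = c / s, the exponential beats every negative power of s
  near 0.\<close>

lemma powr_mult_exp_inverse_bounded:
  fixes q c :: real
  assumes c: "0 < c" and q: "0 \<le> q"
  obtains M where "\<And>s. 0 < s \<Longrightarrow> s \<le> 1 \<Longrightarrow> s powr (- q) * exp (- (c / s)) \<le> M"
proof -
  obtain n :: nat where n: "q \<le> real n" using real_arch_simple by blast
  have "s powr (- q) * exp (- (c / s)) \<le> fact n / c ^ n" if s: "0 < s" "s \<le> 1" for s
  proof -
    have "s powr (- q) \<le> s powr (- real n)" using s n by (intro powr_mono') auto
    also have "\<dots> = (1 / s) ^ n" using s by (simp add: powr_minus_divide powr_realpow power_divide)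
    also have "\<dots> = (c / s) ^ n / fact n * (fact n / c ^ n)" using c s by (simp add: power_divide)
    also have "\<dots> \<le> exp (c / s) * (fact n / c ^ n)"
      using c s by (intro mult_right_mono power_div_fact_le_exp) auto
    finally have "s powr (- q) * exp (- (c / s)) \<le> exp (c / s) * (fact n / c ^ n) * exp (- (c / s))"
      by (rule mult_right_mono) simp
    also have "\<dots> = fact n / c ^ n" by (simp add: exp_minus)
    finally show ?thesis .
  qed
  then show ?thesis using that by blast
qed

lemma damped_weight_le: "damped_weight \<gamma> l s \<le> damped_weight \<gamma> l' s" if "l' \<le> l"
  using that by (auto simp: damped_weight_def intro!: ennreal_leI mult_right_mono)

lemma damped_weight_nonpos: "s \<le> 0 \<Longrightarrow> damped_weight \<gamma> l s = 0"
  by (simp add: damped_weight_def)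

lemma gauss_0: "gauss s (0::'a::euclidean_space) = (2 * pi * s) powr (- (real DIM('a) / 2))"
  by (simp add: gauss_def)

lemma nn_integral_powr_weight_finite:
  fixes f :: "real \<Rightarrow> ennreal"
  assumes f0: "\<And>s. s \<le> 0 \<Longrightarrow> f s = 0"
    and f1: "\<And>s. 0 < s \<Longrightarrow> s \<le> 1 \<Longrightarrow> f s \<le> ennreal (a * s powr p)" and a: "0 \<le> a" and p: "-1 < p"
    and f2: "\<And>s. 1 \<le> s \<Longrightarrow> f s \<le> ennreal (b * s powr q)" and b: "0 \<le> b" and q: "q < -1"
  shows "(\<integral>\<^sup>+s. f s \<partial>lborel) < \<infinity>"
proof -
  have "(\<integral>\<^sup>+s. f s \<partial>lborel) \<le> (\<integral>\<^sup>+s. ennreal a * (ennreal (s powr p) * indicator {0..1} s) +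
      ennreal b * (ennreal (s powr q) * indicator {1..} s) \<partial>lborel)"
  proof (rule nn_integral_mono)
    fix s :: real
    consider "s \<le> 0" | "0 < s" "s \<le> 1" | "1 \<le> s" by linarith
    then show "f s \<le> ennreal a * (ennreal (s powr p) * indicator {0..1} s) +
      ennreal b * (ennreal (s powr q) * indicator {1..} s)"
    proof cases
      case 2
      then have "f s \<le> ennreal a * (ennreal (s powr p) * indicator {0..1} s)"
        using f1[OF 2] a by (simp add: ennreal_mult)
      then show ?thesis by (rule order_trans) simp
    next
      case 3
      then have "f s \<le> ennreal b * (ennreal (s powr q) * indicator {1..} s)"
        using f2[OF 3] b by (simp add: ennreal_mult)
      then show ?thesis by (rule order_trans) simp
    qed (simp add: f0)
  qed
  also have "\<dots> = ennreal a * (\<integral>\<^sup>+s. ennreal (s powr p) * indicator {0..1} s \<partial>lborel) +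
      ennreal b * (\<integral>\<^sup>+s. ennreal (s powr q) * indicator {1..} s \<partial>lborel)"
    by (simp add: nn_integral_add nn_integral_cmult)
  also have "\<dots> < \<infinity>"
    using nn_integral_powr_Ioc_finite[of 1 p] nn_integral_powr_Ici_finite[of 1 q] p q
    by (simp add: ennreal_mult_less_top)
  finally show ?thesis .
qed

lemma damped_weight_integral_finite:
  assumes \<gamma>: "0 < \<gamma>" "\<gamma> \<le> 1" and l: "0 < l"
  shows "(\<integral>\<^sup>+s. damped_weight \<gamma> l s \<partial>lborel) < \<infinity>"
proof (rule nn_integral_powr_weight_finite[where a=1 and p="\<gamma> - 1" and b="2 / l\<^sup>2" and q="-2"])
  fix s :: real assume s: "1 \<le> s"
  \<comment> \<open>The quadratic Taylor term already gives decay s^(-2), which is integrable at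
    infinity; the factor s^(\<gamma>-1) is at most 1 there because \<gamma> <= 1.\<close>
  have "1 + l * s + (l * s)\<^sup>2 / 2 \<le> exp (l * s)" using s l by (intro exp_lower_Taylor_quadratic) auto
  moreover have "0 \<le> l * s" using s l by simp
  ultimately have "(l * s)\<^sup>2 / 2 \<le> exp (l * s)" by linarith
  then have "exp (- (l * s)) \<le> 2 / (l * s)\<^sup>2" using s l by (simp add: exp_minus field_simps)
  also have "\<dots> = 2 / l\<^sup>2 * s powr (-2)"
    using s l by (simp add: powr_minus_divide powr_numeral power_mult_distrib)
  finally have "exp (- (l * s)) * s powr (\<gamma> - 1) \<le> 2 / l\<^sup>2 * s powr (-2) * 1"
    using powr_mono[of "\<gamma> - 1" 0 s] s \<gamma> by (intro mult_mono) auto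
  then show "damped_weight \<gamma> l s \<le> ennreal (2 / l\<^sup>2 * s powr (-2))"
    using s by (simp add: damped_weight_def ennreal_leI)
next
  fix s :: real assume s: "0 < s" "s \<le> 1"
  show "damped_weight \<gamma> l s \<le> ennreal (1 * s powr (\<gamma> - 1))"
    using s l by (simp add: damped_weight_def mult_left_le_one_le ennreal_leI)
qed (use \<gamma> in \<open>auto simp: damped_weight_def\<close>)

lemma gauss_le_powr_exp:
  fixes x :: "'a::euclidean_space"
  assumes "0 < s"
  shows "gauss s x \<le> (2 * pi) powr (- (real DIM('a) / 2)) * s powr (- (real DIM('a) / 2)) * exp (- ((norm x)\<^sup>2 / 2 / s))"
  using assms by (simp add: gauss_def powr_mult divide_divide_eq_left)

text \<open>For small s the factor exp(-|x|^2/(2s)) compensates s^(-N/2) and leaves the integrable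
  power s^(\<gamma>-1). For large s the integrand is at most a constant times s^(\<gamma>-1-N/2),
  integrable because 2\<gamma> < N.\<close>

lemma kern_damped_weight_finite:
  fixes x :: "'a::euclidean_space"
  assumes \<gamma>: "0 < \<gamma>" "2 * \<gamma> < real DIM('a)" and x: "x \<noteq> 0"
  shows "kern (damped_weight \<gamma> 0) x < \<infinity>"
proof -
  let ?N = "real DIM('a)" let ?c = "(2 * pi) powr (- (?N / 2))"
  obtain M where M: "\<And>s. 0 < s \<Longrightarrow> s \<le> 1 \<Longrightarrow> s powr (- (?N / 2)) * exp (- ((norm x)\<^sup>2 / 2 / s)) \<le> M"
    using powr_mult_exp_inverse_bounded[of "(norm x)\<^sup>2 / 2" "?N / 2"] x by auto
  have "0 \<le> M" using order_trans[OF _ M[of 1]] by simp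
  have w: "damped_weight \<gamma> 0 s * ennreal (gauss s x) = ennreal (s powr (\<gamma> - 1) * gauss s x)" if "0 < s" for s
    using that by (simp add: damped_weight_def ennreal_mult)
  show ?thesis unfolding kern_def
  proof (rule nn_integral_powr_weight_finite[where a="?c * M" and p="\<gamma> - 1" and b="?c" and q="\<gamma> - 1 - ?N / 2"])
    fix s :: real assume s: "0 < s" "s \<le> 1"
    have "gauss s x \<le> ?c * M"
    proof (rule order_trans)
      show "gauss s x \<le> ?c * (s powr (- (?N / 2)) * exp (- ((norm x)\<^sup>2 / 2 / s)))"
        using gauss_le_powr_exp[OF s(1), of x] by (simp only: mult.assoc)
      show "?c * (s powr (- (?N / 2)) * exp (- ((norm x)\<^sup>2 / 2 / s))) \<le> ?c * M"
        by (rule mult_left_mono[OF M[OF s]]) simp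
    qed
    then have "s powr (\<gamma> - 1) * gauss s x \<le> ?c * M * s powr (\<gamma> - 1)"
      by (subst mult.commute) (rule mult_right_mono, auto)
    then show "damped_weight \<gamma> 0 s * ennreal (gauss s x) \<le> ennreal (?c * M * s powr (\<gamma> - 1))"
      using s by (subst w) (auto intro: ennreal_leI)
  next
    fix s :: real assume s: "1 \<le> s"
    have "gauss s x \<le> ?c * s powr (- (?N / 2))"
      using gauss_mono[of s 0 x] s by (simp add: gauss_0 powr_mult)
    then have "s powr (\<gamma> - 1) * gauss s x \<le> s powr (\<gamma> - 1) * (?c * s powr (- (?N / 2)))"
      by (rule mult_left_mono) simp
    also have "\<dots> = ?c * s powr (\<gamma> - 1 - ?N / 2)"
      by (simp add: powr_diff powr_minus_divide)
    finally show "damped_weight \<gamma> 0 s * ennreal (gauss s x) \<le> ennreal (?c * s powr (\<gamma> - 1 - ?N / 2))"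
      using s by (subst w) (auto intro: ennreal_leI)
  qed (use \<gamma> \<open>0 \<le> M\<close> in \<open>auto simp: damped_weight_def\<close>)
qed

text \<open>By \<open>heat_kern\<close>, the integral is the Gaussian average of variance 1 of the
  undamped kernel, taken at its pole. The time shift by 1 keeps the Gaussian factor bounded as s
  tends to 0.\<close>

lemma kern_translated_gauss_finite:
  assumes \<gamma>: "0 < \<gamma>" "2 * \<gamma> < real DIM('a::euclidean_space)"
  shows "(\<integral>\<^sup>+s. damped_weight \<gamma> 0 s * ennreal (gauss (s + 1) (0::'a)) \<partial>lborel) < \<infinity>"
proof -
  let ?N = "real DIM('a)" let ?c = "(2 * pi) powr (- (?N / 2))"
  have w: "damped_weight \<gamma> 0 s * ennreal (gauss (s + 1) (0::'a)) = ennreal (s powr (\<gamma> - 1) * (?c * (s + 1) powr (- (?N / 2))))" if "0 < s" for s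
    using that by (simp add: damped_weight_def ennreal_mult gauss_0 powr_mult)
  have neg: "(s + 1) powr (- (?N / 2)) \<le> (max s 1) powr (- (?N / 2))" if "0 < s" for s :: real
    using that by (intro powr_mono2') auto
  show ?thesis
  proof (rule nn_integral_powr_weight_finite[where a="?c" and p="\<gamma> - 1" and b="?c" and q="\<gamma> - 1 - ?N / 2"])
    fix s :: real assume s: "0 < s" "s \<le> 1"
    have "s powr (\<gamma> - 1) * (?c * (s + 1) powr (- (?N / 2))) \<le> s powr (\<gamma> - 1) * (?c * 1)"
      using neg[of s] s by (intro mult_left_mono) (auto simp: max_def)
    then show "damped_weight \<gamma> 0 s * ennreal (gauss (s + 1) (0::'a)) \<le> ennreal (?c * s powr (\<gamma> - 1))"
      using s by (subst w) (auto intro!: ennreal_leI simp: mult.commute)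
  next
    fix s :: real assume s: "1 \<le> s"
    have "s powr (\<gamma> - 1) * (?c * (s + 1) powr (- (?N / 2))) \<le> s powr (\<gamma> - 1) * (?c * s powr (- (?N / 2)))"
      using neg[of s] s by (intro mult_left_mono) (auto simp: max_def)
    also have "\<dots> = ?c * s powr (\<gamma> - 1 - ?N / 2)"
      by (simp add: powr_diff powr_minus_divide)
    finally show "damped_weight \<gamma> 0 s * ennreal (gauss (s + 1) (0::'a)) \<le> ennreal (?c * s powr (\<gamma> - 1 - ?N / 2))"
      using s by (subst w) (auto intro: ennreal_leI)
  qed (use \<gamma> in \<open>auto simp: damped_weight_def\<close>)
qed

lemma nn_integral_pos_if_pos_on:
  fixes f :: "real \<Rightarrow> ennreal"
  assumes [measurable]: "f \<in> borel_measurable borel" and ab: "a < b" and pos: "\<And>s. a < s \<Longrightarrow> s < b \<Longrightarrow> f s > 0"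
  shows "(\<integral>\<^sup>+s. f s \<partial>lborel) > 0"
proof (rule ccontr)
  assume "\<not> (\<integral>\<^sup>+s. f s \<partial>lborel) > 0"
  then have "(\<integral>\<^sup>+s. f s \<partial>lborel) = 0" by (simp add: not_less)
  then have "AE s in lborel. f s = 0" by (subst (asm) nn_integral_0_iff_AE) auto
  then have "AE s in lborel. \<not> (a < s \<and> s < b)"
    by eventually_elim (use pos in fastforce)
  then have "emeasure lborel {s. a < s \<and> s < b} = 0"
    by (subst (asm) AE_iff_measurable[OF _ refl]) auto
  moreover have "{s. a < s \<and> s < b} = {a<..<b}" by auto
  ultimately show False using ab by simp
qed

lemma kern_damped_weight_pos: "kern (damped_weight \<gamma> l) x > 0"
  unfolding kern_def
  by (rule nn_integral_pos_if_pos_on[of _ 0 1]) (auto simp: damped_weight_def gauss_pos ennreal_zero_less_mult_iff)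

lemma kern_mono:
  fixes x y :: "'a::euclidean_space"
  assumes "\<And>s. s \<le> 0 \<Longrightarrow> w s = 0" "norm x \<le> norm y"
  shows "kern w y \<le> kern w x"
  unfolding kern_def
proof (rule nn_integral_mono)
  fix s :: real
  show "w s * ennreal (gauss s y) \<le> w s * ennreal (gauss s x)"
    using assms gauss_mono[of s x y] by (cases "0 < s") (auto intro!: mult_left_mono ennreal_leI)
qed

lemma kern_cong_norm:
  fixes x y :: "'a::euclidean_space"
  assumes "\<And>s. s \<le> 0 \<Longrightarrow> w s = 0" "norm x = norm y"
  shows "kern w x = kern w y"
  using kern_mono[of w x y] kern_mono[of w y x] assms by (intro antisym) auto

text \<open>Substituting c^2 s for the time, the Jacobian contributes c^2, the weight
  c^(2\<gamma>-2) and the Gaussian c^(-N).\<close>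

lemma kern_damped_weight_scale:
  fixes x :: "'a::euclidean_space"
  assumes c: "0 < c"
  shows "kern (damped_weight \<gamma> 0) (c *\<^sub>R x) = ennreal (c powr (2 * \<gamma> - real DIM('a))) * kern (damped_weight \<gamma> 0) x"
proof -
  have c2: "0 < c\<^sup>2" using c by simp
  have "kern (damped_weight \<gamma> 0) (c *\<^sub>R x) =
      ennreal (c\<^sup>2) * (\<integral>\<^sup>+s. damped_weight \<gamma> 0 (c\<^sup>2 * s) * ennreal (gauss (c\<^sup>2 * s) (c *\<^sub>R x)) \<partial>lborel)"
    unfolding kern_def using c
    by (subst nn_integral_real_affine[of _ "c\<^sup>2" 0]) auto
  also have "\<dots> = ennreal (c powr (2 * \<gamma> - real DIM('a))) * kern (damped_weight \<gamma> 0) x"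
    unfolding kern_def
  proof (subst (1 2) nn_integral_cmult[symmetric], simp, simp, rule nn_integral_cong)
    fix s
    show "ennreal (c\<^sup>2) * (damped_weight \<gamma> 0 (c\<^sup>2 * s) * ennreal (gauss (c\<^sup>2 * s) (c *\<^sub>R x))) =
       ennreal (c powr (2 * \<gamma> - real DIM('a))) * (damped_weight \<gamma> 0 s * ennreal (gauss s x))"
    proof (cases "0 < s")
      case True
      have g: "gauss (c\<^sup>2 * s) (c *\<^sub>R x) = gauss s x * c powr (- real DIM('a))"
        using gauss_scale[OF c True, of x] c by (simp add: powr_minus powr_realpow field_simps)
      have "c\<^sup>2 * (c\<^sup>2) powr (\<gamma> - 1) * c powr (- real DIM('a)) = c powr (2 * \<gamma> - real DIM('a))"
      proof -
        have "c\<^sup>2 = c powr 2" using c by (simp add: powr_numeral)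
        then show ?thesis by (simp only: powr_powr powr_add[symmetric]) (simp add: algebra_simps)
      qed
      then have eq: "ennreal (c\<^sup>2) * ennreal ((c\<^sup>2) powr (\<gamma> - 1)) * ennreal (c powr (- real DIM('a))) = ennreal (c powr (2 * \<gamma> - real DIM('a)))"
        by (simp add: ennreal_mult[symmetric])
      show ?thesis unfolding damped_weight_scale[OF c2] g eq[symmetric]
        by (simp add: ennreal_mult mult_ac)
    qed (use c2 in \<open>simp add: damped_weight_nonpos mult_nonneg_nonpos\<close>)
  qed
  finally show ?thesis .
qed

text \<open>Radial symmetry and homogeneity alone identify the Riesz kernel. Its constant is kept as
  the value at a unit vector, so that no Gamma function has to be evaluated.\<close>

lemma kern_damped_weight_eq_powr:
  fixes x e :: "'a::euclidean_space"
  assumes "x \<noteq> 0" "norm e = 1"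
  shows "kern (damped_weight \<gamma> 0) x = ennreal (norm x powr (2 * \<gamma> - real DIM('a))) * kern (damped_weight \<gamma> 0) e"
proof -
  have "kern (damped_weight \<gamma> 0) x = kern (damped_weight \<gamma> 0) (norm x *\<^sub>R e)"
    using assms by (intro kern_cong_norm) (auto simp: damped_weight_nonpos)
  then show ?thesis using kern_damped_weight_scale[of "norm x" \<gamma> e] assms by simp
qed

text \<open>At the pole, homogeneity multiplies the value by c^(2\<gamma>-N) without changing it.
  Choosing c so that this factor is 2 leaves only 0 and infinity, and the kernel is
  positive.\<close>

lemma kern_damped_weight_0:
  assumes "2 * \<gamma> < real DIM('a)"
  shows "kern (damped_weight \<gamma> 0) (0::'a::euclidean_space) = \<infinity>"
proof -
  let ?p = "2 * \<gamma> - real DIM('a)" let ?K = "kern (damped_weight \<gamma> 0) (0::'a)"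
  have "(2 powr (1 / ?p)) powr ?p = 2" using assms by (simp add: powr_powr)
  then have "?K = 2 * ?K"
    using kern_damped_weight_scale[of "2 powr (1 / ?p)" \<gamma> "0::'a"] by simp
  then have "?K = 0 \<or> ?K = \<infinity>"
    by (cases ?K) (auto simp: ennreal_mult[symmetric] ennreal_numeral[symmetric] simp del: ennreal_numeral)
  then show ?thesis using kern_damped_weight_pos[of \<gamma> 0 "0::'a"] by auto
qed

text \<open>Dominated convergence with dominating function \<open>w s * gauss s x0\<close>.\<close>
lemma kern_tendsto:
  fixes X :: "nat \<Rightarrow> 'a::euclidean_space" and x0 x :: 'a
  assumes [measurable]: "w \<in> borel_measurable borel" and w0: "\<And>s. s \<le> 0 \<Longrightarrow> w s = 0"
    and fin: "kern w x0 < \<infinity>" and X: "X \<longlonglongrightarrow> x" "\<And>n. norm x0 \<le> norm (X n)"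
  shows "(\<lambda>n. kern w (X n)) \<longlonglongrightarrow> kern w x"
  unfolding kern_def
proof (rule nn_integral_dominated_convergence[where w="\<lambda>s. w s * ennreal (gauss s x0)"])
  show "AE s in lborel. w s * ennreal (gauss s (X n)) \<le> w s * ennreal (gauss s x0)" for n
  proof (rule AE_I2)
    fix s :: real
    show "w s * ennreal (gauss s (X n)) \<le> w s * ennreal (gauss s x0)"
      using w0 X(2) gauss_mono[of s x0 "X n"] by (cases "0 < s") (auto intro!: mult_left_mono ennreal_leI)
  qed
  show "(\<integral>\<^sup>+s. w s * ennreal (gauss s x0) \<partial>lborel) < \<infinity>" using fin by (simp add: kern_def)
  have "AE s in lborel. w s * ennreal (gauss s x0) \<noteq> \<infinity>"
    by (rule nn_integral_PInf_AE) (use fin in \<open>auto simp: kern_def\<close>)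
  then show "AE s in lborel. (\<lambda>n. w s * ennreal (gauss s (X n))) \<longlonglongrightarrow> w s * ennreal (gauss s x)"
  proof eventually_elim
    case (elim s)
    show ?case
    proof (cases "0 < s")
      case True
      have "w s < top" using elim gauss_pos[OF True, of x0]
        by (auto simp: ennreal_mult_eq_top_iff less_top)
      moreover have "(\<lambda>n. gauss s (X n)) \<longlonglongrightarrow> gauss s x"
        unfolding gauss_def using True by (intro tendsto_intros X(1)) auto
      ultimately show ?thesis by (intro ennreal_tendsto_cmult tendsto_ennrealI) auto
    qed (simp add: w0)
  qed
qed auto

subsection \<open>Sweeping\<close>

locale overshoot = prob_space \<nu> for \<nu> :: "real measure" +
  fixes \<gamma> :: real
  assumes \<gamma>: "0 < \<gamma>" "\<gamma> \<le> 1" and sets_\<nu>[measurable_cong]: "sets \<nu> = sets borel"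
    and AE_\<nu>: "AE v in \<nu>. 1 \<le> v"
    and \<nu>_weight: "\<And>s. (\<integral>\<^sup>+v. damped_weight \<gamma> 0 (s - v) \<partial>\<nu>) = damped_weight \<gamma> 0 s * indicator {1<..} s"
begin

definition tail :: "real \<Rightarrow> real \<Rightarrow> real \<Rightarrow> ennreal" where
  "tail l r s = damped_weight \<gamma> l s * indicator {r<..} s"

definition head :: "real \<Rightarrow> real \<Rightarrow> real \<Rightarrow> ennreal" where
  "head l r s = damped_weight \<gamma> l s * indicator {..r} s"

text \<open>By self-similarity of the subordinator, its first value above r has as law the image of
  \<open>\<nu>\<close> under multiplication by r, so one law serves all levels. The exponential
  factor matches the damping of the weight.\<close>

definition sweep :: "real \<Rightarrow> real \<Rightarrow> ('a::euclidean_space \<Rightarrow> ennreal) \<Rightarrow> 'a \<Rightarrow> ennreal" where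
  "sweep l r f x = (\<integral>\<^sup>+v. ennreal (exp (- l * (r * v))) * heat (r * v) f x \<partial>\<nu>)"

lemma tail_measurable[measurable]: "tail l r \<in> borel_measurable borel"
  and head_measurable[measurable]: "head l r \<in> borel_measurable borel"
  unfolding tail_def head_def by measurable

lemma head_plus_tail: "damped_weight \<gamma> l s = head l r s + tail l r s"
  by (auto simp: head_def tail_def indicator_def)

lemma sweep_measurable[measurable (raw)]:
  fixes f :: "'a::euclidean_space \<Rightarrow> ennreal"
  assumes [measurable]: "f \<in> borel_measurable borel" "g \<in> borel_measurable M"
  shows "(\<lambda>x. sweep l r f (g x)) \<in> borel_measurable M"
  unfolding sweep_def by measurable

text \<open>The defining property of \<open>\<nu>\<close>, rescaled by \<open>r\<close>, damped, and tested against \<open>F\<close>.\<close>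
lemma overshoot_identity:
  fixes F :: "real \<Rightarrow> ennreal"
  assumes [measurable]: "F \<in> borel_measurable borel" and r: "0 < r"
  shows "(\<integral>\<^sup>+v. ennreal (exp (- l * (r * v))) * (\<integral>\<^sup>+s. damped_weight \<gamma> l s * F (s + r * v) \<partial>lborel) \<partial>\<nu>) =
    (\<integral>\<^sup>+s. tail l r s * F s \<partial>lborel)"
proof -
  interpret P: pair_sigma_finite \<nu> "lborel :: real measure" ..
  have "(\<integral>\<^sup>+v. ennreal (exp (- l * (r * v))) * (\<integral>\<^sup>+s. damped_weight \<gamma> l s * F (s + r * v) \<partial>lborel) \<partial>\<nu>) =
    (\<integral>\<^sup>+v. ennreal (exp (- l * (r * v))) * (\<integral>\<^sup>+s. damped_weight \<gamma> l (s - r * v) * F s \<partial>lborel) \<partial>\<nu>)"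
  proof (rule nn_integral_cong)
    fix v
    show "ennreal (exp (- l * (r * v))) * (\<integral>\<^sup>+s. damped_weight \<gamma> l s * F (s + r * v) \<partial>lborel) =
      ennreal (exp (- l * (r * v))) * (\<integral>\<^sup>+s. damped_weight \<gamma> l (s - r * v) * F s \<partial>lborel)"
      using nn_integral_lborel_shift[of "\<lambda>s. damped_weight \<gamma> l (s - r * v) * F s" "- (r * v)"] by simp
  qed
  also have "\<dots> = (\<integral>\<^sup>+v. \<integral>\<^sup>+s. ennreal (exp (- l * (r * v))) * (damped_weight \<gamma> l (s - r * v) * F s) \<partial>lborel \<partial>\<nu>)"
    by (simp add: nn_integral_cmult)
  also have "\<dots> = (\<integral>\<^sup>+s. \<integral>\<^sup>+v. ennreal (exp (- l * (r * v))) * (damped_weight \<gamma> l (s - r * v) * F s) \<partial>\<nu> \<partial>lborel)"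
    by (rule P.Fubini'[symmetric]) measurable
  also have "\<dots> = (\<integral>\<^sup>+s. tail l r s * F s \<partial>lborel)"
  proof (rule nn_integral_cong)
    fix s
    \<comment> \<open>The two exponentials combine to exp(-l s), free of v, and homogeneity of the
      undamped weight brings the level r to 1, where the defining property of \<open>\<nu>\<close>
      applies.\<close>
    have "ennreal (exp (- l * (r * v))) * (damped_weight \<gamma> l (s - r * v) * F s) =
        ennreal (exp (- l * s)) * ennreal (r powr (\<gamma> - 1)) * F s * damped_weight \<gamma> 0 (s / r - v)" for v
    proof -
      have "damped_weight \<gamma> l (s - r * v) = ennreal (exp (- l * (s - r * v))) * damped_weight \<gamma> 0 (r * (s / r - v))"
        using r by (subst damped_weight_eq) (simp add: right_diff_distrib)
      moreover have "ennreal (exp (- l * s)) = ennreal (exp (- l * (r * v))) * ennreal (exp (- l * (s - r * v)))"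
        by (simp add: ennreal_mult[symmetric] exp_add[symmetric] algebra_simps)
      ultimately show ?thesis
        unfolding damped_weight_scale[OF r] by (simp only: mult_ac)
    qed
    then have "(\<integral>\<^sup>+v. ennreal (exp (- l * (r * v))) * (damped_weight \<gamma> l (s - r * v) * F s) \<partial>\<nu>) =
        ennreal (exp (- l * s)) * ennreal (r powr (\<gamma> - 1)) * F s * (damped_weight \<gamma> 0 (s / r) * indicator {1<..} (s / r))"
      by (simp add: nn_integral_cmult \<nu>_weight)
    also have "\<dots> = ennreal (exp (- l * s)) * damped_weight \<gamma> 0 (r * (s / r)) * indicator {1<..} (s / r) * F s"
      unfolding damped_weight_scale[OF r] by (simp add: mult_ac)
    also have "\<dots> = tail l r s * F s"
      using r by (simp add: tail_def damped_weight_eq[of _ l] indicator_def field_simps)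
    finally show "(\<integral>\<^sup>+v. ennreal (exp (- l * (r * v))) * (damped_weight \<gamma> l (s - r * v) * F s) \<partial>\<nu>) = tail l r s * F s" .
  qed
  finally show ?thesis .
qed

lemma AE_pos: "AE v in \<nu>. 0 < v" using AE_\<nu> by eventually_elim simp

lemma sweep_cong_pos:
  assumes "\<And>v. 0 < v \<Longrightarrow> heat v f x = g v" "0 < r"
  shows "sweep l r f x = (\<integral>\<^sup>+v. ennreal (exp (- l * (r * v))) * g (r * v) \<partial>\<nu>)"
  unfolding sweep_def
  by (rule nn_integral_cong_AE) (use AE_pos assms in \<open>auto\<close>)

text \<open>\<open>heat v\<close> shifts all times in the superposition by v. By
  \<open>overshoot_identity\<close>, averaging these shifts over the overshoot law amounts to
  cutting the weight off at r.\<close>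

lemma sweep_mavg:
  fixes \<sigma> :: "'a::euclidean_space measure"
  assumes \<sigma>: "sigma_finite_measure \<sigma>" "sets \<sigma> = sets borel" and r: "0 < r"
  shows "sweep l r (mavg (damped_weight \<gamma> l) \<sigma>) x = mavg (tail l r) \<sigma> x"
proof -
  note [measurable] = mheat_measurable[OF \<sigma>]
  have "heat v (mavg (damped_weight \<gamma> l) \<sigma>) x = (\<integral>\<^sup>+s. damped_weight \<gamma> l s * mheat (s + v) \<sigma> x \<partial>lborel)" if v: "0 < v" for v
    unfolding mavg_def
    by (subst heat_time_integral) (auto intro!: nn_integral_cong simp: damped_weight_def heat_mheat[OF \<sigma> _ v])
  from sweep_cong_pos[OF this r, of l] overshoot_identity[OF _ r, of "\<lambda>s. mheat s \<sigma> x" l]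
  show ?thesis unfolding mavg_def by simp
qed

lemma sweep_kern:
  "0 < r \<Longrightarrow> sweep l r (\<lambda>y. kern (damped_weight \<gamma> l) (y - t)) x = kern (tail l r) (x - t :: 'a::euclidean_space)"
  using sweep_mavg[of "return borel t" r l x]
  by (simp add: mavg_return[abs_def] prob_space_return prob_space_imp_sigma_finite)

lemma sweep_avg:
  fixes f :: "'a::euclidean_space \<Rightarrow> ennreal"
  assumes [measurable]: "f \<in> borel_measurable borel" and r: "0 < r"
  shows "sweep l r (avg (damped_weight \<gamma> l) f) x = avg (tail l r) f x"
proof -
  have "heat v (avg (damped_weight \<gamma> l) f) x = (\<integral>\<^sup>+s. damped_weight \<gamma> l s * heat (s + v) f x \<partial>lborel)" if v: "0 < v" for v
    unfolding avg_def
    by (subst heat_time_integral) (auto intro!: nn_integral_cong simp: damped_weight_def heat_heat[OF _ _ v])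
  from sweep_cong_pos[OF this r, of l] overshoot_identity[OF _ r, of "\<lambda>s. heat s f x" l]
  show ?thesis unfolding avg_def by simp
qed

text \<open>Heat times add, so the order of the two operations does not matter (compare
  \<open>sweep_avg\<close>). The sweep stands inside here because the function to be averaged later
  is the excess of \<open>f\<close> over its sweep.\<close>

lemma avg_sweep:
  fixes f :: "'a::euclidean_space \<Rightarrow> ennreal"
  assumes [measurable]: "f \<in> borel_measurable borel" and r: "0 < r"
  shows "avg (damped_weight \<gamma> l) (sweep l r f) x = avg (tail l r) f x"
proof -
  interpret P: pair_sigma_finite \<nu> "lborel :: real measure" ..
  have heat_sweep: "heat s (sweep l r f) x = (\<integral>\<^sup>+v. ennreal (exp (- l * (r * v))) * heat (s + r * v) f x \<partial>\<nu>)"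
    if s: "0 < s" for s
  proof -
    interpret P2: pair_sigma_finite \<nu> "lborel :: 'a measure" ..
    have "heat s (sweep l r f) x = (\<integral>\<^sup>+y. \<integral>\<^sup>+v. ennreal (exp (- l * (r * v))) * (heat (r * v) f y * ennreal (gauss s (x - y))) \<partial>\<nu> \<partial>lborel)"
      unfolding heat_def[of s] sweep_def by (subst nn_integral_multc[symmetric]) (auto simp: mult_ac)
    also have "\<dots> = (\<integral>\<^sup>+v. \<integral>\<^sup>+y. ennreal (exp (- l * (r * v))) * (heat (r * v) f y * ennreal (gauss s (x - y))) \<partial>lborel \<partial>\<nu>)"
      by (rule P2.Fubini') measurable
    also have "\<dots> = (\<integral>\<^sup>+v. ennreal (exp (- l * (r * v))) * heat s (heat (r * v) f) x \<partial>\<nu>)"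
      unfolding heat_def[of s] by (simp add: nn_integral_cmult)
    also have "\<dots> = (\<integral>\<^sup>+v. ennreal (exp (- l * (r * v))) * heat (s + r * v) f x \<partial>\<nu>)"
      by (rule nn_integral_cong_AE) (use AE_pos r s in \<open>auto simp: heat_heat add.commute\<close>)
    finally show ?thesis .
  qed
  have "avg (damped_weight \<gamma> l) (sweep l r f) x =
      (\<integral>\<^sup>+s. \<integral>\<^sup>+v. ennreal (exp (- l * (r * v))) * (damped_weight \<gamma> l s * heat (s + r * v) f x) \<partial>\<nu> \<partial>lborel)"
    unfolding avg_def
  proof (rule nn_integral_cong)
    fix s
    show "damped_weight \<gamma> l s * heat s (sweep l r f) x =
      (\<integral>\<^sup>+v. ennreal (exp (- l * (r * v))) * (damped_weight \<gamma> l s * heat (s + r * v) f x) \<partial>\<nu>)"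
    proof (cases "0 < s")
      case True
      then show ?thesis
        unfolding heat_sweep[OF True] by (subst nn_integral_cmult[symmetric]) (auto simp: mult_ac)
    qed (simp add: damped_weight_def)
  qed
  also have "\<dots> = (\<integral>\<^sup>+v. \<integral>\<^sup>+s. ennreal (exp (- l * (r * v))) * (damped_weight \<gamma> l s * heat (s + r * v) f x) \<partial>lborel \<partial>\<nu>)"
    by (rule P.Fubini') measurable
  also have "\<dots> = avg (tail l r) f x"
    using overshoot_identity[OF _ r, of "\<lambda>s. heat s f x" l] unfolding avg_def by (simp add: nn_integral_cmult)
  finally show ?thesis .
qed

lemma tail_le: "tail l r s \<le> damped_weight \<gamma> l s"
  by (auto simp: tail_def indicator_def)

lemma tail_nonpos: "s \<le> 0 \<Longrightarrow> tail l r s = 0"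
  by (simp add: tail_def damped_weight_nonpos)

lemma head_nonpos: "s \<le> 0 \<Longrightarrow> head l r s = 0"
  by (simp add: head_def damped_weight_nonpos)

lemma head_integral_finite: assumes "0 \<le> l" shows "(\<integral>\<^sup>+s. head l r s \<partial>lborel) < \<infinity>"
proof -
  have "(\<integral>\<^sup>+s. head l r s \<partial>lborel) \<le> (\<integral>\<^sup>+s. ennreal (s powr (\<gamma> - 1)) * indicator {0..max r 0} s \<partial>lborel)"
    using assms by (intro nn_integral_mono)
      (auto simp: head_def damped_weight_def indicator_def mult_left_le_one_le intro!: ennreal_leI)
  also have "\<dots> < \<infinity>" using \<gamma> by (intro nn_integral_powr_Ioc_finite) auto
  finally show ?thesis .
qed

lemma head_integral_pos: "0 < r \<Longrightarrow> 0 < (\<integral>\<^sup>+s. head l r s \<partial>lborel)"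
  by (rule nn_integral_pos_if_pos_on[of _ 0 r]) (auto simp: head_def damped_weight_def)

text \<open>For times beyond r, the Gaussian values at 0 and at a unit vector differ at most by the
  factor exp(1/(2r)). Finiteness away from the pole therefore carries over to the pole.\<close>

lemma kern_tail_0_finite:
  assumes "2 * \<gamma> < real DIM('a)" "0 < r"
  shows "kern (tail 0 r) (0::'a::euclidean_space) < \<infinity>"
proof -
  obtain e :: 'a where e: "norm e = 1" using vector_choose_size[of 1] by auto
  then have "e \<noteq> 0" by auto
  have "kern (tail 0 r) (0::'a) \<le> ennreal (exp (1 / (2 * r))) * kern (damped_weight \<gamma> 0) e"
    unfolding kern_def
  proof (subst nn_integral_cmult[symmetric], simp, rule nn_integral_mono)
    fix s :: real
    show "tail 0 r s * ennreal (gauss s (0::'a)) \<le> ennreal (exp (1 / (2 * r))) * (damped_weight \<gamma> 0 s * ennreal (gauss s e))"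
    proof (cases "r < s")
      case True
      have "gauss s (0::'a) = exp (1 / (2 * s)) * gauss s e"
        using e True assms by (simp add: gauss_def exp_minus)
      also have "\<dots> \<le> exp (1 / (2 * r)) * gauss s e"
        using True assms by (intro mult_right_mono) (auto simp: frac_le)
      finally have "damped_weight \<gamma> 0 s * ennreal (gauss s (0::'a)) \<le> damped_weight \<gamma> 0 s * ennreal (exp (1 / (2 * r)) * gauss s e)"
        by (intro mult_left_mono ennreal_leI) auto
      then show ?thesis using True by (simp add: tail_def ennreal_mult mult_ac)
    qed (simp add: tail_def)
  qed
  also have "\<dots> < \<infinity>"
    using kern_damped_weight_finite[of \<gamma> e] \<open>e \<noteq> 0\<close> \<gamma> assms by (simp add: ennreal_mult_less_top)
  finally show ?thesis .
qed

lemma sweep_mono: "(\<And>y. f y \<le> g y) \<Longrightarrow> sweep l r f x \<le> sweep l r g x"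
  unfolding sweep_def by (intro nn_integral_mono mult_left_mono heat_mono) auto

lemma sweep_le_const:
  assumes "0 < r" "0 \<le> l" "\<And>y. f y \<le> c"
  shows "sweep l r f x \<le> c"
proof -
  have "sweep l r f x \<le> (\<integral>\<^sup>+v. 1 * c \<partial>\<nu>)"
    unfolding sweep_def
  proof (rule nn_integral_mono_AE)
    show "AE v in \<nu>. ennreal (exp (- l * (r * v))) * heat (r * v) f x \<le> 1 * c"
      using AE_pos
    proof eventually_elim
      case (elim v)
      then show ?case using assms by (intro mult_mono heat_le_const) auto
    qed
  qed
  then show ?thesis by (simp add: emeasure_space_1)
qed

text \<open>This is \<open>overshoot_identity\<close> tested with the constant 1. The factor coming
  from \<open>\<nu>\<close> is the one by which \<open>sweep\<close> multiplies integrals in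
  \<open>nn_integral_sweep\<close>; this match yields the mass bound.\<close>

lemma nn_integral_tail:
  assumes r: "0 < r"
  shows "(\<integral>\<^sup>+s. tail l r s \<partial>lborel) = (\<integral>\<^sup>+v. ennreal (exp (- l * (r * v))) \<partial>\<nu>) * (\<integral>\<^sup>+s. damped_weight \<gamma> l s \<partial>lborel)"
  using overshoot_identity[OF _ r, of "\<lambda>_. 1" l] by (simp add: nn_integral_multc)

lemma nn_integral_sweep:
  fixes f :: "'a::euclidean_space \<Rightarrow> ennreal"
  assumes [measurable]: "f \<in> borel_measurable borel" and r: "0 < r"
  shows "(\<integral>\<^sup>+x. sweep l r f x \<partial>lborel) = (\<integral>\<^sup>+v. ennreal (exp (- l * (r * v))) \<partial>\<nu>) * (\<integral>\<^sup>+x. f x \<partial>lborel)"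
proof -
  interpret P: pair_sigma_finite \<nu> "lborel :: 'a measure" ..
  have "(\<integral>\<^sup>+x. sweep l r f x \<partial>lborel) = (\<integral>\<^sup>+v. \<integral>\<^sup>+x. ennreal (exp (- l * (r * v))) * heat (r * v) f x \<partial>lborel \<partial>\<nu>)"
    unfolding sweep_def by (rule P.Fubini') measurable
  also have "\<dots> = (\<integral>\<^sup>+v. ennreal (exp (- l * (r * v))) * (\<integral>\<^sup>+x. f x \<partial>lborel) \<partial>\<nu>)"
    by (rule nn_integral_cong_AE) (use AE_pos r in \<open>auto simp: nn_integral_cmult nn_integral_heat\<close>)
  finally show ?thesis by (simp add: nn_integral_multc)
qed

lemma avg_head_plus_tail:
  fixes f :: "'a::euclidean_space \<Rightarrow> ennreal"
  assumes [measurable]: "f \<in> borel_measurable borel"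
  shows "avg (damped_weight \<gamma> l) f x = avg (head l r) f x + avg (tail l r) f x"
  unfolding avg_def by (subst nn_integral_add[symmetric]) (auto simp: head_plus_tail[of l _ r] distrib_right)

text \<open>Averaging \<open>f\<close> gives head plus tail, averaging its sweep gives the tail
  alone. To be cancelled in \<open>ennreal\<close> the tail has to be finite, which is obtained from
  \<open>l > 0\<close>.\<close>

lemma avg_excess:
  fixes f :: "'a::euclidean_space \<Rightarrow> ennreal"
  assumes [measurable]: "f \<in> borel_measurable borel" and r: "0 < r" and l: "0 < l"
    and f: "\<And>y. f y \<le> c" "c < \<infinity>" and le: "\<And>y. sweep l r f y \<le> f y"
  shows "avg (damped_weight \<gamma> l) (\<lambda>y. f y - sweep l r f y) x = avg (head l r) f x"
proof -
  have "avg (head l r) f x + avg (tail l r) f x = avg (damped_weight \<gamma> l) (\<lambda>y. (f y - sweep l r f y) + sweep l r f y) x"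
    using le by (subst avg_head_plus_tail[symmetric]) (auto simp: diff_add_cancel_ennreal)
  also have "\<dots> = avg (damped_weight \<gamma> l) (\<lambda>y. f y - sweep l r f y) x + avg (tail l r) f x"
    using r by (subst avg_add) (auto simp: avg_sweep)
  finally have "avg (head l r) f x + avg (tail l r) f x = avg (damped_weight \<gamma> l) (\<lambda>y. f y - sweep l r f y) x + avg (tail l r) f x" .
  moreover have "avg (tail l r) f x < \<infinity>"
  proof -
    have "avg (tail l r) f x \<le> (\<integral>\<^sup>+s. tail l r s \<partial>lborel) * c"
      by (rule avg_le_const) (auto simp: tail_nonpos f)
    also have "\<dots> \<le> (\<integral>\<^sup>+s. damped_weight \<gamma> l s \<partial>lborel) * c"
      by (intro mult_right_mono nn_integral_mono tail_le) auto
    also have "\<dots> < \<infinity>" using damped_weight_integral_finite[OF \<gamma> l] f(2) by (simp add: ennreal_mult_less_top)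
    finally show ?thesis .
  qed
  ultimately show ?thesis by (metis add.commute ennreal_add_left_cancel infinity_ennreal_def less_irrefl)
qed

text \<open>Let q be the factor by which sweeping multiplies integrals. The excess has (1 - q) times
  the integral of \<open>f\<close>, and the head has (1 - q) times the integral of the full weight;
  the assumption on \<open>f\<close> compares the two.\<close>

lemma nn_integral_excess_le:
  fixes f :: "'a::euclidean_space \<Rightarrow> ennreal"
  assumes [measurable]: "f \<in> borel_measurable borel" and r: "0 < r" and l: "0 < l"
    and f: "(\<integral>\<^sup>+x. f x \<partial>lborel) \<le> (\<integral>\<^sup>+s. damped_weight \<gamma> l s \<partial>lborel)" and le: "\<And>y. sweep l r f y \<le> f y"
  shows "(\<integral>\<^sup>+x. f x - sweep l r f x \<partial>lborel) \<le> (\<integral>\<^sup>+s. head l r s \<partial>lborel)"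
proof -
  define q where "q = (\<integral>\<^sup>+v. ennreal (exp (- l * (r * v))) \<partial>\<nu>)"
  define m where "m = (\<integral>\<^sup>+s. damped_weight \<gamma> l s \<partial>lborel)"
  define a where "a = (\<integral>\<^sup>+x. f x \<partial>lborel)"
  define h where "h = (\<integral>\<^sup>+s. head l r s \<partial>lborel)"
  define X where "X = (\<integral>\<^sup>+x. f x - sweep l r f x \<partial>lborel)"
  have m: "m < \<infinity>" unfolding m_def by (rule damped_weight_integral_finite[OF \<gamma> l])
  have q: "q \<le> 1"
  proof -
    have "q \<le> (\<integral>\<^sup>+v. 1 \<partial>\<nu>)" unfolding q_def
    proof (rule nn_integral_mono_AE)
      show "AE v in \<nu>. ennreal (exp (- l * (r * v))) \<le> 1"
        using AE_pos by eventually_elim (use r l in auto)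
    qed
    then show ?thesis by (simp add: emeasure_space_1)
  qed
  have mq: "m = h + q * m"
    unfolding m_def h_def q_def nn_integral_tail[OF r, symmetric]
    by (subst nn_integral_add[symmetric]) (auto intro!: nn_integral_cong head_plus_tail)
  have aX: "a = X + q * a"
    unfolding a_def X_def q_def using le r
    by (subst nn_integral_sweep[symmetric]) (auto simp: nn_integral_add[symmetric] diff_add_cancel_ennreal)
  have am: "a \<le> m" using f by (simp add: a_def m_def)
  then have "a < \<infinity>" "q < \<infinity>" "h < \<infinity>" "X < \<infinity>"
    using m q mq aX by (auto simp: less_top[symmetric] top_unique)
  \<comment> \<open>Everything is finite thanks to the damping, so the subtraction of the two
    identities can be done in the reals.\<close>
  then obtain a' q' h' X' m' where r': "a = ennreal a'" "q = ennreal q'" "h = ennreal h'" "X = ennreal X'" "m = ennreal m'"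
    "0 \<le> a'" "0 \<le> q'" "0 \<le> h'" "0 \<le> X'" "0 \<le> m'"
    using m by (metis ennreal_cases infinity_ennreal_def less_irrefl)
  have "m' = h' + q' * m'" "a' = X' + q' * a'" "a' \<le> m'" "q' \<le> 1"
    using mq aX am q r' by (auto simp: ennreal_mult[symmetric] ennreal_plus[symmetric] simp del: ennreal_plus)
  moreover have "(1 - q') * a' \<le> (1 - q') * m'" using calculation by (intro mult_left_mono) auto
  ultimately have "X' \<le> h'" by (simp add: algebra_simps)
  then show ?thesis using r' by (simp add: X_def[symmetric] h_def[symmetric] ennreal_leI)
qed

section \<open>Normalised short-time weights and approximate identities\<close>

definition unit_head :: "real \<Rightarrow> real \<Rightarrow> real \<Rightarrow> ennreal" where
  "unit_head l r s = inverse (\<integral>\<^sup>+s. head l r s \<partial>lborel) * head l r s"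

lemma unit_head_measurable[measurable]: "unit_head l r \<in> borel_measurable borel"
  unfolding unit_head_def by measurable

lemma unit_head_eq_0: "s \<le> 0 \<or> r < s \<Longrightarrow> unit_head l r s = 0"
  by (auto simp: unit_head_def head_nonpos) (simp add: head_def)

lemma nn_integral_unit_head:
  assumes "0 < r" "0 \<le> l"
  shows "(\<integral>\<^sup>+s. unit_head l r s \<partial>lborel) = 1"
proof -
  let ?H = "\<integral>\<^sup>+s. head l r s \<partial>lborel"
  have "(\<integral>\<^sup>+s. unit_head l r s \<partial>lborel) = ?H * inverse ?H"
    unfolding unit_head_def by (subst nn_integral_cmult) (auto simp: mult.commute)
  also have "\<dots> = 1"
    using head_integral_pos[of r l] head_integral_finite[of l r] assms ennreal_divide_self[of ?H]
    by (simp add: divide_ennreal_def)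
  finally show ?thesis .
qed

lemma avg_unit_head:
  fixes f :: "'a::euclidean_space \<Rightarrow> ennreal"
  shows "f \<in> borel_measurable borel \<Longrightarrow> avg (unit_head l r) f x = inverse (\<integral>\<^sup>+s. head l r s \<partial>lborel) * avg (head l r) f x"
  unfolding avg_def unit_head_def by (subst nn_integral_cmult[symmetric]) (auto simp: mult.assoc)

text \<open>Only two features of the weights matter, mass 1 and support in (0, r n], so the damping
  \<open>l n\<close> may vary with n.\<close>

lemma avg_unit_head_tendsto:
  fixes f :: "'a::euclidean_space \<Rightarrow> ennreal"
  assumes [measurable]: "f \<in> borel_measurable borel" and cont: "isCont f x"
    and bound: "\<And>y. f y \<le> c" "c < \<infinity>" and l: "\<And>n. 0 \<le> l n" and r: "\<And>n. 0 < r n" "r \<longlonglongrightarrow> 0"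
  shows "(\<lambda>n. avg (unit_head (l n) (r n)) f x) \<longlonglongrightarrow> f x"
proof -
  have lim: "((\<lambda>s. heat s f x) \<longlongrightarrow> f x) (at_right 0)"
    by (rule heat_tendsto[OF _ cont bound]) simp
  have const: "(\<integral>\<^sup>+s. unit_head (l n) (r n) s * b \<partial>lborel) = b" for n b
    by (simp add: nn_integral_multc nn_integral_unit_head l r)
  have small: "eventually (\<lambda>n. \<forall>s. 0 < s \<longrightarrow> s \<le> r n \<longrightarrow> P s) sequentially"
    if "eventually P (at_right 0)" for P
  proof -
    from that obtain \<eta> where \<eta>: "0 < \<eta>" "\<And>s. 0 < s \<Longrightarrow> s < \<eta> \<Longrightarrow> P s"
      by (auto simp: eventually_at_right_field)
    from order_tendstoD(2)[OF r(2) \<eta>(1)] show ?thesis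
      by eventually_elim (use \<eta> in auto)
  qed
  show ?thesis
  proof (rule order_tendstoI)
    fix b assume "b < f x"
    then obtain b' where b': "b < b'" "b' < f x" using dense by blast
    from small[OF order_tendstoD(1)[OF lim b'(2)]]
    show "eventually (\<lambda>n. b < avg (unit_head (l n) (r n)) f x) sequentially"
    proof eventually_elim
      case (elim n)
      have "(\<integral>\<^sup>+s. unit_head (l n) (r n) s * b' \<partial>lborel) \<le> avg (unit_head (l n) (r n)) f x"
        unfolding avg_def
      proof (rule nn_integral_mono)
        fix s
        show "unit_head (l n) (r n) s * b' \<le> unit_head (l n) (r n) s * heat s f x"
          using less_imp_le[OF elim[rule_format, of s]] unit_head_eq_0[of s "r n" "l n"]
          by (cases "0 < s \<and> s \<le> r n") (auto intro!: mult_left_mono simp: not_less not_le)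
      qed
      then show ?case using b' unfolding const by simp
    qed
  next
    fix b assume "f x < b"
    then obtain b' where b': "f x < b'" "b' < b" using dense by blast
    from small[OF order_tendstoD(2)[OF lim b'(1)]]
    show "eventually (\<lambda>n. avg (unit_head (l n) (r n)) f x < b) sequentially"
    proof eventually_elim
      case (elim n)
      have "avg (unit_head (l n) (r n)) f x \<le> (\<integral>\<^sup>+s. unit_head (l n) (r n) s * b' \<partial>lborel)"
        unfolding avg_def
      proof (rule nn_integral_mono)
        fix s
        show "unit_head (l n) (r n) s * heat s f x \<le> unit_head (l n) (r n) s * b'"
          using less_imp_le[OF elim[rule_format, of s]] unit_head_eq_0[of s "r n" "l n"]
          by (cases "0 < s \<and> s \<le> r n") (auto intro!: mult_left_mono simp: not_less not_le)
      qed
      then show ?case using b' unfolding const by simp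
    qed
  qed
qed

text \<open>For each v > 0 the time \<open>r n * v\<close> tends to 0 from the right, and the bound
  on \<open>f\<close> dominates. This recovers \<open>u 0\<close> from its sweeps at the end of the
  existence proof.\<close>

lemma sweep_tendsto_self:
  fixes f :: "'a::euclidean_space \<Rightarrow> ennreal"
  assumes [measurable]: "f \<in> borel_measurable borel" and cont: "isCont f x"
    and bound: "\<And>y. f y \<le> c" "c < \<infinity>" and r: "\<And>n. 0 < r n" "r \<longlonglongrightarrow> 0"
  shows "(\<lambda>n. sweep 0 (r n) f x) \<longlonglongrightarrow> f x"
proof -
  have lim: "((\<lambda>s. heat s f x) \<longlongrightarrow> f x) (at_right 0)"
    by (rule heat_tendsto[OF _ cont bound]) simp
  have "(\<lambda>n. \<integral>\<^sup>+v. heat (r n * v) f x \<partial>\<nu>) \<longlonglongrightarrow> (\<integral>\<^sup>+v. f x \<partial>\<nu>)"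
  proof (rule nn_integral_dominated_convergence[where w="\<lambda>_. c"])
    show "AE v in \<nu>. heat (r n * v) f x \<le> c" for n
      using AE_pos by eventually_elim (use r bound in \<open>auto intro!: heat_le_const\<close>)
    show "AE v in \<nu>. (\<lambda>n. heat (r n * v) f x) \<longlonglongrightarrow> f x"
      using AE_pos
    proof eventually_elim
      case (elim v)
      have "(\<lambda>n. r n * v) \<longlonglongrightarrow> 0" using tendsto_mult_right[OF r(2), of v] by simp
      then have "filterlim (\<lambda>n. r n * v) (at_right 0) sequentially"
        using elim r(1) by (intro tendsto_imp_filterlim_at_right always_eventually) auto
      then show ?case by (rule filterlim_compose[OF lim])
    qed
  qed (use bound in \<open>auto simp: emeasure_space_1\<close>)
  then show ?thesis by (simp add: sweep_def emeasure_space_1)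
qed

lemma sweep_tendsto:
  fixes f :: "nat \<Rightarrow> 'a::euclidean_space \<Rightarrow> ennreal"
  assumes [measurable]: "\<And>n. f n \<in> borel_measurable borel" "g \<in> borel_measurable borel"
    and lim: "\<And>y. (\<lambda>n. f n y) \<longlonglongrightarrow> g y" and bound: "\<And>n y. f n y \<le> c" and c: "c < \<infinity>" and r: "0 < r"
    and l: "\<And>n. 0 \<le> l n" "l \<longlonglongrightarrow> 0"
  shows "(\<lambda>n. sweep (l n) r (f n) x) \<longlonglongrightarrow> sweep 0 r g x"
  unfolding sweep_def
proof (rule nn_integral_dominated_convergence[where w="\<lambda>_. 1 * c"])
  have g: "g y \<le> c" for y by (rule LIMSEQ_le_const2[OF lim]) (use bound in auto)
  show "AE v in \<nu>. ennreal (exp (- l n * (r * v))) * heat (r * v) (f n) x \<le> 1 * c" for n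
    using AE_pos
  proof eventually_elim
    case (elim v)
    then show ?case using r l bound by (intro mult_mono heat_le_const) auto
  qed
  show "AE v in \<nu>. (\<lambda>n. ennreal (exp (- l n * (r * v))) * heat (r * v) (f n) x) \<longlonglongrightarrow>
      ennreal (exp (- 0 * (r * v))) * heat (r * v) g x"
    using AE_pos
  proof eventually_elim
    case (elim v)
    have "heat (r * v) g x \<le> c" using elim r g by (intro heat_le_const) auto
    then show ?case
      by (intro tendsto_mult_ennreal tendsto_ennrealI tendsto_intros l heat_tendsto_seq[OF _ _ lim bound c])
        (use elim r c in auto)
  qed
qed (use c in \<open>auto simp: emeasure_space_1\<close>)

end

subsection \<open>The potential of the farthest distance function\<close>

text \<open>The farthest distance enters as a function that dominates all distances to points of
  \<open>E\<close> and equals one of them at each x, so that no suprema have to be handled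
  below.\<close>

locale farthest_potential = overshoot \<nu> \<gamma> for \<nu> \<gamma> +
  fixes E :: "'a::euclidean_space set" and d :: "'a \<Rightarrow> real"
  assumes dim: "2 * \<gamma> < real DIM('a)"
    and bounded_E: "bounded E" and two: "\<exists>a\<in>E. \<exists>b\<in>E. a \<noteq> b"
    and d_attained: "\<And>x. \<exists>t\<in>E. d x = norm (x - t)"
    and d_upper: "\<And>x t. t \<in> E \<Longrightarrow> norm (x - t) \<le> d x"
begin

text \<open>A fixed unit vector, used to evaluate a radial kernel at a prescribed distance.\<close>

definition e :: 'a where "e = (SOME e. norm e = 1)"

lemma norm_e[simp]: "norm e = 1"
  unfolding e_def by (rule someI_ex) (use vector_choose_size[of 1] in auto)

lemma e_nonzero[simp]: "e \<noteq> 0"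
  using norm_e by force

lemma d_lipschitz: "\<bar>d x - d y\<bar> \<le> norm (x - y)"
proof -
  have "d x \<le> d y + norm (x - y)" for x y
  proof -
    obtain t where t: "t \<in> E" "d x = norm (x - t)" using d_attained by blast
    have "norm (x - t) \<le> norm (x - y) + norm (y - t)" by norm
    then show ?thesis using d_upper[OF t(1), of y] t by simp
  qed
  from this[of x y] this[of y x] show ?thesis by (simp add: norm_minus_commute abs_le_iff)
qed

lemma d_isCont: "isCont d x"
proof -
  have "1-lipschitz_on UNIV d"
    by (intro lipschitz_onI) (auto simp: dist_norm dist_real_def d_lipschitz)
  then have "continuous_on UNIV d" by (rule lipschitz_on_continuous_on)
  then show ?thesis by (simp add: continuous_on_eq_continuous_at)
qed

lemma d_measurable[measurable]: "d \<in> borel_measurable borel"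
  using d_isCont by (intro borel_measurable_continuous_onI continuous_at_imp_continuous_on) auto

text \<open>The larger of the distances to two distinct points is at least half the distance between
  them. This keeps \<open>u\<close> away from the pole of the kernel, uniformly in x.\<close>

lemma d_lower_bound: obtains \<delta> where "0 < \<delta>" "\<And>x. \<delta> \<le> d x"
proof -
  obtain a b where ab: "a \<in> E" "b \<in> E" "a \<noteq> b" using two by blast
  show ?thesis
  proof (rule that[of "norm (a - b) / 2"])
    show "norm (a - b) / 2 \<le> d x" for x
    proof -
      have "norm (a - b) \<le> norm (x - a) + norm (x - b)" by norm
      then show ?thesis using d_upper[OF ab(1), of x] d_upper[OF ab(2), of x] by simp
    qed
  qed (use ab in simp)
qed

lemma d_upper_bound: obtains R where "0 \<le> R" "\<And>x. d x \<le> norm x + R"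
proof -
  obtain R where R: "\<And>t. t \<in> E \<Longrightarrow> norm t \<le> R" using bounded_E by (auto simp: bounded_iff)
  show ?thesis
  proof (rule that[of "max R 0"])
    show "d x \<le> norm x + max R 0" for x
    proof -
      obtain t where t: "t \<in> E" "d x = norm (x - t)" using d_attained by blast
      then show ?thesis using R[OF t(1)] norm_triangle_ineq4[of x t] by simp
    qed
  qed simp
qed

lemma d_nonneg: "0 \<le> d x"
  by (rule d_lower_bound) (use order_trans less_imp_le in blast)

section \<open>The infimum of the translated kernels and its damped versions\<close>

abbreviation K :: "real \<Rightarrow> 'a \<Rightarrow> ennreal" where "K l \<equiv> kern (damped_weight \<gamma> l)"

text \<open>Since the kernel decreases radially, this is the infimum of its translates by points of
  \<open>E\<close>. The damping sits in the kernel rather than being a factor of \<open>u 0\<close>,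
  so that each \<open>u l\<close> is again such an infimum.\<close>

definition u :: "real \<Rightarrow> 'a \<Rightarrow> ennreal" where "u l x = K l (d x *\<^sub>R e)"

lemma u_measurable[measurable]: "u l \<in> borel_measurable borel"
  unfolding u_def by measurable

lemma K_mono: "norm x \<le> norm y \<Longrightarrow> K l y \<le> K l x"
  by (rule kern_mono) (simp add: damped_weight_nonpos)

lemma K_cong: "norm x = norm y \<Longrightarrow> K l x = K l y"
  by (rule kern_cong_norm) (simp add: damped_weight_nonpos)

lemma K_damp_mono: "l' \<le> l \<Longrightarrow> K l x \<le> K l' x"
  unfolding kern_def by (intro nn_integral_mono mult_right_mono damped_weight_le) auto

lemma K_finite: "0 \<le> l \<Longrightarrow> x \<noteq> 0 \<Longrightarrow> K l x < \<infinity>"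
  using le_less_trans[OF K_damp_mono[of 0 l x] kern_damped_weight_finite[OF \<gamma>(1) dim, of x]] by simp

lemma u_le_K: "t \<in> E \<Longrightarrow> u l x \<le> K l (x - t)"
  unfolding u_def using d_upper[of t x] by (intro K_mono) auto

lemma u_attained: "\<exists>t\<in>E. u l x = K l (x - t)"
  using d_attained[of x] unfolding u_def by (metis K_cong abs_norm_cancel mult.right_neutral norm_e norm_scaleR)

lemma u_damp_mono: "l' \<le> l \<Longrightarrow> u l x \<le> u l' x"
  unfolding u_def by (rule K_damp_mono)

text \<open>An infimum of translates of the kernel is still diminished by \<open>sweep\<close>.\<close>
lemma sweep_u_le: assumes "0 < r" shows "sweep l r (u l) x \<le> u l x"
proof -
  obtain t where t: "t \<in> E" "u l x = K l (x - t)" using u_attained by blast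
  have "sweep l r (u l) x \<le> sweep l r (\<lambda>y. K l (y - t)) x"
    by (rule sweep_mono) (rule u_le_K[OF t(1)])
  also have "\<dots> = kern (tail l r) (x - t)" by (rule sweep_kern[OF assms])
  also have "\<dots> \<le> K l (x - t)" unfolding kern_def by (intro nn_integral_mono mult_right_mono tail_le) auto
  finally show ?thesis using t by simp
qed

lemma u_bounded: obtains c where "c < \<infinity>" "\<And>l x. 0 \<le> l \<Longrightarrow> u l x \<le> c"
proof -
  obtain \<delta> where \<delta>: "0 < \<delta>" "\<And>x. \<delta> \<le> d x" by (rule d_lower_bound) (rule that)
  show ?thesis
  proof (rule that[of "K 0 (\<delta> *\<^sub>R e)"])
    show "K 0 (\<delta> *\<^sub>R e) < \<infinity>" using \<delta> by (intro K_finite) auto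
    show "u l x \<le> K 0 (\<delta> *\<^sub>R e)" if "0 \<le> l" for l x
      using u_damp_mono[OF that, of x] K_mono[of "\<delta> *\<^sub>R e" "d x *\<^sub>R e" 0] \<delta>(1) \<delta>(2)[of x] d_nonneg[of x]
      by (auto simp: u_def)
  qed
qed

lemma u_isCont: assumes "0 \<le> l" shows "isCont (u l) x"
proof -
  obtain \<delta> where \<delta>: "0 < \<delta>" "\<And>x. \<delta> \<le> d x" by (rule d_lower_bound) (rule that)
  show ?thesis
    unfolding continuous_at_sequentially
  proof (intro allI impI)
    fix X assume "X \<longlonglongrightarrow> x"
    then have "(\<lambda>n. d (X n) *\<^sub>R e) \<longlonglongrightarrow> d x *\<^sub>R e"
      by (intro tendsto_intros isCont_tendsto_compose[OF d_isCont])
    moreover have "norm (\<delta> *\<^sub>R e) \<le> norm (d (X n) *\<^sub>R e)" for n using \<delta>(1) \<delta>(2)[of "X n"] by simp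
    moreover have "K l (\<delta> *\<^sub>R e) < \<infinity>" using \<delta> assms by (intro K_finite) auto
    ultimately show "(u l \<circ> X) \<longlonglongrightarrow> u l x"
      unfolding o_def u_def by (intro kern_tendsto[of _ "\<delta> *\<^sub>R e"]) (auto simp: damped_weight_nonpos)
  qed
qed

lemma u_damp_tendsto:
  assumes l: "\<And>n. 0 \<le> l n" "l \<longlonglongrightarrow> 0"
  shows "(\<lambda>n. u (l n) x) \<longlonglongrightarrow> u 0 x"
  unfolding u_def kern_def
proof (rule nn_integral_dominated_convergence)
  show "AE s in lborel. damped_weight \<gamma> (l n) s * ennreal (gauss s (d x *\<^sub>R e)) \<le> damped_weight \<gamma> 0 s * ennreal (gauss s (d x *\<^sub>R e))" for n
    using l by (intro AE_I2 mult_right_mono damped_weight_le) auto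
  obtain \<delta> where "0 < \<delta>" "\<And>x. \<delta> \<le> d x" by (rule d_lower_bound) (rule that)
  then have "d x *\<^sub>R e \<noteq> 0" using less_le_trans[of 0 \<delta> "d x"] by auto
  then show "(\<integral>\<^sup>+s. damped_weight \<gamma> 0 s * ennreal (gauss s (d x *\<^sub>R e)) \<partial>lborel) < \<infinity>"
    using K_finite[of 0 "d x *\<^sub>R e"] by (simp add: kern_def)
  have "(\<lambda>n. damped_weight \<gamma> (l n) s) \<longlonglongrightarrow> damped_weight \<gamma> 0 s" for s
    unfolding damped_weight_def
    by (cases "0 < s") (auto intro!: tendsto_ennrealI tendsto_eq_intros l(2))
  then show "AE s in lborel. (\<lambda>n. damped_weight \<gamma> (l n) s * ennreal (gauss s (d x *\<^sub>R e))) \<longlonglongrightarrow> damped_weight \<gamma> 0 s * ennreal (gauss s (d x *\<^sub>R e))"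
    by (intro AE_I2 tendsto_multc_ennreal)
qed auto

text \<open>Function and time scale change together, so \<open>avg_unit_head_tendsto\<close> does
  not apply directly. By monotonicity in the damping, \<open>u (l n)\<close> lies between
  \<open>u (l m)\<close>, for n >= m, and \<open>u 0\<close>, to which it does apply.\<close>

lemma u_avg_tendsto:
  assumes l: "\<And>n. 0 < l n" "decseq l" "l \<longlonglongrightarrow> 0" and r: "\<And>n. 0 < r n" "r \<longlonglongrightarrow> 0"
  shows "(\<lambda>n. avg (unit_head (l n) (r n)) (u (l n)) x) \<longlonglongrightarrow> u 0 x"
proof -
  obtain c where c: "c < \<infinity>" "\<And>l x. 0 \<le> l \<Longrightarrow> u l x \<le> c" by (rule u_bounded) (rule that)
  have lim: "(\<lambda>n. avg (unit_head (l n) (r n)) (u k) x) \<longlonglongrightarrow> u k x" if "0 \<le> k" for k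
    by (rule avg_unit_head_tendsto[OF _ u_isCont[OF that] c(2)[OF that] c(1)]) (use l(1) r in \<open>auto intro: less_imp_le\<close>)
  show ?thesis
  proof (rule order_tendstoI)
    fix b assume b: "b < u 0 x"
    have "(\<lambda>n. u (l n) x) \<longlonglongrightarrow> u 0 x" by (rule u_damp_tendsto) (use l in \<open>auto intro: less_imp_le\<close>)
    from order_tendstoD(1)[OF this b] obtain m where m: "b < u (l m) x"
      by (auto simp: eventually_sequentially)
    from order_tendstoD(1)[OF lim m] l(1) have "eventually (\<lambda>n. b < avg (unit_head (l n) (r n)) (u (l m)) x) sequentially"
      by (auto intro: less_imp_le)
    with eventually_ge_at_top[of m]
    show "eventually (\<lambda>n. b < avg (unit_head (l n) (r n)) (u (l n)) x) sequentially"
    proof eventually_elim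
      case (elim n)
      have "avg (unit_head (l n) (r n)) (u (l m)) x \<le> avg (unit_head (l n) (r n)) (u (l n)) x"
        by (rule avg_mono) (use elim l(2) in \<open>auto intro: u_damp_mono decseqD\<close>)
      then show ?case using elim by simp
    qed
  next
    fix b assume b: "u 0 x < b"
    from order_tendstoD(2)[OF lim b]
    have "eventually (\<lambda>n. avg (unit_head (l n) (r n)) (u 0) x < b) sequentially" by simp
    then show "eventually (\<lambda>n. avg (unit_head (l n) (r n)) (u (l n)) x < b) sequentially"
    proof eventually_elim
      case (elim n)
      have "avg (unit_head (l n) (r n)) (u (l n)) x \<le> avg (unit_head (l n) (r n)) (u 0) x"
        by (rule avg_mono) (use l(1)[of n] in \<open>auto intro: u_damp_mono\<close>)
      then show ?case using elim by simp
    qed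
  qed
qed

text \<open>Compare Gaussian averages of variance c^2 at the origin. For the potential of
  \<open>\<sigma>\<close> the average is at most the mass of \<open>\<sigma>\<close> times that of
  the kernel, which is c^(2\<gamma>-N) \<kappa> by homogeneity. Since d x <= |x| + R, the average of
  \<open>u 0\<close> is at least c^(2\<gamma>-N) times a quantity tending to \<kappa> as c grows. As
  0 < \<kappa> < infinity, \<kappa> can be cancelled.\<close>

lemma mass_ge_1:
  fixes \<sigma> :: "'a measure"
  assumes \<sigma>: "finite_measure \<sigma>" "sets \<sigma> = sets borel" and eq: "\<And>x. mavg (damped_weight \<gamma> 0) \<sigma> x = u 0 x"
  shows "1 \<le> emeasure \<sigma> UNIV"
proof -
  interpret \<sigma>: finite_measure \<sigma> by fact
  have \<sigma>': "sigma_finite_measure \<sigma>" ..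
  note [measurable] = mheat_measurable[OF \<sigma>' \<sigma>(2)]
  obtain R where R: "0 \<le> R" "\<And>x. d x \<le> norm x + R" by (rule d_upper_bound) (rule that)
  define \<kappa> where "\<kappa> = heat 1 (K 0) 0"
  let ?p = "2 * \<gamma> - real DIM('a)" and ?m = "emeasure \<sigma> UNIV"
  have heat_K: "heat t (K 0) 0 = (\<integral>\<^sup>+s. damped_weight \<gamma> 0 s * ennreal (gauss (s + t) (0::'a)) \<partial>lborel)" if "0 < t" for t
    using heat_kern[of "damped_weight \<gamma> 0" t "0::'a" 0] that by (simp add: damped_weight_nonpos)
  have \<kappa>_fin: "\<kappa> < \<infinity>" unfolding \<kappa>_def using heat_K[of 1] kern_translated_gauss_finite[OF \<gamma>(1) dim] by simp
  have \<kappa>_pos: "\<kappa> > 0" unfolding \<kappa>_def heat_K[OF zero_less_one]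
    by (rule nn_integral_pos_if_pos_on[of _ 0 1]) (auto simp: damped_weight_def gauss_pos ennreal_zero_less_mult_iff)
  have le: "(\<integral>\<^sup>+z. K 0 ((norm z + R / real (Suc n)) *\<^sub>R e) * ennreal (gauss 1 (z::'a)) \<partial>lborel) \<le> ?m * \<kappa>" for n
  proof -
    define c where "c = real (Suc n)"
    have c: "c > 0" "sqrt (c\<^sup>2) = c" by (auto simp: c_def)
    have heat_scale: "heat (c\<^sup>2) (K 0) 0 = ennreal (c powr ?p) * \<kappa>"
      using c unfolding \<kappa>_def
      by (simp add: heat_eq_std kern_damped_weight_scale nn_integral_cmult mult.assoc)
    have "ennreal (c powr ?p) * (\<integral>\<^sup>+z. K 0 ((norm z + R / c) *\<^sub>R e) * ennreal (gauss 1 (z::'a)) \<partial>lborel) =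
        (\<integral>\<^sup>+z. K 0 ((c * norm z + R) *\<^sub>R e) * ennreal (gauss 1 (z::'a)) \<partial>lborel)"
    proof (subst nn_integral_cmult[symmetric], simp, rule nn_integral_cong)
      fix z :: 'a
      have "(c * norm z + R) *\<^sub>R e = c *\<^sub>R ((norm z + R / c) *\<^sub>R e)" using c by (simp add: algebra_simps)
      then show "ennreal (c powr ?p) * (K 0 ((norm z + R / c) *\<^sub>R e) * ennreal (gauss 1 z)) =
          K 0 ((c * norm z + R) *\<^sub>R e) * ennreal (gauss 1 z)"
        using kern_damped_weight_scale[OF c(1), of \<gamma> "(norm z + R / c) *\<^sub>R e"] by (simp add: mult.assoc)
    qed
    also have "\<dots> \<le> (\<integral>\<^sup>+z. u 0 (0 + sqrt (c\<^sup>2) *\<^sub>R z) * ennreal (gauss 1 (z::'a)) \<partial>lborel)"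
    proof (intro nn_integral_mono mult_right_mono)
      fix z :: 'a
      show "K 0 ((c * norm z + R) *\<^sub>R e) \<le> u 0 (0 + sqrt (c\<^sup>2) *\<^sub>R z)"
        unfolding u_def c(2) using R(1) R(2)[of "c *\<^sub>R z"] c d_nonneg[of "c *\<^sub>R z"] by (intro K_mono) auto
    qed simp
    also have "\<dots> = heat (c\<^sup>2) (mavg (damped_weight \<gamma> 0) \<sigma>) 0"
      using c by (subst heat_eq_std[symmetric]) (auto simp: eq[abs_def] fun_eq_iff heat_def eq)
    also have "\<dots> = (\<integral>\<^sup>+s. damped_weight \<gamma> 0 s * heat (c\<^sup>2) (mheat s \<sigma>) 0 \<partial>lborel)"
      unfolding mavg_def by (subst heat_time_integral) auto
    also have "\<dots> \<le> (\<integral>\<^sup>+s. ?m * (damped_weight \<gamma> 0 s * ennreal (gauss (s + c\<^sup>2) (0::'a))) \<partial>lborel)"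
    proof (rule nn_integral_mono)
      fix s :: real
      show "damped_weight \<gamma> 0 s * heat (c\<^sup>2) (mheat s \<sigma>) 0 \<le> ?m * (damped_weight \<gamma> 0 s * ennreal (gauss (s + c\<^sup>2) (0::'a)))"
      proof (cases "0 < s")
        case True
        have "heat (c\<^sup>2) (mheat s \<sigma>) 0 = mheat (s + c\<^sup>2) \<sigma> 0"
          using c True by (intro heat_mheat[OF \<sigma>' \<sigma>(2)]) auto
        \<comment> \<open>A Gaussian is largest at its centre, so moving all mass of
          \<open>\<sigma>\<close> to the origin can only increase the average there.\<close>
        also have "\<dots> \<le> (\<integral>\<^sup>+y. ennreal (gauss (s + c\<^sup>2) (0::'a)) \<partial>\<sigma>)"
          unfolding mheat_def using True c by (intro nn_integral_mono ennreal_leI gauss_mono) (auto simp: add_pos_pos)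
        also have "\<dots> = ?m * ennreal (gauss (s + c\<^sup>2) (0::'a))"
          using sets_eq_imp_space_eq[OF \<sigma>(2)] by (simp add: mult.commute)
        finally have "damped_weight \<gamma> 0 s * heat (c\<^sup>2) (mheat s \<sigma>) 0 \<le> damped_weight \<gamma> 0 s * (?m * ennreal (gauss (s + c\<^sup>2) (0::'a)))"
          by (rule mult_left_mono) simp
        then show ?thesis by (simp add: mult_ac)
      qed (simp add: damped_weight_nonpos)
    qed
    also have "\<dots> = ?m * heat (c\<^sup>2) (K 0) 0"
      using c heat_K[of "c\<^sup>2"] by (simp add: nn_integral_cmult)
    also have "\<dots> = ennreal (c powr ?p) * (?m * \<kappa>)" unfolding heat_scale by (simp add: mult_ac)
    finally have "ennreal (c powr ?p) * (\<integral>\<^sup>+z. K 0 ((norm z + R / c) *\<^sub>R e) * ennreal (gauss 1 (z::'a)) \<partial>lborel) \<le> ennreal (c powr ?p) * (?m * \<kappa>)" .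
    then show ?thesis using c unfolding c_def[symmetric] by (subst (asm) ennreal_mult_le_mult_iff) auto
  qed
  have "(\<lambda>n. \<integral>\<^sup>+z. K 0 ((norm z + R / real (Suc n)) *\<^sub>R e) * ennreal (gauss 1 (z::'a)) \<partial>lborel) \<longlonglongrightarrow>
      (\<integral>\<^sup>+z. K 0 z * ennreal (gauss 1 (z::'a)) \<partial>lborel)"
  proof (rule nn_integral_dominated_convergence[where w="\<lambda>z. K 0 z * ennreal (gauss 1 z)"])
    show "AE z in lborel. K 0 ((norm z + R / real (Suc n)) *\<^sub>R e) * ennreal (gauss 1 z) \<le> K 0 z * ennreal (gauss 1 z)" for n
      using R by (intro AE_I2 mult_right_mono K_mono) auto
    show "(\<integral>\<^sup>+z. K 0 (z::'a) * ennreal (gauss 1 (z::'a)) \<partial>lborel) < \<infinity>"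
      using \<kappa>_fin unfolding \<kappa>_def by (simp add: heat_eq_std)
    show "AE z in lborel. (\<lambda>n. K 0 ((norm z + R / real (Suc n)) *\<^sub>R e) * ennreal (gauss 1 z)) \<longlonglongrightarrow> K 0 z * ennreal (gauss 1 z)"
      using AE_lborel_singleton[of "0::'a"]
    proof eventually_elim
      case (elim z)
      have "(\<lambda>n. (norm z + R / real (Suc n)) *\<^sub>R e) \<longlonglongrightarrow> (norm z + 0) *\<^sub>R e"
        by (intro tendsto_intros LIMSEQ_Suc[OF lim_const_over_n])
      then have "(\<lambda>n. K 0 ((norm z + R / real (Suc n)) *\<^sub>R e)) \<longlonglongrightarrow> K 0 (norm z *\<^sub>R e)"
        using K_finite[of 0 z] elim R by (intro kern_tendsto[of _ z]) (auto simp: damped_weight_nonpos)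
      also have "K 0 (norm z *\<^sub>R e) = K 0 z" by (rule K_cong) simp
      finally show ?case by (rule tendsto_multc_ennreal)
    qed
  qed auto
  then have "(\<integral>\<^sup>+z. K 0 z * ennreal (gauss 1 (z::'a)) \<partial>lborel) \<le> ?m * \<kappa>"
    by (rule LIMSEQ_le_const2) (use le in auto)
  then have "\<kappa> \<le> ?m * \<kappa>" by (simp add: \<kappa>_def heat_eq_std)
  then have "\<kappa> * 1 \<le> \<kappa> * ?m" by (simp add: mult.commute)
  then show ?thesis using \<kappa>_pos \<kappa>_fin by (subst (asm) ennreal_mult_le_mult_iff) auto
qed

text \<open>\<open>u l\<close> lies below a single translate of the kernel, and the kernel has the
  integral of its weight because Gaussians have mass 1. This is the assumption on \<open>f\<close>
  in \<open>nn_integral_excess_le\<close>.\<close>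

lemma nn_integral_u_le:
  "(\<integral>\<^sup>+x. u l x \<partial>lborel) \<le> (\<integral>\<^sup>+s. damped_weight \<gamma> l s \<partial>lborel)"
proof -
  obtain t where t: "t \<in> E" using two by blast
  have "(\<integral>\<^sup>+x. u l x \<partial>lborel) \<le> (\<integral>\<^sup>+x. 1 * K l (t - x) \<partial>lborel)"
    using u_le_K[OF t, of l] kern_minus_commute[of _ t] by (intro nn_integral_mono) simp
  also have "\<dots> = avg (damped_weight \<gamma> l) (\<lambda>_. 1) t"
    by (simp add: avg_eq_kern)
  also have "\<dots> \<le> (\<integral>\<^sup>+s. damped_weight \<gamma> l s \<partial>lborel)"
    using avg_le_const[of "damped_weight \<gamma> l" "\<lambda>_. 1" 1 t] by (simp add: damped_weight_nonpos)
  finally show ?thesis .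
qed

section \<open>Approximating densities and their potentials\<close>

definition D :: "real \<Rightarrow> real \<Rightarrow> 'a \<Rightarrow> ennreal" where
  "D l r x = inverse (\<integral>\<^sup>+s. head l r s \<partial>lborel) * (u l x - sweep l r (u l) x)"

lemma D_measurable[measurable]: "D l r \<in> borel_measurable borel"
  unfolding D_def by measurable

lemma nn_integral_D_le:
  assumes l: "0 < l" and r: "0 < r"
  shows "(\<integral>\<^sup>+x. D l r x \<partial>lborel) \<le> 1"
proof -
  let ?H = "\<integral>\<^sup>+s. head l r s \<partial>lborel"
  have "(\<integral>\<^sup>+x. D l r x \<partial>lborel) = inverse ?H * (\<integral>\<^sup>+x. u l x - sweep l r (u l) x \<partial>lborel)"
    unfolding D_def by (simp add: nn_integral_cmult)
  also have "\<dots> \<le> inverse ?H * ?H"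
    by (intro mult_left_mono nn_integral_excess_le nn_integral_u_le sweep_u_le) (use l r in auto)
  also have "\<dots> = 1"
    using head_integral_pos[OF r, of l] head_integral_finite[of l r] l ennreal_divide_self[of ?H]
    by (simp add: divide_ennreal_def mult.commute)
  finally show ?thesis .
qed

lemma avg_D:
  assumes l: "0 < l" and r: "0 < r"
  shows "avg (damped_weight \<gamma> l) (D l r) x = avg (unit_head l r) (u l) x"
proof -
  obtain c where c: "c < \<infinity>" "\<And>l x. 0 \<le> l \<Longrightarrow> u l x \<le> c" by (rule u_bounded) (rule that)
  have "avg (damped_weight \<gamma> l) (D l r) x =
      inverse (\<integral>\<^sup>+s. head l r s \<partial>lborel) * avg (damped_weight \<gamma> l) (\<lambda>x. u l x - sweep l r (u l) x) x"
    unfolding D_def by (rule avg_cmult) auto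
  also have "avg (damped_weight \<gamma> l) (\<lambda>x. u l x - sweep l r (u l) x) x = avg (head l r) (u l) x"
    by (rule avg_excess[OF _ r l _ c(1)]) (use c l sweep_u_le[OF r] in auto)
  also have "inverse (\<integral>\<^sup>+s. head l r s \<partial>lborel) * avg (head l r) (u l) x = avg (unit_head l r) (u l) x"
    by (simp add: avg_unit_head)
  finally show ?thesis .
qed

text \<open>Sweeping both sides of \<open>avg_D\<close> at a second level \<epsilon>, independent of
  r, replaces the singular kernel of the potential by one that can be tested against a vague
  limit.\<close>

lemma avg_tail_D:
  assumes l: "0 < l" and r: "0 < r" and \<epsilon>: "0 < \<epsilon>"
  shows "avg (tail l \<epsilon>) (D l r) x = sweep l \<epsilon> (avg (unit_head l r) (u l)) x"
proof -
  have "avg (damped_weight \<gamma> l) (D l r) = avg (unit_head l r) (u l)"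
    using avg_D[OF l r] by (rule ext)
  moreover have "sweep l \<epsilon> (avg (damped_weight \<gamma> l) (D l r)) x = avg (tail l \<epsilon>) (D l r) x"
    by (rule sweep_avg[OF _ \<epsilon>]) simp
  ultimately show ?thesis by simp
qed

lemma avg_unit_head_u_le:
  assumes c: "\<And>l x. 0 \<le> l \<Longrightarrow> u l x \<le> c" and "0 \<le> l" "0 < r"
  shows "avg (unit_head l r) (u l) x \<le> c"
  using avg_le_const[of "unit_head l r" "u l" c x] assms by (simp add: nn_integral_unit_head unit_head_eq_0)

text \<open>A Gaussian is largest at 0, so this bounds, uniformly in space, what the tail kernel
  loses by damping.\<close>

definition tail_loss :: "real \<Rightarrow> real \<Rightarrow> ennreal" where
  "tail_loss \<epsilon> l = (\<integral>\<^sup>+s. (tail 0 \<epsilon> s - tail l \<epsilon> s) * ennreal (gauss s (0::'a)) \<partial>lborel)"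

lemma tail_damp_mono: "l' \<le> l \<Longrightarrow> tail l \<epsilon> s \<le> tail l' \<epsilon> s"
  unfolding tail_def by (intro mult_right_mono damped_weight_le) auto

lemma tail_loss_tendsto:
  assumes \<epsilon>: "0 < \<epsilon>" and l: "\<And>n. 0 \<le> l n" "l \<longlonglongrightarrow> 0"
  shows "(\<lambda>n. tail_loss \<epsilon> (l n)) \<longlonglongrightarrow> 0"
proof -
  have fin: "tail l \<epsilon> s < \<infinity>" for l s by (auto simp: tail_def damped_weight_def indicator_def)
  have "(\<lambda>n. tail_loss \<epsilon> (l n)) \<longlonglongrightarrow> (\<integral>\<^sup>+s. (tail 0 \<epsilon> s - tail 0 \<epsilon> s) * ennreal (gauss s (0::'a)) \<partial>lborel)"
    unfolding tail_loss_def
  proof (rule nn_integral_dominated_convergence[where w="\<lambda>s. tail 0 \<epsilon> s * ennreal (gauss s (0::'a))"])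
    show "(\<integral>\<^sup>+s. tail 0 \<epsilon> s * ennreal (gauss s (0::'a)) \<partial>lborel) < \<infinity>"
      using kern_tail_0_finite[OF dim \<epsilon>] by (simp add: kern_def)
    have "(\<lambda>n. tail (l n) \<epsilon> s) \<longlonglongrightarrow> tail 0 \<epsilon> s" for s
      unfolding damped_weight_def tail_def
      by (cases "0 < s"; cases "\<epsilon> < s") (auto intro!: tendsto_ennrealI tendsto_eq_intros l(2))
    then have "(\<lambda>n. tail 0 \<epsilon> s - tail (l n) \<epsilon> s) \<longlonglongrightarrow> tail 0 \<epsilon> s - tail 0 \<epsilon> s" for s
      using fin[of 0 s] by (intro tendsto_diff_ennreal) auto
    then show "AE s in lborel. (\<lambda>n. (tail 0 \<epsilon> s - tail (l n) \<epsilon> s) * ennreal (gauss s (0::'a))) \<longlonglongrightarrow> (tail 0 \<epsilon> s - tail 0 \<epsilon> s) * ennreal (gauss s (0::'a))"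
      by (intro AE_I2 tendsto_multc_ennreal)
  qed (auto intro!: mult_right_mono simp: diff_le_self_ennreal)
  then show ?thesis using fin by (simp add: less_top)
qed

lemma kern_tail_le:
  assumes "0 \<le> l"
  shows "kern (tail 0 \<epsilon>) (x::'a) \<le> kern (tail l \<epsilon>) x + tail_loss \<epsilon> l"
proof -
  have "kern (tail 0 \<epsilon>) x \<le> (\<integral>\<^sup>+s. tail l \<epsilon> s * ennreal (gauss s x) + (tail 0 \<epsilon> s - tail l \<epsilon> s) * ennreal (gauss s (0::'a)) \<partial>lborel)"
    unfolding kern_def
  proof (rule nn_integral_mono)
    fix s :: real
    show "tail 0 \<epsilon> s * ennreal (gauss s x) \<le> tail l \<epsilon> s * ennreal (gauss s x) + (tail 0 \<epsilon> s - tail l \<epsilon> s) * ennreal (gauss s (0::'a))"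
    proof (cases "0 < s")
      case True
      have "tail 0 \<epsilon> s * ennreal (gauss s x) = (tail l \<epsilon> s + (tail 0 \<epsilon> s - tail l \<epsilon> s)) * ennreal (gauss s x)"
        using tail_damp_mono[OF assms, of \<epsilon> s] by (simp add: add_diff_inverse_ennreal)
      also have "\<dots> \<le> tail l \<epsilon> s * ennreal (gauss s x) + (tail 0 \<epsilon> s - tail l \<epsilon> s) * ennreal (gauss s (0::'a))"
        unfolding distrib_right using gauss_mono[OF True, of 0 x] by (intro add_left_mono mult_left_mono ennreal_leI) auto
      finally show ?thesis .
    qed (simp add: tail_nonpos)
  qed
  also have "\<dots> = kern (tail l \<epsilon>) x + tail_loss \<epsilon> l"
    unfolding kern_def tail_loss_def by (rule nn_integral_add) auto
  finally show ?thesis .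
qed

text \<open>The Gaussians at 0 dominate, with finite superposition over the times beyond \<epsilon>.
  Together with \<open>kern_tail_vanishes\<close> this makes the tail kernel an admissible test
  function for \<open>vague_limit_subseq\<close>.\<close>

lemma kern_tail_continuous:
  assumes \<epsilon>: "0 < \<epsilon>"
  shows "continuous_on UNIV (\<lambda>y. enn2real (kern (tail 0 \<epsilon>) (x - y :: 'a)))"
proof (intro continuous_at_imp_continuous_on ballI)
  fix y :: 'a
  have fin: "kern (tail 0 \<epsilon>) (0::'a) < \<infinity>" by (rule kern_tail_0_finite[OF dim \<epsilon>])
  have fin': "kern (tail 0 \<epsilon>) z < \<infinity>" for z :: 'a
    using kern_mono[of "tail 0 \<epsilon>" 0 z] fin tail_nonpos by (simp add: le_less_trans)
  show "isCont (\<lambda>y. enn2real (kern (tail 0 \<epsilon>) (x - y))) y"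
    unfolding continuous_at_sequentially
  proof (intro allI impI)
    fix X assume "X \<longlonglongrightarrow> y"
    then have "(\<lambda>n. x - X n) \<longlonglongrightarrow> x - y" by (intro tendsto_intros)
    then have "(\<lambda>n. kern (tail 0 \<epsilon>) (x - X n)) \<longlonglongrightarrow> kern (tail 0 \<epsilon>) (x - y)"
      using fin by (intro kern_tendsto[of _ "0::'a"]) (auto simp: tail_nonpos)
    then show "((\<lambda>y. enn2real (kern (tail 0 \<epsilon>) (x - y))) \<circ> X) \<longlonglongrightarrow> enn2real (kern (tail 0 \<epsilon>) (x - y))"
      unfolding o_def using fin' by (intro tendsto_enn2real) (auto simp: less_top)
  qed
qed

text \<open>The tail kernel lies below the Riesz kernel, a multiple of |z|^(2\<gamma>-N) with
  negative exponent.\<close>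

lemma kern_tail_vanishes:
  "((\<lambda>y. enn2real (kern (tail 0 \<epsilon>) (x - y :: 'a))) \<longlongrightarrow> 0) at_infinity"
proof -
  let ?p = "2 * \<gamma> - real DIM('a)"
  have C: "K 0 e < \<infinity>" by (rule K_finite) auto
  have bound: "enn2real (kern (tail 0 \<epsilon>) z) \<le> norm z powr ?p * enn2real (K 0 e)" if "z \<noteq> 0" for z :: 'a
  proof -
    have "kern (tail 0 \<epsilon>) z \<le> K 0 z"
      unfolding kern_def by (intro nn_integral_mono mult_right_mono tail_le) auto
    also have "\<dots> = ennreal (norm z powr ?p) * K 0 e"
      using that by (intro kern_damped_weight_eq_powr) auto
    finally have "enn2real (kern (tail 0 \<epsilon>) z) \<le> enn2real (ennreal (norm z powr ?p) * K 0 e)"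
      using C by (intro enn2real_mono) (auto simp: ennreal_mult_less_top)
    then show ?thesis by (simp add: enn2real_mult)
  qed
  have inf: "filterlim (\<lambda>y. norm (x - y)) at_top at_infinity"
  proof (rule filterlim_at_top_mono)
    show "filterlim (\<lambda>y. - norm x + norm y) at_top at_infinity"
      by (rule filterlim_tendsto_add_at_top[OF tendsto_const filterlim_norm_at_top])
    show "eventually (\<lambda>y. - norm x + norm y \<le> norm (x - y)) at_infinity"
    proof (rule always_eventually, rule allI)
      fix y show "- norm x + norm y \<le> norm (x - y)"
        using norm_triangle_ineq2[of y x] by (simp add: norm_minus_commute)
    qed
  qed
  have "((\<lambda>y. norm (x - y) powr ?p) \<longlongrightarrow> 0) at_infinity"
    by (rule tendsto_neg_powr[OF _ inf]) (use dim in simp)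
  then have lim: "((\<lambda>y. norm (x - y) powr ?p * enn2real (K 0 e)) \<longlongrightarrow> 0) at_infinity"
    by (rule tendsto_mult_left_zero)
  show ?thesis
  proof (rule tendsto_sandwich[OF _ _ tendsto_const lim])
    have "eventually (\<lambda>y. norm (x - y) > 0) at_infinity" using inf unfolding filterlim_at_top_dense by blast
    then show "eventually (\<lambda>y. enn2real (kern (tail 0 \<epsilon>) (x - y)) \<le> norm (x - y) powr ?p * enn2real (K 0 e)) at_infinity"
      by eventually_elim (use bound in auto)
  qed auto
qed

text \<open>The integral is the Gaussian average of variance n + 1 of the kernel at its pole. It
  bounds the potential of the Gaussian that fills up the missing mass in the existence
  proof.\<close>

lemma translated_gauss_tendsto_0:
  "(\<lambda>n. \<integral>\<^sup>+s. damped_weight \<gamma> 0 s * ennreal (gauss (s + real (Suc n)) (0::'a)) \<partial>lborel) \<longlonglongrightarrow> 0"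
proof -
  have "(\<lambda>n. \<integral>\<^sup>+s. damped_weight \<gamma> 0 s * ennreal (gauss (s + real (Suc n)) (0::'a)) \<partial>lborel) \<longlonglongrightarrow> (\<integral>\<^sup>+s. damped_weight \<gamma> 0 s * 0 \<partial>lborel)"
  proof (rule nn_integral_dominated_convergence[where w="\<lambda>s. damped_weight \<gamma> 0 s * ennreal (gauss (s + 1) (0::'a))"])
    show "(\<integral>\<^sup>+s. damped_weight \<gamma> 0 s * ennreal (gauss (s + 1) (0::'a)) \<partial>lborel) < \<infinity>"
      by (rule kern_translated_gauss_finite[OF \<gamma>(1) dim])
    show "AE s in lborel. damped_weight \<gamma> 0 s * ennreal (gauss (s + real (Suc n)) (0::'a)) \<le> damped_weight \<gamma> 0 s * ennreal (gauss (s + 1) (0::'a))" for n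
    proof (rule AE_I2)
      fix s :: real
      show "damped_weight \<gamma> 0 s * ennreal (gauss (s + real (Suc n)) (0::'a)) \<le> damped_weight \<gamma> 0 s * ennreal (gauss (s + 1) (0::'a))"
      proof (cases "0 < s")
        case True
        then have "gauss (s + real (Suc n)) (0::'a) \<le> gauss (s + 1) (0::'a)"
          unfolding gauss_0 by (intro powr_mono2') auto
        then show ?thesis by (intro mult_left_mono ennreal_leI) auto
      qed (simp add: damped_weight_nonpos)
    qed
    have "(\<lambda>n. gauss (s + real (Suc n)) (0::'a)) \<longlonglongrightarrow> 0" for s
      unfolding gauss_0
    proof (rule tendsto_neg_powr)
      show "filterlim (\<lambda>n. 2 * pi * (s + real (Suc n))) at_top sequentially"
        by (intro filterlim_tendsto_pos_mult_at_top[OF tendsto_const] filterlim_tendsto_add_at_top[OF tendsto_const]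
            filterlim_compose[OF filterlim_real_sequentially filterlim_Suc]) auto
    qed simp
    from tendsto_ennrealI[OF this]
    have "(\<lambda>n. ennreal (gauss (s + real (Suc n)) (0::'a))) \<longlonglongrightarrow> 0" for s by simp
    then show "AE s in lborel. (\<lambda>n. damped_weight \<gamma> 0 s * ennreal (gauss (s + real (Suc n)) (0::'a))) \<longlonglongrightarrow> damped_weight \<gamma> 0 s * 0"
      by (intro AE_I2 ennreal_tendsto_cmult) (auto simp: damped_weight_def)
  qed auto
  then show ?thesis by simp
qed

text \<open>Damping and level are tied together as \<open>\<eta> n\<close>. For each fixed
  \<epsilon> the swept identity \<open>avg_tail_D\<close> passes to the vague limit; then \<epsilon>
  tends to 0. The vague limit has mass at most 1, and \<open>mass_ge_1\<close> excludes a
  loss.\<close>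

lemma equilibrium_exists:
  obtains \<sigma> :: "'a measure" where "prob_space \<sigma>" "sets \<sigma> = sets borel"
    "\<And>x. mavg (damped_weight \<gamma> 0) \<sigma> x = u 0 x"
proof -
  obtain c where c: "c < \<infinity>" "\<And>l x. 0 \<le> l \<Longrightarrow> u l x \<le> c" by (rule u_bounded) (rule that)
  define \<eta> where "\<eta> n = 1 / real (Suc n)" for n
  have \<eta>: "0 < \<eta> n" for n by (simp add: \<eta>_def)
  have \<eta>_lim: "\<eta> \<longlonglongrightarrow> 0" unfolding \<eta>_def using LIMSEQ_Suc[OF lim_const_over_n[of 1]] by simp
  have \<eta>_dec: "decseq \<eta>" unfolding \<eta>_def by (intro decseq_SucI) (simp add: field_simps)
  define m where "m n = (\<integral>\<^sup>+x. D (\<eta> n) (\<eta> n) x \<partial>lborel)" for n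
  have m: "m n \<le> 1" for n unfolding m_def by (rule nn_integral_D_le[OF \<eta> \<eta>])
  text \<open>The missing mass is filled up by Gaussians that spread out to infinity.\<close>
  define \<tau> where "\<tau> n = density lborel (\<lambda>x. D (\<eta> n) (\<eta> n) x + (1 - m n) * ennreal (gauss (real (Suc n)) (x::'a)))" for n
  have \<tau>_int: "(\<integral>\<^sup>+y. f y \<partial>\<tau> n) = (\<integral>\<^sup>+y. D (\<eta> n) (\<eta> n) y * f y \<partial>lborel) + (1 - m n) * (\<integral>\<^sup>+y. f y * ennreal (gauss (real (Suc n)) y) \<partial>lborel)"
    if [measurable]: "f \<in> borel_measurable borel" for f n
  proof -
    have "(\<integral>\<^sup>+y. f y \<partial>\<tau> n) = (\<integral>\<^sup>+y. D (\<eta> n) (\<eta> n) y * f y + (1 - m n) * (f y * ennreal (gauss (real (Suc n)) y)) \<partial>lborel)"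
      unfolding \<tau>_def by (subst nn_integral_density) (auto intro!: nn_integral_cong simp: distrib_left distrib_right mult_ac)
    then show ?thesis by (simp add: nn_integral_add nn_integral_cmult)
  qed
  have "prob_space (\<tau> n)" for n
  proof (rule prob_spaceI)
    have "emeasure (\<tau> n) (space (\<tau> n)) = (\<integral>\<^sup>+y. 1 \<partial>\<tau> n)" by simp
    also have "\<dots> = m n + (1 - m n)" by (subst \<tau>_int) (simp_all add: m_def nn_integral_gauss del: of_nat_Suc)
    also have "\<dots> = 1" using m by (simp add: add_diff_inverse_ennreal)
    finally show "emeasure (\<tau> n) (space (\<tau> n)) = 1" .
  qed
  moreover have sets_\<tau>: "sets (\<tau> n) = sets borel" for n by (simp add: \<tau>_def)
  ultimately obtain r :: "nat \<Rightarrow> nat" and \<sigma> where r: "strict_mono r" and \<sigma>: "sets \<sigma> = sets borel" "emeasure \<sigma> UNIV \<le> 1"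
    and lim: "\<And>f :: 'a \<Rightarrow> real. continuous_on UNIV f \<Longrightarrow> (f \<longlongrightarrow> 0) at_infinity \<Longrightarrow>
       (\<lambda>n. \<integral>x. f x \<partial>\<tau> (r n)) \<longlonglongrightarrow> (\<integral>x. f x \<partial>\<sigma>)"
    by (rule vague_limit_subseq) (rule that)
  note \<tau>_prob = \<open>\<And>n. prob_space (\<tau> n)\<close>
  have \<sigma>_fin: "finite_measure \<sigma>"
    using \<sigma> sets_eq_imp_space_eq[OF \<sigma>(1)] by (intro finite_measureI) (auto simp: top_unique)
  then have \<sigma>_sf: "sigma_finite_measure \<sigma>" by (rule finite_measure.sigma_finite_measure)
  have tail_eq: "mavg (tail 0 \<epsilon>) \<sigma> x = sweep 0 \<epsilon> (u 0) x" if \<epsilon>: "0 < \<epsilon>" for \<epsilon> x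
  proof -
    define k where "k y = kern (tail 0 \<epsilon>) (x - y)" for y :: 'a
    have [measurable]: "k \<in> borel_measurable borel" unfolding k_def by measurable
    have k_fin: "kern (tail 0 \<epsilon>) (0::'a) < \<infinity>" by (rule kern_tail_0_finite[OF dim \<epsilon>])
    have k_le: "k y \<le> kern (tail 0 \<epsilon>) (0::'a)" for y
      unfolding k_def by (rule kern_mono) (auto simp: tail_nonpos)
    have k_real: "ennreal (enn2real (k y)) = k y" for y
      using le_less_trans[OF k_le k_fin] by (simp add: less_top)
    have int_k: "(\<integral>\<^sup>+y. k y \<partial>M) = ennreal (\<integral>y. enn2real (k y) \<partial>M)"
      if M: "finite_measure M" "sets M = sets borel" for M
    proof -
      interpret finite_measure M by fact
      note [measurable_cong] = M(2)
      have "integrable M (\<lambda>y. enn2real (k y))"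
        using k_fin by (intro integrable_const_bound[where B="enn2real (kern (tail 0 \<epsilon>) (0::'a))"])
          (auto intro!: enn2real_mono k_le)
      then show ?thesis using nn_integral_eq_integral[of M "\<lambda>y. enn2real (k y)"] by (simp add: k_real)
    qed
    have "(\<lambda>n. \<integral>y. enn2real (k y) \<partial>\<tau> (r n)) \<longlonglongrightarrow> (\<integral>y. enn2real (k y) \<partial>\<sigma>)"
      unfolding k_def by (rule lim[OF kern_tail_continuous[OF \<epsilon>] kern_tail_vanishes])
    then have lim1: "(\<lambda>n. \<integral>\<^sup>+y. k y \<partial>\<tau> (r n)) \<longlonglongrightarrow> (\<integral>\<^sup>+y. k y \<partial>\<sigma>)"
      using int_k[OF \<sigma>_fin \<sigma>(1)] int_k[OF prob_space.finite_measure[OF \<tau>_prob] sets_\<tau>]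
      by (simp add: tendsto_ennrealI)
    let ?S = "\<lambda>n. sweep (\<eta> n) \<epsilon> (avg (unit_head (\<eta> n) (\<eta> n)) (u (\<eta> n))) x"
    have S: "?S n = (\<integral>\<^sup>+y. D (\<eta> n) (\<eta> n) y * kern (tail (\<eta> n) \<epsilon>) (x - y) \<partial>lborel)" for n
      using avg_tail_D[OF \<eta> \<eta> \<epsilon>, of n n x] by (simp add: avg_eq_kern)
    have lim_S: "?S \<longlonglongrightarrow> sweep 0 \<epsilon> (u 0) x"
      by (rule sweep_tendsto[OF _ _ u_avg_tendsto[OF \<eta> \<eta>_dec \<eta>_lim \<eta> \<eta>_lim] avg_unit_head_u_le[OF c(2)] c(1) \<epsilon> _ \<eta>_lim])
        (use \<eta> in \<open>auto intro: less_imp_le\<close>)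
    \<comment> \<open>The left side is the potential of the density \<open>D\<close> alone, with the
      damped tail kernel. Dropping the damping and adding the filling Gaussian can only increase
      it.\<close>
    have lower: "?S n \<le> (\<integral>\<^sup>+y. k y \<partial>\<tau> n)" for n
    proof -
      have "?S n \<le> (\<integral>\<^sup>+y. D (\<eta> n) (\<eta> n) y * k y \<partial>lborel)"
        unfolding S k_def kern_def using \<eta>[of n]
        by (intro nn_integral_mono mult_left_mono mult_right_mono tail_damp_mono) auto
      then show ?thesis by (subst \<tau>_int) (auto intro: order_trans)
    qed
    let ?G = "\<lambda>n. \<integral>\<^sup>+s. damped_weight \<gamma> 0 s * ennreal (gauss (s + real (Suc n)) (0::'a)) \<partial>lborel"
    \<comment> \<open>The errors are the loss by damping, integrated against a density of mass at
      most 1, and the potential of the filling Gaussian; both tend to 0.\<close>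
    have upper: "(\<integral>\<^sup>+y. k y \<partial>\<tau> n) \<le> ?S n + tail_loss \<epsilon> (\<eta> n) + ?G n" for n
    proof -
      have "(\<integral>\<^sup>+y. D (\<eta> n) (\<eta> n) y * k y \<partial>lborel) \<le>
          (\<integral>\<^sup>+y. D (\<eta> n) (\<eta> n) y * kern (tail (\<eta> n) \<epsilon>) (x - y) + D (\<eta> n) (\<eta> n) y * tail_loss \<epsilon> (\<eta> n) \<partial>lborel)"
        unfolding k_def distrib_left[symmetric] using \<eta>[of n]
        by (intro nn_integral_mono mult_left_mono kern_tail_le) auto
      also have "\<dots> = ?S n + m n * tail_loss \<epsilon> (\<eta> n)"
        unfolding S m_def by (simp add: nn_integral_add nn_integral_multc)
      also have "\<dots> \<le> ?S n + 1 * tail_loss \<epsilon> (\<eta> n)"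
        by (intro add_left_mono mult_right_mono m) auto
      finally have 1: "(\<integral>\<^sup>+y. D (\<eta> n) (\<eta> n) y * k y \<partial>lborel) \<le> ?S n + tail_loss \<epsilon> (\<eta> n)" by simp
      have "(\<integral>\<^sup>+y. k y * ennreal (gauss (real (Suc n)) y) \<partial>lborel) \<le>
          (\<integral>\<^sup>+y. K 0 (y - x) * ennreal (gauss (real (Suc n)) (0 - y)) \<partial>lborel)"
      proof (rule nn_integral_mono)
        fix y
        have "k y \<le> K 0 (y - x)"
          unfolding k_def kern_minus_commute[of _ x] unfolding kern_def by (intro nn_integral_mono mult_right_mono tail_le) auto
        then show "k y * ennreal (gauss (real (Suc n)) y) \<le> K 0 (y - x) * ennreal (gauss (real (Suc n)) (0 - y))"
          using gauss_minus_commute[of "real (Suc n)" 0 y] by (simp add: mult_right_mono)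
      qed
      also have "\<dots> = (\<integral>\<^sup>+s. damped_weight \<gamma> 0 s * ennreal (gauss (s + real (Suc n)) (0 - x)) \<partial>lborel)"
        using heat_kern[of "damped_weight \<gamma> 0" "real (Suc n)" x 0] by (simp add: heat_def damped_weight_nonpos)
      also have "\<dots> \<le> ?G n"
      proof (rule nn_integral_mono)
        fix s :: real
        show "damped_weight \<gamma> 0 s * ennreal (gauss (s + real (Suc n)) (0 - x)) \<le> damped_weight \<gamma> 0 s * ennreal (gauss (s + real (Suc n)) (0::'a))"
          by (cases "0 < s") (auto intro!: mult_left_mono ennreal_leI gauss_mono simp: damped_weight_nonpos)
      qed
      finally have 2: "(\<integral>\<^sup>+y. k y * ennreal (gauss (real (Suc n)) y) \<partial>lborel) \<le> ?G n" .
      have "(1 - m n) * (\<integral>\<^sup>+y. k y * ennreal (gauss (real (Suc n)) y) \<partial>lborel) \<le> 1 * ?G n"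
        by (intro mult_mono 2 diff_le_self_ennreal) auto
      then show ?thesis using 1 by (subst \<tau>_int) (auto intro!: add_mono)
    qed
    have lim_tl: "(\<lambda>n. tail_loss \<epsilon> (\<eta> n)) \<longlonglongrightarrow> 0"
      by (rule tail_loss_tendsto[OF \<epsilon> _ \<eta>_lim]) (use \<eta> in \<open>auto intro: less_imp_le\<close>)
    have "(\<lambda>n. ?S n + tail_loss \<epsilon> (\<eta> n) + ?G n) \<longlonglongrightarrow> sweep 0 \<epsilon> (u 0) x + 0 + 0"
      by (intro tendsto_add lim_S lim_tl translated_gauss_tendsto_0)
    then have "(\<lambda>n. ?S n + tail_loss \<epsilon> (\<eta> n) + ?G n) \<longlonglongrightarrow> sweep 0 \<epsilon> (u 0) x" by simp
    from tendsto_sandwich[OF always_eventually[OF allI[OF lower]] always_eventually[OF allI[OF upper]] lim_S this]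
    have "(\<lambda>n. \<integral>\<^sup>+y. k y \<partial>\<tau> n) \<longlonglongrightarrow> sweep 0 \<epsilon> (u 0) x" .
    from LIMSEQ_subseq_LIMSEQ[OF this r] have "(\<lambda>n. \<integral>\<^sup>+y. k y \<partial>\<tau> (r n)) \<longlonglongrightarrow> sweep 0 \<epsilon> (u 0) x"
      by (simp add: o_def)
    from LIMSEQ_unique[OF lim1 this] show ?thesis
      using mavg_eq_kern[OF \<sigma>_sf \<sigma>(1), of "tail 0 \<epsilon>" x] by (simp add: k_def)
  qed
  have eq: "mavg (damped_weight \<gamma> 0) \<sigma> x = u 0 x" for x
  proof -
    note [measurable] = mheat_measurable[OF \<sigma>_sf \<sigma>(1)]
    \<comment> \<open>As the level decreases to 0 the tail weights increase to the full weight, and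
      monotone convergence requires no control of the kernel near its pole.\<close>
    have "(\<lambda>n. mavg (tail 0 (\<eta> n)) \<sigma> x) \<longlonglongrightarrow> mavg (damped_weight \<gamma> 0) \<sigma> x"
      unfolding mavg_def
    proof (rule nn_integral_LIMSEQ)
      show "incseq (\<lambda>n s. tail 0 (\<eta> n) s * mheat s \<sigma> x)"
        using \<eta>_dec by (intro incseq_SucI le_funI mult_right_mono)
          (auto simp: tail_def indicator_def decseq_Suc_iff intro: le_less_trans)
      fix s
      have "eventually (\<lambda>n. tail 0 (\<eta> n) s * mheat s \<sigma> x = damped_weight \<gamma> 0 s * mheat s \<sigma> x) sequentially"
      proof (cases "0 < s")
        case True
        from order_tendstoD(2)[OF \<eta>_lim this] show ?thesis
          by eventually_elim (simp add: tail_def)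
      qed (simp add: tail_nonpos damped_weight_nonpos)
      then show "(\<lambda>n. tail 0 (\<eta> n) s * mheat s \<sigma> x) \<longlonglongrightarrow> damped_weight \<gamma> 0 s * mheat s \<sigma> x"
        by (rule tendsto_eventually)
    qed auto
    moreover have "(\<lambda>n. mavg (tail 0 (\<eta> n)) \<sigma> x) \<longlonglongrightarrow> u 0 x"
      unfolding tail_eq[OF \<eta>]
      by (rule sweep_tendsto_self[OF _ u_isCont c(2) c(1) \<eta> \<eta>_lim]) auto
    ultimately show ?thesis by (rule LIMSEQ_unique)
  qed
  have "emeasure \<sigma> UNIV = 1"
    using mass_ge_1[OF \<sigma>_fin \<sigma>(1) eq] \<sigma>(2) by simp
  then have "prob_space \<sigma>" using sets_eq_imp_space_eq[OF \<sigma>(1)] by (intro prob_spaceI) simp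
  then show ?thesis using that \<sigma>(1) eq by blast
qed

text \<open>Subtracting from \<open>u 0\<close> its sweep leaves the short-time average of the
  measure, which is thus the same for both measures. By duality, short-time averages of
  \<open>f\<close> have equal integrals against both, and these averages tend to
  \<open>f\<close>.\<close>

lemma equilibrium_unique:
  fixes \<sigma> \<tau> :: "'a measure"
  assumes \<sigma>: "finite_measure \<sigma>" "sets \<sigma> = sets borel" "\<And>x. mavg (damped_weight \<gamma> 0) \<sigma> x = u 0 x"
    and \<tau>: "finite_measure \<tau>" "sets \<tau> = sets borel" "\<And>x. mavg (damped_weight \<gamma> 0) \<tau> x = u 0 x"
  shows "\<sigma> = \<tau>"
proof (rule measure_eqI_bounded_continuous[OF \<sigma>(1,2) \<tau>(1,2)])
  fix f :: "'a \<Rightarrow> real" assume f: "continuous_on UNIV f" "\<And>x. 0 \<le> f x \<and> f x \<le> 1"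
  obtain c where c: "c < \<infinity>" "\<And>l x. 0 \<le> l \<Longrightarrow> u l x \<le> c" by (rule u_bounded) (rule that)
  have [measurable]: "f \<in> borel_measurable borel" by (rule borel_measurable_continuous_onI[OF f(1)])
  have cont: "isCont (\<lambda>x. ennreal (f x)) x" for x
    using f(1) by (auto simp: continuous_on_eq_continuous_at isCont_def intro: tendsto_ennrealI)
  define \<eta> where "\<eta> n = 1 / real (Suc n)" for n
  have \<eta>: "0 < \<eta> n" for n by (simp add: \<eta>_def)
  have \<eta>_lim: "\<eta> \<longlonglongrightarrow> 0" unfolding \<eta>_def using LIMSEQ_Suc[OF lim_const_over_n[of 1]] by simp
  have head_eq: "mavg (head 0 r) \<rho> x = u 0 x - sweep 0 r (u 0) x"
    if r: "0 < r" and \<rho>: "finite_measure \<rho>" "sets \<rho> = sets borel" "\<And>x. mavg (damped_weight \<gamma> 0) \<rho> x = u 0 x" for r \<rho> x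
  proof -
    have sf: "sigma_finite_measure \<rho>" using \<rho>(1) by (rule finite_measure.sigma_finite_measure)
    note [measurable] = mheat_measurable[OF sf \<rho>(2)]
    have "u 0 x = mavg (head 0 r) \<rho> x + mavg (tail 0 r) \<rho> x"
      unfolding \<rho>(3)[symmetric] mavg_def
      by (subst nn_integral_add[symmetric]) (auto intro!: nn_integral_cong simp: head_plus_tail[of 0 _ r] distrib_right)
    also have "mavg (tail 0 r) \<rho> x = sweep 0 r (u 0) x"
      using sweep_mavg[OF sf \<rho>(2) r, of 0 x] \<rho>(3) by (simp add: fun_eq_iff[symmetric] ext[OF \<rho>(3)])
    finally have "u 0 x = mavg (head 0 r) \<rho> x + sweep 0 r (u 0) x" .
    \<comment> \<open>Without damping the subtraction in \<open>ennreal\<close> is justified by the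
      bound on \<open>u 0\<close>, which sweeping preserves.\<close>
    moreover have "sweep 0 r (u 0) x < \<infinity>"
      using sweep_le_const[OF r, of 0 "u 0" c x] c by (auto intro: le_less_trans)
    ultimately show ?thesis by (simp add: less_top)
  qed
  have lim: "(\<lambda>n. \<integral>\<^sup>+y. avg (unit_head 0 (\<eta> n)) f y \<partial>\<rho>) \<longlonglongrightarrow> (\<integral>\<^sup>+y. f y \<partial>\<rho>)"
    if \<rho>: "finite_measure \<rho>" "sets \<rho> = sets borel" for \<rho>
  proof (rule nn_integral_dominated_convergence[where w="\<lambda>_. 1"])
    interpret finite_measure \<rho> by fact
    note [measurable_cong] = \<rho>(2)
    show "(\<integral>\<^sup>+x. 1 \<partial>\<rho>) < \<infinity>" by (simp add: less_top[symmetric])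
    show "(\<lambda>y. avg (unit_head 0 (\<eta> n)) f y) \<in> borel_measurable \<rho>" "(\<lambda>y. ennreal (f y)) \<in> borel_measurable \<rho>" for n
      by measurable
    show "AE y in \<rho>. avg (unit_head 0 (\<eta> n)) f y \<le> 1" for n
      using avg_le_const[of "unit_head 0 (\<eta> n)" f 1] f(2) \<eta>
      by (auto simp: nn_integral_unit_head unit_head_eq_0)
    show "AE y in \<rho>. (\<lambda>n. avg (unit_head 0 (\<eta> n)) f y) \<longlonglongrightarrow> ennreal (f y)"
      by (intro AE_I2 avg_unit_head_tendsto[OF _ cont _ _ _ \<eta> \<eta>_lim, of 1]) (use f(2) in auto)
  qed auto
  have same: "(\<integral>\<^sup>+y. avg (unit_head 0 (\<eta> n)) f y \<partial>\<sigma>) = (\<integral>\<^sup>+y. avg (unit_head 0 (\<eta> n)) f y \<partial>\<tau>)" for n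
  proof -
    have "(\<integral>\<^sup>+y. avg (unit_head 0 (\<eta> n)) f y \<partial>\<rho>) =
       inverse (\<integral>\<^sup>+s. head 0 (\<eta> n) s \<partial>lborel) * (\<integral>\<^sup>+x. f x * (u 0 x - sweep 0 (\<eta> n) (u 0) x) \<partial>lborel)"
      if \<rho>: "finite_measure \<rho>" "sets \<rho> = sets borel" "\<And>x. mavg (damped_weight \<gamma> 0) \<rho> x = u 0 x" for \<rho>
    proof -
      have sf: "sigma_finite_measure \<rho>" using \<rho>(1) by (rule finite_measure.sigma_finite_measure)
      have [measurable]: "avg (head 0 (\<eta> n)) f \<in> borel_measurable \<rho>"
        using avg_measurable[of "head 0 (\<eta> n)" "\<lambda>x. ennreal (f x)" "\<lambda>x. x" borel] \<rho>(2)
        by (simp cong: measurable_cong_sets)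
      have "(\<integral>\<^sup>+y. avg (unit_head 0 (\<eta> n)) f y \<partial>\<rho>) = inverse (\<integral>\<^sup>+s. head 0 (\<eta> n) s \<partial>lborel) * (\<integral>\<^sup>+y. avg (head 0 (\<eta> n)) f y \<partial>\<rho>)"
        by (simp add: avg_unit_head nn_integral_cmult)
      also have "(\<integral>\<^sup>+y. avg (head 0 (\<eta> n)) f y \<partial>\<rho>) = (\<integral>\<^sup>+x. f x * mavg (head 0 (\<eta> n)) \<rho> x \<partial>lborel)"
        by (rule nn_integral_mavg[OF _ _ sf \<rho>(2), symmetric]) auto
      finally show ?thesis by (simp add: head_eq[OF \<eta> \<rho>])
    qed
    from this[OF \<sigma>] this[OF \<tau>] show ?thesis by simp
  qed
  show "(\<integral>\<^sup>+x. ennreal (f x) \<partial>\<sigma>) = (\<integral>\<^sup>+x. ennreal (f x) \<partial>\<tau>)"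
    using LIMSEQ_unique[OF lim[OF \<sigma>(1,2)]] lim[OF \<tau>(1,2)] unfolding same by simp
qed

end

theorem theorem2p2:
  fixes E :: "(real ^ 'n) set" and \<alpha> :: real
  assumes "CARD('n) \<ge> 2"
    and "0 < \<alpha>" and "\<alpha> \<le> 2" and "\<alpha> \<noteq> real CARD('n)"
    and "compact E" and "\<exists>a\<in>E. \<exists>b\<in>E. a \<noteq> b"
  shows "\<exists>!\<sigma> :: (real ^ 'n) measure.
    sets \<sigma> = sets borel \<and> prob_space \<sigma> \<and>
    (\<forall>x. ennreal (farthest_dist E x powr (\<alpha> - real CARD('n)))
           = (\<integral>\<^sup>+ t. riesz_kernel \<alpha> x t \<partial>\<sigma>))"
proof -
  have N: "\<alpha> < real CARD('n)"
    using assms(1,3,4) by linarith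
  \<comment> \<open>The index of the subordinator: the weight s^(\<gamma>-1) produces a kernel with
    exponent 2\<gamma> - N, which has to be \<alpha> - N.\<close>
  define \<gamma> where "\<gamma> = \<alpha> / 2"
  have \<gamma>: "0 < \<gamma>" "\<gamma> \<le> 1" "2 * \<gamma> = \<alpha>" using assms by (auto simp: \<gamma>_def)
  obtain \<nu> :: "real measure" where \<nu>: "prob_space \<nu>" "sets \<nu> = sets borel" "AE v in \<nu>. 1 \<le> v"
    "\<And>s. (\<integral>\<^sup>+v. damped_weight \<gamma> 0 (s - v) \<partial>\<nu>) = damped_weight \<gamma> 0 s * indicator {1<..} s"
    by (rule exists_overshoot_law[OF \<gamma>(1,2)]) (rule that)
  have "E \<noteq> {}" using assms(6) by auto
  have attained: "\<exists>t\<in>E. farthest_dist E x = norm (x - t) \<and> (\<forall>s\<in>E. norm (x - s) \<le> norm (x - t))" for x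
  proof -
    have "continuous_on E (\<lambda>t. norm (x - t))" by (intro continuous_intros)
    from continuous_attains_sup[OF assms(5) \<open>E \<noteq> {}\<close> this]
    obtain t where t: "t \<in> E" "\<forall>s\<in>E. norm (x - s) \<le> norm (x - t)" by blast
    then have "farthest_dist E x = norm (x - t)"
      unfolding farthest_dist_def by (intro cSup_eq_maximum) auto
    with t show ?thesis by blast
  qed
  interpret T: overshoot \<nu> \<gamma>
    by (intro overshoot.intro overshoot_axioms.intro \<nu> \<gamma>(1,2))
  interpret F: farthest_potential \<nu> \<gamma> E "farthest_dist E"
  proof
    show "2 * \<gamma> < real DIM(real ^ 'n)" unfolding \<gamma>(3) using N by simp
    show "bounded E" using assms(5) by (rule compact_imp_bounded)
    show "\<exists>t\<in>E. farthest_dist E x = norm (x - t)" for x using attained by blast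
    show "norm (x - t) \<le> farthest_dist E x" if "t \<in> E" for x t using attained[of x] that by auto
  qed (rule assms(6))
  \<comment> \<open>The unevaluated constant between the Gaussian superposition and the Riesz
    kernel. Being positive and finite, it cancels from both sides of the potential equation.\<close>
  define C where "C = kern (damped_weight \<gamma> 0) F.e"
  have C: "C < \<infinity>" "C > 0"
    unfolding C_def using F.K_finite[of 0 F.e] kern_damped_weight_pos[of \<gamma> 0 F.e] by auto
  have kern_eq: "kern (damped_weight \<gamma> 0) (x - t) = C * riesz_kernel \<alpha> x t" for x t :: "real ^ 'n"
  proof (cases "x = t")
    \<comment> \<open>On the diagonal both sides are infinite.\<close>
    case True
    then show ?thesis
      using kern_damped_weight_0[OF F.dim] C by (simp add: riesz_kernel_def ennreal_mult_top)
  next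
    case False
    then show ?thesis
      using kern_damped_weight_eq_powr[of "x - t" F.e \<gamma>] \<gamma>(3)
      by (simp add: riesz_kernel_def C_def mult.commute)
  qed
  have u_eq: "F.u 0 x = C * ennreal (farthest_dist E x powr (\<alpha> - real CARD('n)))" for x
  proof -
    obtain \<delta> where "0 < \<delta>" "\<And>x. \<delta> \<le> farthest_dist E x" by (rule F.d_lower_bound) (rule that)
    then have "0 < farthest_dist E x" using less_le_trans by blast
    then show ?thesis
      using kern_damped_weight_scale[of "farthest_dist E x" \<gamma> F.e] \<gamma>(3)
      by (simp add: F.u_def C_def mult.commute)
  qed
  have iff: "(\<forall>x. mavg (damped_weight \<gamma> 0) \<sigma> x = F.u 0 x) \<longleftrightarrow>
      (\<forall>x. ennreal (farthest_dist E x powr (\<alpha> - real CARD('n))) = (\<integral>\<^sup>+ t. riesz_kernel \<alpha> x t \<partial>\<sigma>))"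
    if \<sigma>: "prob_space \<sigma>" "sets \<sigma> = sets borel" for \<sigma>
  proof -
    note [measurable_cong] = \<sigma>(2)
    have pot: "mavg (damped_weight \<gamma> 0) \<sigma> x = C * (\<integral>\<^sup>+ t. riesz_kernel \<alpha> x t \<partial>\<sigma>)" for x
    proof -
      have [measurable]: "riesz_kernel \<alpha> x \<in> borel_measurable borel"
        unfolding riesz_kernel_def by measurable
      have "mavg (damped_weight \<gamma> 0) \<sigma> x = (\<integral>\<^sup>+ t. C * riesz_kernel \<alpha> x t \<partial>\<sigma>)"
        using \<sigma> by (simp add: mavg_eq_kern prob_space_imp_sigma_finite kern_eq)
      then show ?thesis by (simp add: nn_integral_cmult)
    qed
    show ?thesis
      unfolding pot u_eq ennreal_mult_cancel_left using C by (metis infinity_ennreal_def less_irrefl)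
  qed
  obtain \<sigma> where \<sigma>: "prob_space \<sigma>" "sets \<sigma> = sets borel" "\<And>x. mavg (damped_weight \<gamma> 0) \<sigma> x = F.u 0 x"
    by (rule F.equilibrium_exists) (rule that)
  show ?thesis
  proof (rule ex1I[of _ \<sigma>])
    show "sets \<sigma> = sets borel \<and> prob_space \<sigma> \<and>
      (\<forall>x. ennreal (farthest_dist E x powr (\<alpha> - real CARD('n))) = (\<integral>\<^sup>+ t. riesz_kernel \<alpha> x t \<partial>\<sigma>))"
      using \<sigma> iff[OF \<sigma>(1,2)] by simp
  next
    fix \<tau> :: "(real ^ 'n) measure"
    assume "sets \<tau> = sets borel \<and> prob_space \<tau> \<and>
      (\<forall>x. ennreal (farthest_dist E x powr (\<alpha> - real CARD('n))) = (\<integral>\<^sup>+ t. riesz_kernel \<alpha> x t \<partial>\<tau>))"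
    then have \<tau>: "prob_space \<tau>" "sets \<tau> = sets borel" "\<And>x. mavg (damped_weight \<gamma> 0) \<tau> x = F.u 0 x"
      using iff[of \<tau>] by auto
    show "\<tau> = \<sigma>"
      by (rule F.equilibrium_unique[OF prob_space.finite_measure[OF \<tau>(1)] \<tau>(2,3) prob_space.finite_measure[OF \<sigma>(1)] \<sigma>(2,3)])
  qed
qed

end
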